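(* Let $N_0,k\in\mathbb{N}$, let $\Omega\subset\mathbb{R}^{N_0}$ be a bounded Lipschitz domain, and let $\mathbb{U}=\mathbb{V}=H^k(\Omega)$ be the standard (real) Sobolev space of order $k$. Let $\mathbb{P}$ be a compact topological space and let $\mu$ be a probability measure on $\mathbb{P}$. For each $p\in\mathbb{P}$ let $\mathscr{B}^p:\mathbb{U}\to\mathbb{V}^*$ be a bounded linear operator and $l^p\in\mathbb{V}^*$, and suppose that there are constants $0<\gamma\le\vartheta<\infty$, independent of $p$, such that for all $p\in\mathbb{P}$ $$\sup_{u\in\mathbb{U}\setminus\{0\}}\ \sup_{v\in\mathbb{V}\setminus\{0\}}\frac{|\langle\mathscr{B}^pu,v\rangle_{\mathbb{V}^*\times\mathbb{V}}|}{\|u\|_{\mathbb{U}}\|v\|_{\mathbb{V}}}\le\vartheta,\qquad \inf_{u\in\mathbb{U}\setminus\{0\}}\ \sup_{v\in\mathbb{V}\setminus\{0\}}\frac{|\langle\mathscr{B}^pu,v\rangle_{\mathbb{V}^*\times\mathbb{V}}|}{\|u\|_{\mathbb{U}}\|v\|_{\mathbb{V}}}\ge\gamma .$$ For each $p\in\mathbb{P}$ let $\mathfrak{u}^p\in\mathbb{U}$ be the solution of $$\langle\mathscr{B}^p\mathfrak{u}^p,v\rangle_{\mathbb{V}^*\times\mathbb{V}}=\langle l^p,v\rangle_{\mathbb{V}^*\times\mathbb{V}}\qquad\forall v\in\mathbb{V}$$ (assumed to exist), and assume that the map $\mathbb{P}\ni p\mapsto\mathfrak{u}^p\in\mathbb{U}$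 is $\mu$-measurable and continuous. Then for every $\epsilon>0$ there exist $N\in\mathbb{N}$ and a set of parameters (weights and biases) $\alpha_\epsilon$ yielding a fully-connected feed-forward neural network $\mathbf{u}^{\alpha_\epsilon}=(u_1^{\alpha_\epsilon},\dots,u_N^{\alpha_\epsilon}):\Omega\to\mathbb{R}^N$ such that $$\int_{\mathbb{P}}\|u^{p,\alpha_\epsilon}-\mathfrak{u}^p\|_{\mathbb{U}}^2\,d\mu(p)<\epsilon\qquad\text{and}\qquad \int_{\mathbb{P}}\|\mathscr{B}^pu^{p,\alpha_\epsilon}-l^p\|_{\mathbb{V}^*}^2\,d\mu(p)<\epsilon,$$ where, for each $p\in\mathbb{P}$, $u^{p,\alpha_\epsilon}:=\mathbf{c}^{p,\alpha_\epsilon}\cdot\mathbf{u}^{\alpha_\epsilon}=\sum_{n=1}^Nc_n^{p,\alpha_\epsilon}u_n^{\alpha_\epsilon}:\Omega\to\mathbb{R}$ and $$\mathbf{c}^{p,\alpha_\epsilon}\in\arg\min_{\mathbf{c}\in\mathbb{R}^N}\|\mathscr{B}^p(\mathbf{c}\cdot\mathbf{u}^{\alpha_\epsilon})-l^p\|_{\mathbb{V}^*}^2 .$$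
   Context: $\mathbb{V}^*$ is the topological dual of $\mathbb{V}$, $\langle\cdot,\cdot\rangle_{\mathbb{V}^*\times\mathbb{V}}$ is the duality pairing, and $\|\ell\|_{\mathbb{V}^*}=\sup_{v\in\mathbb{V}\setminus\{0\}}|\langle \ell,v\rangle_{\mathbb{V}^*\times\mathbb{V}}|/\|v\|_{\mathbb{V}}$. A fully-connected feed-forward neural network from $\Omega\subset\mathbb{R}^{N_0}$ to $\mathbb{R}^N$ of depth $K\in\mathbb{N}$ is a function $L_K\circ L_{K-1}\circ\cdots\circ L_1$ of the input $x$, where, for $k=1,\dots,K$, the layer $L_k$ maps $z\in\mathbb{R}^{N_{k-1}}$ to $\sigma(A_kz+b_k)\in\mathbb{R}^{N_k}$, with weight matrix $A_k\in\mathbb{R}^{N_k\times N_{k-1}}$, bias vector $b_k\in\mathbb{R}^{N_k}$, $N_K=N$, and $\sigma(t)=1/(1+e^{-t})$ the sigmoid activation function applied component-wise. The depth $K$ and the widths $N_1,\dots,N_{K-1}$ are free (may be chosen depending on $\epsilon$), and $\alpha$ denotes the collection of all entries of the $A_k$ and $b_k$. If the functions $u_n^{\alpha_\epsilon}$ are linearly dependent, the minimizing coefficient vector need not be unique, but the function $u^{p,\alpha_\epsilon}$ is; it is the minimum-residual element of $\mathrm{span}\{u_n^{\alpha_\epsilon}\}_{n=1}^N$. *)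

theory Defs
  imports "HOL-Probability.Probability"
begin

(* Bounded Lipschitz domains: near each boundary point, and in suitable orthogonal
   coordinates with vertical axis e, the set is the strict epigraph of a Lipschitz function g
   of the remaining coordinates y - (y . e) e. *)

definition lipschitz_boundary :: "(real^'n) set \<Rightarrow> bool" where
  "lipschitz_boundary \<Omega> \<longleftrightarrow>
     (\<forall>x\<in>frontier \<Omega>. \<exists>r>0. \<exists>e L g. norm e = 1 \<and> L-lipschitz_on {z. z \<bullet> e = 0} (g :: real^'n \<Rightarrow> real) \<and>
        \<Omega> \<inter> ball x r = {y \<in> ball x r. g (y - (y \<bullet> e) *\<^sub>R e) < y \<bullet> e})"

definition bounded_lipschitz_domain :: "(real^'n) set \<Rightarrow> bool" where
  "bounded_lipschitz_domain \<Omega> \<longleftrightarrow>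
     \<Omega> \<noteq> {} \<and> open \<Omega> \<and> connected \<Omega> \<and> bounded \<Omega> \<and> lipschitz_boundary \<Omega>"

definition partial_deriv :: "'n \<Rightarrow> (real^'n \<Rightarrow> real) \<Rightarrow> real^'n \<Rightarrow> real" where
  "partial_deriv i f = (\<lambda>x. frechet_derivative f (at x) (axis i 1))"

primrec C_k :: "nat \<Rightarrow> (real^'n \<Rightarrow> real) \<Rightarrow> bool" where
  "C_k 0 f \<longleftrightarrow> continuous_on UNIV f"
| "C_k (Suc k) f \<longleftrightarrow> (\<forall>x. f differentiable (at x)) \<and> (\<forall>i. C_k k (partial_deriv i f))"

(* Functions in C_c^infinity(Omega), extended by zero to the whole space. *)
definition test_function :: "(real^'n) set \<Rightarrow> (real^'n \<Rightarrow> real) \<Rightarrow> bool" where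
  "test_function \<Omega> \<phi> \<longleftrightarrow>
     (\<forall>k. C_k k \<phi>) \<and> compact (closure {x. \<phi> x \<noteq> 0}) \<and> closure {x. \<phi> x \<noteq> 0} \<subseteq> \<Omega>"

(* Multi-indices are functions 'n => nat. Since 'n is finite, from_nat_into UNIV restricts to
   a bijection from {..<CARD('n)} onto 'n; on smooth functions the order in
   which the directions are enumerated is immaterial. *)
definition multi_deriv :: "('n::finite \<Rightarrow> nat) \<Rightarrow> (real^'n \<Rightarrow> real) \<Rightarrow> real^'n \<Rightarrow> real" where
  "multi_deriv \<alpha> =
     fold (\<lambda>i. partial_deriv i ^^ \<alpha> i) (map (from_nat_into UNIV) [0..<CARD('n)])"

(* Elements of L^2(Omega) and H^k(Omega) are represented by functions on the whole space;
   only their values on Omega matter, and functions that agree almost everywhere on Omega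
   represent the same element. *)

definition L2 :: "(real^'n) set \<Rightarrow> (real^'n \<Rightarrow> real) set" where
  "L2 \<Omega> = {u \<in> borel_measurable (lebesgue_on \<Omega>). integrable (lebesgue_on \<Omega>) (\<lambda>x. (u x)\<^sup>2)}"

definition is_weak_deriv ::
    "(real^'n) set \<Rightarrow> ('n::finite \<Rightarrow> nat) \<Rightarrow> (real^'n \<Rightarrow> real) \<Rightarrow> (real^'n \<Rightarrow> real) \<Rightarrow> bool" where
  "is_weak_deriv \<Omega> \<alpha> u w \<longleftrightarrow>
     (\<forall>\<phi>. test_function \<Omega> \<phi> \<longrightarrow>
        (\<integral>x. u x * multi_deriv \<alpha> \<phi> x \<partial>lebesgue_on \<Omega>) =
        (-1) ^ (\<Sum>i\<in>UNIV. \<alpha> i) * (\<integral>x. w x * \<phi> x \<partial>lebesgue_on \<Omega>))"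

definition sobolev :: "nat \<Rightarrow> (real^'n) set \<Rightarrow> (real^'n \<Rightarrow> real) set" where
  "sobolev k \<Omega> =
     {u \<in> L2 \<Omega>. \<forall>\<alpha>. (\<Sum>i\<in>UNIV. \<alpha> i) \<le> k \<longrightarrow> (\<exists>w\<in>L2 \<Omega>. is_weak_deriv \<Omega> \<alpha> u w)}"

(* Weak derivatives are unique almost everywhere on Omega, so the choice does not affect
   the norm below. *)
definition weak_deriv ::
    "(real^'n) set \<Rightarrow> ('n::finite \<Rightarrow> nat) \<Rightarrow> (real^'n \<Rightarrow> real) \<Rightarrow> real^'n \<Rightarrow> real" where
  "weak_deriv \<Omega> \<alpha> u = (SOME w. w \<in> L2 \<Omega> \<and> is_weak_deriv \<Omega> \<alpha> u w)"

definition sobolev_norm :: "nat \<Rightarrow> (real^'n) set \<Rightarrow> (real^'n \<Rightarrow> real) \<Rightarrow> real" where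
  "sobolev_norm k \<Omega> u =
     sqrt (\<Sum>\<alpha> | (\<Sum>i\<in>UNIV. \<alpha> i) \<le> k. \<integral>x. (weak_deriv \<Omega> \<alpha> u x)\<^sup>2 \<partial>lebesgue_on \<Omega>)"

definition sobolev_topology :: "nat \<Rightarrow> (real^'n) set \<Rightarrow> (real^'n \<Rightarrow> real) topology" where
  "sobolev_topology k \<Omega> = topology_generated_by
     {{w \<in> sobolev k \<Omega>. sobolev_norm k \<Omega> (\<lambda>x. w x - u x) < r} |u r. u \<in> sobolev k \<Omega> \<and> 0 < r}"

(* Spaces of representatives: V is a set of functions closed under linear combinations, nrm
   a seminorm on V whose null functions are the representatives of zero. Bounded linear
   functionals are then automatically well defined on classes, and V - {0} is nonzero V nrm.
   Functionals are relevant only through their values on V. *)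

definition nonzero :: "('a \<Rightarrow> real) set \<Rightarrow> (('a \<Rightarrow> real) \<Rightarrow> real) \<Rightarrow> ('a \<Rightarrow> real) set" where
  "nonzero V nrm = {v \<in> V. nrm v \<noteq> 0}"

definition linear_functional_on :: "('a \<Rightarrow> real) set \<Rightarrow> (('a \<Rightarrow> real) \<Rightarrow> real) \<Rightarrow> bool" where
  "linear_functional_on V l \<longleftrightarrow>
     (\<forall>u\<in>V. \<forall>v\<in>V. l (\<lambda>x. u x + v x) = l u + l v) \<and> (\<forall>a. \<forall>v\<in>V. l (\<lambda>x. a * v x) = a * l v)"

definition dual_space ::
    "('a \<Rightarrow> real) set \<Rightarrow> (('a \<Rightarrow> real) \<Rightarrow> real) \<Rightarrow> (('a \<Rightarrow> real) \<Rightarrow> real) set" where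
  "dual_space V nrm = {l. linear_functional_on V l \<and> (\<exists>C. \<forall>v\<in>V. \<bar>l v\<bar> \<le> C * nrm v)}"

definition dual_norm ::
    "('a \<Rightarrow> real) set \<Rightarrow> (('a \<Rightarrow> real) \<Rightarrow> real) \<Rightarrow> (('a \<Rightarrow> real) \<Rightarrow> real) \<Rightarrow> real" where
  "dual_norm V nrm l = (SUP v\<in>nonzero V nrm. \<bar>l v\<bar> / nrm v)"

(* T maps V boundedly and linearly into its dual; T u v is the duality pairing <T u, v>. *)
definition bounded_operator_to_dual ::
    "('a \<Rightarrow> real) set \<Rightarrow> (('a \<Rightarrow> real) \<Rightarrow> real) \<Rightarrow> (('a \<Rightarrow> real) \<Rightarrow> ('a \<Rightarrow> real) \<Rightarrow> real) \<Rightarrow> bool" where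
  "bounded_operator_to_dual V nrm T \<longleftrightarrow>
     (\<forall>u\<in>V. T u \<in> dual_space V nrm) \<and> (\<forall>v\<in>V. linear_functional_on V (\<lambda>u. T u v)) \<and>
     (\<exists>C. \<forall>u\<in>V. dual_norm V nrm (T u) \<le> C * nrm u)"

definition sigmoid :: "real \<Rightarrow> real" where
  "sigmoid t = 1 / (1 + exp (- t))"

(* Output of the k-th layer, with widths W, weight matrices A k and bias vectors b k. Vectors
   in R^(W k) are functions nat => real of which only the components below W k are
   used; layer 0 is the input x, with W 0 = CARD('n) understood. The activation function
   is applied in every layer, the last one included. *)
primrec nn_layer ::
    "(nat \<Rightarrow> nat) \<Rightarrow> (nat \<Rightarrow> nat \<Rightarrow> nat \<Rightarrow> real) \<Rightarrow> (nat \<Rightarrow> nat \<Rightarrow> real) \<Rightarrow> nat \<Rightarrow> real^'n \<Rightarrow> nat \<Rightarrow> real" where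
  "nn_layer W A b 0 x = (\<lambda>j. x $ from_nat_into UNIV j)"
| "nn_layer W A b (Suc k) x =
     (\<lambda>i. sigmoid ((\<Sum>j<W k. A (Suc k) i j * nn_layer W A b k x j) + b (Suc k) i))"

definition neural_network :: "nat \<Rightarrow> (nat \<Rightarrow> real^'n \<Rightarrow> real) \<Rightarrow> bool" where
  "neural_network N u \<longleftrightarrow>
     (\<exists>K W A b. 1 \<le> K \<and> W 0 = CARD('n) \<and> (\<forall>k\<le>K. 1 \<le> W k) \<and> W K = N \<and>
        (\<forall>n<N. \<forall>x. u n x = nn_layer W A b K x n))"

definition lin_comb :: "nat \<Rightarrow> (nat \<Rightarrow> real) \<Rightarrow> (nat \<Rightarrow> 'a \<Rightarrow> real) \<Rightarrow> 'a \<Rightarrow> real" where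
  "lin_comb N c u = (\<lambda>x. \<Sum>n<N. c n * u n x)"

(* Coefficient vectors c in R^N are functions of which only the components below N matter. *)
definition is_residual_minimizer ::
    "('a \<Rightarrow> real) set \<Rightarrow> (('a \<Rightarrow> real) \<Rightarrow> real) \<Rightarrow> (('a \<Rightarrow> real) \<Rightarrow> ('a \<Rightarrow> real) \<Rightarrow> real) \<Rightarrow>
     (('a \<Rightarrow> real) \<Rightarrow> real) \<Rightarrow> nat \<Rightarrow> (nat \<Rightarrow> 'a \<Rightarrow> real) \<Rightarrow> (nat \<Rightarrow> real) \<Rightarrow> bool" where
  "is_residual_minimizer V nrm T l N u =
     is_arg_min (\<lambda>c. (dual_norm V nrm (\<lambda>v. T (lin_comb N c u) v - l v))\<^sup>2) (\<lambda>_. True)"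

end

theory Submission
  imports Defs
begin

text \<open>Minimizing the residual over the span of the network components is quasi-optimal: by the inf-sup
  condition the error of the minimizer is at most \<open>\<theta> / \<gamma>\<close> times the error of every other element of
  the span (\<open>quasi_optimal\<close>). Hence one network has to be found whose span comes close to all
  solutions \<open>usol p\<close> at once. The solutions form the continuous image of a compact space, so finitely
  many of them represent all up to a small error (\<open>uniform_approximation\<close>), and networks for finitely
  many functions are put side by side (\<open>common_network\<close>). Since the integrands are then uniformly
  small and \<open>M\<close> is a probability measure, everything rests on one density statement: the linear
  combinations of functions \<open>sigmoid (w \<bullet> x + b)\<close> are dense in the Sobolev space of a bounded
  Lipschitz domain (\<open>sigmoid_sums_dense\<close>). That a minimizer exists, although the components may be
  linearly dependent, is compactness in finite dimension with respect to a seminorm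
  (\<open>minimizer_exists\<close>).

  Density is reached through two intermediate classes. First, smooth functions on the whole space are
  dense (\<open>smooth_approximation\<close>). Near a boundary point the Lipschitz condition provides cones of fixed
  shape inside the domain; convolution with a mollifier supported in the reflected cone uses values of
  \<open>u\<close> inside the domain only, so that its derivatives are mollified weak derivatives and converge in
  the mean by continuity of translations. The local approximations are glued with cutoff functions.

  Second, every function built in this way is a limit, with all derivatives up to order \<open>k\<close>, of sums
  of exponentials \<open>c * exp (w \<bullet> x)\<close>. The cutoffs and mollifiers are products of functions of one
  coordinate, which are approximated by polynomials (Weierstrass, for the highest derivative), and
  polynomials are limits of exponential sums because \<open>(exp (h t) - 1) / h\<close> tends to \<open>t\<close>. Exponential
  sums are closed under products and under convolution with \<open>u\<close>, which covers the gluing and the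
  mollification. Third, \<open>exp m * sigmoid (t - m) = exp t * (1 - sigmoid (t - m))\<close> tends to \<open>exp t\<close> with
  all derivatives, so exponentials are limits of sigmoid units (\<open>exp_in_sigmoid_closure\<close>).

  Convergence of derivatives is always defined by recursion on the order, one partial derivative at a
  time. Products are then handled by the product rule alone. Commuting partial derivatives is avoided:
  the only functions for which the order of differentiation matters are the mollifiers, and as tensor
  products their derivatives are explicit.\<close>

section \<open>Smooth bumps on the line\<close>

text \<open>Differentiability up to a fixed order. Since the order is explicit, closure under products and
  inverses is a plain induction with the product rule.\<close>

primrec smooth1 :: "nat \<Rightarrow> (real \<Rightarrow> real) \<Rightarrow> bool" where
  "smooth1 0 f \<longleftrightarrow> True"
| "smooth1 (Suc k) f \<longleftrightarrow> (\<exists>f'. (\<forall>t. (f has_real_derivative f' t) (at t)) \<and> smooth1 k f')"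

lemma smooth1_SucD: "smooth1 (Suc k) f \<Longrightarrow> smooth1 k f"
proof (induction k arbitrary: f)
  case (Suc k)
  then show ?case by (metis smooth1.simps(2))
qed simp

lemma smooth1_const: "smooth1 k (\<lambda>_. c)"
proof (induction k arbitrary: c)
  case (Suc k)
  show ?case
    unfolding smooth1.simps
    by (rule exI[of _ "\<lambda>_. 0"]) (auto intro: Suc)
qed simp

lemma smooth1_add: "smooth1 k f \<Longrightarrow> smooth1 k g \<Longrightarrow> smooth1 k (\<lambda>t. f t + g t)"
proof (induction k arbitrary: f g)
  case (Suc k)
  then obtain f' g' where *: "\<And>t. (f has_real_derivative f' t) (at t)" "smooth1 k f'"
    "\<And>t. (g has_real_derivative g' t) (at t)" "smooth1 k g'"
    by auto
  show ?case
    unfolding smooth1.simps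
    by (rule exI[of _ "\<lambda>t. f' t + g' t"]) (auto intro!: Suc.IH * DERIV_add)
qed simp

lemma smooth1_mult: "smooth1 k f \<Longrightarrow> smooth1 k g \<Longrightarrow> smooth1 k (\<lambda>t. f t * g t)"
proof (induction k arbitrary: f g)
  case (Suc k)
  then obtain f' g' where *: "\<And>t. (f has_real_derivative f' t) (at t)" "smooth1 k f'"
    "\<And>t. (g has_real_derivative g' t) (at t)" "smooth1 k g'"
    by auto
  show ?case
    unfolding smooth1.simps
    by (rule exI[of _ "\<lambda>t. f' t * g t + g' t * f t"])
      (auto intro!: Suc.IH smooth1_add * DERIV_mult smooth1_SucD[OF Suc.prems(1)] smooth1_SucD[OF Suc.prems(2)])
qed simp

lemma smooth1_inverse:
  assumes "\<And>t. f t \<noteq> 0"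
  shows "smooth1 k f \<Longrightarrow> smooth1 k (\<lambda>t. inverse (f t))"
proof (induction k)
  case (Suc k)
  then obtain f' where *: "\<And>t. (f has_real_derivative f' t) (at t)" "smooth1 k f'"
    by auto
  have i: "smooth1 k (\<lambda>t. inverse (f t))"
    using Suc smooth1_SucD by blast
  have "((\<lambda>t. inverse (f t)) has_real_derivative (-1) * (f' t * (inverse (f t) * inverse (f t)))) (at t)" for t
    using DERIV_inverse_fun[OF *(1) assms, of t] by (simp add: mult_ac power2_eq_square)
  moreover have "smooth1 k (\<lambda>t. (-1) * (f' t * (inverse (f t) * inverse (f t))))"
    by (intro smooth1_mult smooth1_const i *)
  ultimately show ?case
    unfolding smooth1.simps
    by (intro exI[of _ "\<lambda>t. (-1) * (f' t * (inverse (f t) * inverse (f t)))"]) auto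
qed simp

lemma smooth1_affine: "smooth1 k f \<Longrightarrow> smooth1 k (\<lambda>t. f (a * t + b))"
proof (induction k arbitrary: f)
  case (Suc k)
  then obtain f' where *: "\<And>t. (f has_real_derivative f' t) (at t)" "smooth1 k f'"
    by auto
  have "((\<lambda>t. f (a * t + b)) has_real_derivative a * f' (a * t + b)) (at t)" for t
    by (rule DERIV_cong[OF DERIV_chain2[OF *(1)]]) (auto intro!: derivative_eq_intros)
  moreover have "smooth1 k (\<lambda>t. a * f' (a * t + b))"
    by (intro smooth1_mult smooth1_const Suc.IH *)
  ultimately show ?case
    unfolding smooth1.simps by (intro exI[of _ "\<lambda>t. a * f' (a * t + b)"]) auto
qed simp

lemma poly_times_exp_tendsto_0: "((\<lambda>s. poly p s * exp (- s)) \<longlongrightarrow> (0::real)) at_top"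
proof -
  have "((\<lambda>s. \<Sum>i\<le>degree p. coeff p i * (s ^ i / exp s)) \<longlongrightarrow> (\<Sum>i\<le>degree p. coeff p i * (0::real))) at_top"
    by (intro tendsto_sum tendsto_mult tendsto_const tendsto_power_div_exp_0)
  then show ?thesis
    by (simp add: poly_altdef exp_minus divide_inverse sum_distrib_right mult.assoc)
qed

text \<open>The family that contains \<open>exp (- 1 / t)\<close>, cut off at \<open>0\<close>, together with
  all its derivatives: differentiation only changes the polynomial.\<close>

definition flat :: "real poly \<Rightarrow> real \<Rightarrow> real" where
  "flat p t = (if 0 < t then poly p (1 / t) * exp (- 1 / t) else 0)"

text \<open>At \<open>0\<close> the exponential beats every power of \<open>1 / t\<close>; elsewhere this is
  the chain rule.\<close>

lemma flat_has_derivative: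
  "(flat p has_real_derivative flat (pCons 0 (pCons 0 (p - pderiv p))) t) (at t)"
proof -
  consider "t < 0" | "t = 0" | "0 < t" by linarith
  then show ?thesis
  proof cases
    case 1
    have "((\<lambda>_. 0) has_real_derivative 0) (at t)" by simp
    then have "(flat p has_real_derivative 0) (at t)"
      by (rule has_field_derivative_transform_within_open[of _ _ _ "{..<0}"])
        (use 1 in \<open>auto simp: flat_def\<close>)
    then show ?thesis using 1 by (simp add: flat_def)
  next
    case 3
    have "((\<lambda>t. poly p (1 / t) * exp (- 1 / t)) has_real_derivative
        flat (pCons 0 (pCons 0 (p - pderiv p))) t) (at t)"
      using 3
      by (auto intro!: derivative_eq_intros DERIV_chain2[OF poly_DERIV] simp: flat_def field_simps power2_eq_square)
    then show ?thesis
      by (rule has_field_derivative_transform_within_open[of _ _ _ "{0<..}"])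
        (use 3 in \<open>auto simp: flat_def\<close>)
  next
    case 2
    have r: "((\<lambda>h. flat p h / h) \<longlongrightarrow> 0) (at_right 0)"
    proof -
      have "((\<lambda>h. poly (pCons 0 p) (inverse h) * exp (- (inverse h))) \<longlongrightarrow> (0::real)) (at_right 0)"
        by (rule filterlim_compose[OF poly_times_exp_tendsto_0 filterlim_inverse_at_top_right])
      moreover have "eventually (\<lambda>h. poly (pCons 0 p) (inverse h) * exp (- (inverse h)) = flat p h / h) (at_right 0)"
        unfolding eventually_at_right_field
        by (rule exI[of _ 1]) (auto simp: flat_def field_simps inverse_eq_divide)
      ultimately show ?thesis
        by (rule Lim_transform_eventually)
    qed
    have l: "((\<lambda>h. flat p h / h) \<longlongrightarrow> 0) (at_left 0)"
      by (rule Lim_transform_eventually[of "\<lambda>_. 0"])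
        (auto simp: eventually_at_left_field flat_def intro!: exI[of _ "-1"])
    have "((\<lambda>h. flat p h / h) \<longlongrightarrow> 0) (at 0)"
      using l r by (simp add: filterlim_at_split)
    then show ?thesis
      using 2 by (simp add: DERIV_def flat_def)
  qed
qed

lemma smooth1_flat: "smooth1 k (flat p)"
proof (induction k arbitrary: p)
  case (Suc k)
  show ?case
    unfolding smooth1.simps
    by (rule exI[of _ "flat (pCons 0 (pCons 0 (p - pderiv p)))"]) (auto intro: Suc flat_has_derivative)
qed simp

lemma flat_1: "flat 1 t = (if 0 < t then exp (- 1 / t) else 0)"
  by (simp add: flat_def)

text \<open>The quotient of \<open>flat 1 t\<close> by \<open>flat 1 t + flat 1 (1 - t)\<close> is a smooth
  step from \<open>0\<close> to \<open>1\<close> because its denominator never vanishes. A rising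
  and a falling step multiply to a plateau, which serves both as a cutoff function and, after
  normalization, as a mollifier. The derivatives are listed in \<open>b\<close> so that tensor
  products can be differentiated in closed form.\<close>

lemma smooth_plateau_exists:
  obtains b :: "nat \<Rightarrow> real \<Rightarrow> real"
  where "\<And>j t. (b j has_real_derivative b (Suc j) t) (at t)"
    and "\<And>t. 0 \<le> b 0 t" and "\<And>t. \<bar>t\<bar> \<le> 1 \<Longrightarrow> b 0 t = 1" and "\<And>t. 2 \<le> \<bar>t\<bar> \<Longrightarrow> b 0 t = 0"
proof -
  define step where "step t = flat 1 t * inverse (flat 1 t + flat 1 ((-1) * t + 1))" for t
  define f where "f t = step (1 * t + 2) * step ((-1) * t + 2)" for t
  have "flat 1 t + flat 1 ((-1) * t + 1) \<noteq> 0" for t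
    by (smt (verit) exp_gt_zero flat_1)
  then have "smooth1 k step" for k
    unfolding step_def by (intro smooth1_mult smooth1_inverse smooth1_add smooth1_affine smooth1_flat)
  then have sf: "smooth1 k f" for k
    unfolding f_def by (intro smooth1_mult smooth1_affine)
  define b where "b j = (deriv ^^ j) f" for j
  have step_nonneg: "0 \<le> step t" for t
    by (auto simp: step_def flat_1 intro!: mult_nonneg_nonneg add_nonneg_nonneg)
  have step_1: "step t = 1" if "1 \<le> t" for t
    using that by (simp add: step_def flat_1)
  have step_0: "step t = 0" if "t \<le> 0" for t
    using that by (simp add: step_def flat_1)
  have sb: "smooth1 k (b j)" for j k
  proof (induction j arbitrary: k)
    case (Suc j)
    from Suc[of "Suc k"] obtain f' where "\<And>t. (b j has_real_derivative f' t) (at t)" "smooth1 k f'"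
      by auto
    moreover from this have "b (Suc j) = f'"
      by (auto simp: b_def DERIV_imp_deriv)
    ultimately show ?case by simp
  qed (simp add: b_def sf)
  have "(b j has_real_derivative b (Suc j) t) (at t)" for j t
  proof -
    from sb[of "Suc 0" j] obtain f' where *: "\<And>t. (b j has_real_derivative f' t) (at t)"
      by auto
    then have "b (Suc j) = f'"
      by (auto simp: b_def DERIV_imp_deriv)
    with * show ?thesis by simp
  qed
  moreover have "0 \<le> b 0 t" for t
    by (simp add: b_def f_def step_nonneg)
  moreover have "b 0 t = 1" if "\<bar>t\<bar> \<le> 1" for t
    using that by (simp add: b_def f_def step_1)
  moreover have "b 0 t = 0" if "2 \<le> \<bar>t\<bar>" for t
    using that step_0[of "t + 2"] step_0[of "2 - t"] by (cases "0 \<le> t") (auto simp: b_def f_def add.commute)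
  ultimately show ?thesis
    using that by blast
qed


section \<open>Smooth functions and uniform convergence of derivatives\<close>

lemma partial_deriv_eq:
  "(f has_derivative f') (at x) \<Longrightarrow> partial_deriv i f x = f' (axis i 1)"
  unfolding partial_deriv_def by (metis frechet_derivative_at)

definition smooth :: "(real^'n \<Rightarrow> real) \<Rightarrow> bool" where
  "smooth f \<longleftrightarrow> (\<forall>k. C_k k f)"

lemma smooth_differentiable: "smooth f \<Longrightarrow> f differentiable (at x)"
  unfolding smooth_def using C_k.simps(2) by blast

lemma smooth_has_derivative: "smooth f \<Longrightarrow> (f has_derivative frechet_derivative f (at x)) (at x)"
  using smooth_differentiable frechet_derivative_works by blast

lemma smooth_partial: "smooth f \<Longrightarrow> smooth (partial_deriv i f)"
  unfolding smooth_def using C_k.simps(2) by blast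

lemma smooth_continuous: "smooth f \<Longrightarrow> continuous_on S f"
  unfolding smooth_def using C_k.simps(1) continuous_on_subset by blast

text \<open>Smoothness is the largest property that implies differentiability and passes to partial
  derivatives; closed-form families are shown to be smooth in this way.\<close>

lemma smooth_coinduct:
  assumes X: "\<And>f. f \<in> X \<Longrightarrow> (\<forall>x. f differentiable (at x)) \<and> (\<forall>i. partial_deriv i f \<in> X)"
    and f: "f \<in> X"
  shows "smooth f"
proof -
  have "C_k k f" if "f \<in> X" for k f
    using that
  proof (induction k arbitrary: f)
    case 0
    then show ?case
      using X[OF 0] by (auto intro!: continuous_at_imp_continuous_on differentiable_imp_continuous_within)
  next
    case (Suc k)
    then show ?case using X by auto
  qed
  with f show ?thesis by (auto simp: smooth_def)
qed

lemma partial_deriv_add: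
  assumes "smooth f" "smooth g"
  shows "partial_deriv i (\<lambda>x. f x + g x) = (\<lambda>x. partial_deriv i f x + partial_deriv i g x)"
  by (rule ext, subst partial_deriv_eq[OF has_derivative_add[OF smooth_has_derivative smooth_has_derivative]])
    (use assms in \<open>auto simp: partial_deriv_def\<close>)

lemma partial_deriv_mult:
  assumes "smooth f" "smooth g"
  shows "partial_deriv i (\<lambda>x. f x * g x) = (\<lambda>x. partial_deriv i f x * g x + f x * partial_deriv i g x)"
  by (rule ext, subst partial_deriv_eq[OF has_derivative_mult[OF smooth_has_derivative smooth_has_derivative]])
    (use assms in \<open>auto simp: partial_deriv_def\<close>)

lemma partial_deriv_const: "partial_deriv i (\<lambda>x. c) = (\<lambda>x. 0)"
  by (rule ext, subst partial_deriv_eq[OF has_derivative_const]) auto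

lemma smooth_const: "smooth (\<lambda>x. c)"
  by (rule smooth_coinduct[of "range (\<lambda>c x. c)"]) (auto simp: partial_deriv_const)

lemma C_k_add:
  "C_k k f \<Longrightarrow> C_k k g \<Longrightarrow> C_k k (\<lambda>x. f x + g x)"
proof (induction k arbitrary: f g)
  case 0
  then show ?case by (auto intro: continuous_on_add)
next
  case (Suc k)
  have "partial_deriv i (\<lambda>x. f x + g x) = (\<lambda>x. partial_deriv i f x + partial_deriv i g x)" for i
  proof
    fix x
    have "(f has_derivative frechet_derivative f (at x)) (at x)"
      "(g has_derivative frechet_derivative g (at x)) (at x)"
      using Suc.prems by (simp_all flip: frechet_derivative_works)
    from partial_deriv_eq[OF has_derivative_add[OF this]]
    show "partial_deriv i (\<lambda>x. f x + g x) x = partial_deriv i f x + partial_deriv i g x"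
      by (simp add: partial_deriv_def)
  qed
  then show ?case
    using Suc by (auto intro: differentiable_add)
qed

lemma smooth_add: "smooth f \<Longrightarrow> smooth g \<Longrightarrow> smooth (\<lambda>x. f x + g x)"
  unfolding smooth_def by (intro allI C_k_add) auto

lemma smooth_mult:
  fixes f g :: "real^'n \<Rightarrow> real"
  assumes "smooth f" "smooth g"
  shows "smooth (\<lambda>x. f x * g x)"
proof -
  have *: "C_k k (\<lambda>x. f x * g x)" if "smooth f" "smooth g" for k and f g :: "real^'n \<Rightarrow> real"
    using that
  proof (induction k arbitrary: f g)
    case 0
    then show ?case by (simp add: continuous_on_mult smooth_continuous)
  next
    case (Suc k)
    have "(\<lambda>x. f x * g x) differentiable (at x)" for x
      by (intro differentiable_mult smooth_differentiable Suc.prems)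
    with Suc show ?case
      by (auto simp: partial_deriv_mult intro!: C_k_add smooth_partial)
  qed
  show ?thesis unfolding smooth_def by (intro allI * assms)
qed

lemma smooth_cmult: "smooth f \<Longrightarrow> smooth (\<lambda>x. c * f x)"
  by (intro smooth_mult smooth_const)

lemma smooth_diff: "smooth f \<Longrightarrow> smooth g \<Longrightarrow> smooth (\<lambda>x. f x - g x)"
  using smooth_add[OF _ smooth_cmult[of g "-1"], of f] by simp

lemma partial_deriv_transform_open:
  assumes "open S" "x \<in> S" "\<And>y. y \<in> S \<Longrightarrow> f y = g y" "f differentiable (at x)"
  shows "partial_deriv i g x = partial_deriv i f x"
proof -
  have "(f has_derivative frechet_derivative f (at x)) (at x)"
    using assms(4) frechet_derivative_works by blast
  then have "(g has_derivative frechet_derivative f (at x)) (at x)"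
    by (rule has_derivative_transform_within_open[OF _ assms(1-3)])
  from partial_deriv_eq[OF this] show ?thesis
    by (simp add: partial_deriv_def)
qed

lemma smooth_bounded_on:
  assumes "smooth f" "bounded S"
  shows "bounded (f ` S)"
proof -
  have "compact (f ` closure S)"
    using assms by (intro compact_continuous_image smooth_continuous) (auto simp: compact_closure)
  then show ?thesis
    by (meson bounded_subset closure_subset compact_imp_bounded image_mono)
qed

text \<open>Derivatives are taken one at a time and in any order. An induction on the order then needs only
  the product rule, never the general Leibniz formula.\<close>

primrec cclose :: "nat \<Rightarrow> (real^'n) set \<Rightarrow> real \<Rightarrow> (real^'n \<Rightarrow> real) \<Rightarrow> (real^'n \<Rightarrow> real) \<Rightarrow> bool" where
  "cclose 0 K e f g \<longleftrightarrow> (\<forall>x\<in>K. \<bar>f x - g x\<bar> < e)"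
| "cclose (Suc k) K e f g \<longleftrightarrow>
     (\<forall>x\<in>K. \<bar>f x - g x\<bar> < e) \<and> (\<forall>i. cclose k K e (partial_deriv i f) (partial_deriv i g))"

lemma cclose_bound: "cclose k K e f g \<Longrightarrow> x \<in> K \<Longrightarrow> \<bar>f x - g x\<bar> < e"
  by (cases k) auto

lemma cclose_refl: "0 < e \<Longrightarrow> cclose k K e f f"
  by (induction k arbitrary: f) auto

lemma cclose_triangle: "cclose k K d f g \<Longrightarrow> cclose k K e g h \<Longrightarrow> cclose k K (d + e) f h"
proof (induction k arbitrary: f g h)
  case 0
  then show ?case by fastforce
next
  case (Suc k)
  have "\<bar>f x - h x\<bar> < d + e" if "x \<in> K" for x
  proof -
    have "\<bar>f x - g x\<bar> < d" "\<bar>g x - h x\<bar> < e"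
      using Suc.prems that by auto
    then show ?thesis by linarith
  qed
  moreover have "cclose k K (d + e) (partial_deriv i f) (partial_deriv i h)" for i
    using Suc.prems by (intro Suc.IH[of _ "partial_deriv i g"]) auto
  ultimately show ?case by auto
qed

lemma cclose_mono: "cclose k K d f g \<Longrightarrow> d \<le> e \<Longrightarrow> cclose k K e f g"
  by (induction k arbitrary: f g) (auto intro: less_le_trans)

definition ulim :: "nat \<Rightarrow> (real^'n) set \<Rightarrow> (nat \<Rightarrow> real^'n \<Rightarrow> real) \<Rightarrow> (real^'n \<Rightarrow> real) \<Rightarrow> bool" where
  "ulim k K s g \<longleftrightarrow> (\<forall>e>0. \<forall>\<^sub>F m in sequentially. cclose k K e (s m) g)"

lemma ulim_0: "ulim 0 K s g \<longleftrightarrow> uniform_limit K s g sequentially"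
  by (simp add: ulim_def uniform_limit_iff dist_real_def)

lemma ulim_Suc:
  "ulim (Suc k) K s g \<longleftrightarrow> uniform_limit K s g sequentially \<and>
     (\<forall>i. ulim k K (\<lambda>m. partial_deriv i (s m)) (partial_deriv i g))"
proof -
  have "(\<forall>\<^sub>F m in sequentially. \<forall>i. Q m i) \<longleftrightarrow> (\<forall>i. \<forall>\<^sub>F m in sequentially. Q m i)"
    for Q :: "nat \<Rightarrow> 'a \<Rightarrow> bool"
    by (auto intro: eventually_all_finite elim: eventually_mono)
  then show ?thesis
    unfolding ulim_def uniform_limit_iff dist_real_def cclose.simps eventually_conj_iff by auto
qed

lemma ulim_SucD: "ulim (Suc k) K s g \<Longrightarrow> ulim k K s g"
  by (induction k arbitrary: s g) (auto simp: ulim_Suc ulim_0)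

lemma ulim_const: "ulim k K (\<lambda>_. g) g"
  by (simp add: ulim_def cclose_refl)

lemma ulim_add:
  assumes "\<And>m. smooth (s m)" "\<And>m. smooth (t m)" "smooth g" "smooth h" "ulim k K s g" "ulim k K t h"
  shows "ulim k K (\<lambda>m x. s m x + t m x) (\<lambda>x. g x + h x)"
  using assms
proof (induction k arbitrary: s t g h)
  case 0
  then show ?case by (simp add: ulim_0 uniform_limit_add)
next
  case (Suc k)
  then show ?case
    by (auto simp: ulim_Suc partial_deriv_add intro!: uniform_limit_add Suc.IH smooth_partial)
qed

text \<open>Both factors and their limits are bounded on \<open>K\<close>, and the product rule reduces order
  \<open>k + 1\<close> to order \<open>k\<close>.\<close>

lemma ulim_mult:
  assumes "\<And>m. smooth (s m)" "\<And>m. smooth (t m)" "smooth g" "smooth h" "ulim k K s g" "ulim k K t h"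
    and "bounded K"
  shows "ulim k K (\<lambda>m x. s m x * t m x) (\<lambda>x. g x * h x)"
  using assms
proof (induction k arbitrary: s t g h)
  case 0
  then show ?case by (simp add: ulim_0 uniform_lim_mult smooth_bounded_on)
next
  case (Suc k)
  have "ulim k K s g" "ulim k K t h"
    using Suc.prems(5,6) by (auto intro: ulim_SucD)
  moreover have "ulim k K (\<lambda>m. partial_deriv i (s m)) (partial_deriv i g)"
    "ulim k K (\<lambda>m. partial_deriv i (t m)) (partial_deriv i h)" for i
    using Suc.prems by (auto simp: ulim_Suc)
  ultimately show ?case
    unfolding ulim_Suc using Suc.prems
    by (auto simp: partial_deriv_mult ulim_Suc
        intro!: ulim_add Suc.IH smooth_partial smooth_mult uniform_lim_mult smooth_bounded_on)
qed

text \<open>The approximating functions have to be smooth themselves: only then are their partial derivatives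
  more than arbitrary values.\<close>

definition C_k_closure :: "nat \<Rightarrow> (real^'n) set \<Rightarrow> (real^'n \<Rightarrow> real) set \<Rightarrow> (real^'n \<Rightarrow> real) set" where
  "C_k_closure k K X = {g. smooth g \<and> (\<forall>e>0. \<exists>s\<in>X. smooth s \<and> cclose k K e s g)}"

lemma C_k_closureE:
  assumes "g \<in> C_k_closure k K X"
  obtains s where "\<And>m. s m \<in> X" "\<And>m. smooth (s m)" "ulim k K s g"
proof -
  have "\<forall>m. \<exists>s\<in>X. smooth s \<and> cclose k K (1 / Suc m) s g"
    using assms by (auto simp: C_k_closure_def)
  then obtain s where s: "\<And>m. s m \<in> X" "\<And>m. smooth (s m)" "\<And>m. cclose k K (1 / Suc m) (s m) g"
    by metis
  have "ulim k K s g"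
    unfolding ulim_def
  proof (intro allI impI)
    fix e :: real assume "0 < e"
    then have "\<forall>\<^sub>F m in sequentially. 1 / real (Suc m) < e"
      using LIMSEQ_Suc[OF lim_1_over_n] by (rule order_tendstoD[rotated])
    then show "\<forall>\<^sub>F m in sequentially. cclose k K e (s m) g"
      by (rule eventually_mono) (use s(3) cclose_mono less_imp_le in blast)
  qed
  with s that show ?thesis by blast
qed

lemma C_k_closureI:
  assumes "smooth g" "\<And>m. s m \<in> X" "\<And>m. smooth (s m)" "ulim k K s g"
  shows "g \<in> C_k_closure k K X"
proof -
  have "\<exists>m. cclose k K e (s m) g" if "0 < e" for e
    using assms(4) that unfolding ulim_def by (auto simp: eventually_sequentially)
  with assms show ?thesis unfolding C_k_closure_def by blast
qed

lemma C_k_closure_smooth: "g \<in> C_k_closure k K X \<Longrightarrow> smooth g"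
  by (simp add: C_k_closure_def)

lemma C_k_closure_subset: "s \<in> X \<Longrightarrow> smooth s \<Longrightarrow> s \<in> C_k_closure k K X"
  by (auto simp: C_k_closure_def intro: cclose_refl)

lemma C_k_closure_trans:
  assumes "g \<in> C_k_closure k K Y" "\<And>y. y \<in> Y \<Longrightarrow> smooth y \<Longrightarrow> y \<in> C_k_closure k K X"
  shows "g \<in> C_k_closure k K X"
  unfolding C_k_closure_def
proof (intro CollectI conjI allI impI)
  show "smooth g" using assms C_k_closure_smooth by blast
  fix e :: real assume "0 < e"
  then obtain y where y: "y \<in> Y" "smooth y" "cclose k K (e/2) y g"
    using assms(1) by (auto simp: C_k_closure_def dest!: spec[of _ "e/2"])
  then have "\<forall>e>0. \<exists>s\<in>X. smooth s \<and> cclose k K e s y"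
    using assms(2) by (auto simp: C_k_closure_def)
  then obtain s where s: "s \<in> X" "smooth s" "cclose k K (e/2) s y"
    using \<open>0 < e\<close> half_gt_zero by blast
  then show "\<exists>s\<in>X. smooth s \<and> cclose k K e s g"
    using cclose_triangle[OF s(3) y(3)] by auto
qed

lemma C_k_closure_add:
  assumes "g \<in> C_k_closure k K X" "h \<in> C_k_closure k K X"
    and "\<And>s t. s \<in> X \<Longrightarrow> t \<in> X \<Longrightarrow> (\<lambda>x. s x + t x) \<in> X"
  shows "(\<lambda>x. g x + h x) \<in> C_k_closure k K X"
proof -
  obtain s where s: "\<And>m. s m \<in> X" "\<And>m. smooth (s m)" "ulim k K s g"
    using C_k_closureE[OF assms(1)] by blast
  obtain t where t: "\<And>m. t m \<in> X" "\<And>m. smooth (t m)" "ulim k K t h"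
    using C_k_closureE[OF assms(2)] by blast
  show ?thesis
    by (intro C_k_closureI[of _ "\<lambda>m x. s m x + t m x"] ulim_add smooth_add
        assms s t C_k_closure_smooth[OF assms(1)] C_k_closure_smooth[OF assms(2)])
qed

lemma C_k_closure_mult:
  assumes "g \<in> C_k_closure k K X" "h \<in> C_k_closure k K X" "bounded K"
    and "\<And>s t. s \<in> X \<Longrightarrow> t \<in> X \<Longrightarrow> (\<lambda>x. s x * t x) \<in> X"
  shows "(\<lambda>x. g x * h x) \<in> C_k_closure k K X"
proof -
  obtain s where s: "\<And>m. s m \<in> X" "\<And>m. smooth (s m)" "ulim k K s g"
    using C_k_closureE[OF assms(1)] by blast
  obtain t where t: "\<And>m. t m \<in> X" "\<And>m. smooth (t m)" "ulim k K t h"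
    using C_k_closureE[OF assms(2)] by blast
  show ?thesis
    by (intro C_k_closureI[of _ "\<lambda>m x. s m x * t m x"] ulim_mult smooth_mult
        assms s t C_k_closure_smooth[OF assms(1)] C_k_closure_smooth[OF assms(2)])
qed

section \<open>Tensor products of functions of one variable\<close>

text \<open>The components of \<open>m\<close> count derivatives in the respective directions. A partial
  derivative raises one component by one, so for these functions all mixed derivatives are
  explicit and trivially commute.\<close>

definition tensor :: "('n \<Rightarrow> nat \<Rightarrow> real \<Rightarrow> real) \<Rightarrow> ('n \<Rightarrow> nat) \<Rightarrow> real^'n \<Rightarrow> real" where
  "tensor b m x = (\<Prod>i\<in>UNIV. b i (m i) (x $ i))"

definition deriv_chain :: "(nat \<Rightarrow> real \<Rightarrow> real) \<Rightarrow> bool" where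
  "deriv_chain b \<longleftrightarrow> (\<forall>j t. (b j has_real_derivative b (Suc j) t) (at t))"

lemma tensor_has_derivative:
  assumes "\<forall>i. deriv_chain (b i)"
  shows "(tensor b m has_derivative
     (\<lambda>h. \<Sum>i\<in>UNIV. (h $ i * b i (Suc (m i)) (x $ i)) * (\<Prod>j\<in>UNIV - {i}. b j (m j) (x $ j)))) (at x)"
  unfolding tensor_def[abs_def]
proof (rule has_derivative_prod)
  fix i :: 'a
  have "(b i (m i) has_real_derivative b i (Suc (m i)) (x $ i)) (at (x $ i))"
    using assms by (auto simp: deriv_chain_def)
  from has_derivative_compose[OF bounded_linear.has_derivative[OF bounded_linear_vec_nth has_derivative_ident]
      this[unfolded has_field_derivative_def]]
  show "((\<lambda>x. b i (m i) (x $ i)) has_derivative (\<lambda>h. h $ i * b i (Suc (m i)) (x $ i))) (at x)"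
    by (simp add: mult.commute)
qed

lemma partial_deriv_tensor:
  assumes "\<forall>i. deriv_chain (b i)"
  shows "partial_deriv i (tensor b m) = tensor b (m(i := Suc (m i)))"
proof
  fix x
  have "partial_deriv i (tensor b m) x = b i (Suc (m i)) (x $ i) * (\<Prod>j\<in>UNIV - {i}. b j (m j) (x $ j))"
    by (subst partial_deriv_eq[OF tensor_has_derivative[OF assms]], subst sum.remove[of _ i]) (auto simp: axis_def)
  also have "\<dots> = tensor b (m(i := Suc (m i))) x"
    unfolding tensor_def by (subst prod.remove[of UNIV i]) (auto intro!: prod.cong)
  finally show "partial_deriv i (tensor b m) x = tensor b (m(i := Suc (m i))) x" .
qed

lemma smooth_tensor:
  assumes "\<forall>i. deriv_chain (b i)"
  shows "smooth (tensor b m)"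
  by (rule smooth_coinduct[of "range (tensor b)"])
    (auto simp: partial_deriv_tensor[OF assms] intro: differentiableI tensor_has_derivative[OF assms])

lemma partial_deriv_pow_tensor:
  assumes "\<forall>i. deriv_chain (b i)"
  shows "(partial_deriv i ^^ j) (tensor b m) = tensor b (m(i := m i + j))"
proof (induction j)
  case (Suc j)
  have "(m(i := m i + j))(i := Suc ((m(i := m i + j)) i)) = m(i := m i + Suc j)"
    by auto
  with Suc show ?case
    by (simp only: funpow.simps comp_def partial_deriv_tensor[OF assms])
qed simp

lemma enum_UNIV:
  "distinct (map (from_nat_into UNIV) [0..<CARD('n)] :: 'n::finite list)"
  "set (map (from_nat_into UNIV) [0..<CARD('n)]) = (UNIV :: 'n::finite set)"
proof -
  have "bij_betw (from_nat_into UNIV) {..<CARD('n)} (UNIV :: 'n set)"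
    by (rule bij_betw_from_nat_into_finite) simp
  then show "distinct (map (from_nat_into UNIV) [0..<CARD('n)] :: 'n::finite list)"
    "set (map (from_nat_into UNIV) [0..<CARD('n)]) = (UNIV :: 'n::finite set)"
    by (auto simp: distinct_map bij_betw_def atLeast0LessThan)
qed

lemma multi_deriv_tensor:
  assumes "\<forall>i. deriv_chain (b i)"
  shows "multi_deriv \<alpha> (tensor b m) = tensor b (\<lambda>i. m i + \<alpha> i)"
proof -
  have "fold (\<lambda>i. partial_deriv i ^^ \<alpha> i) is (tensor b m)
      = tensor b (\<lambda>i. m i + (if i \<in> set is then \<alpha> i else 0))" if "distinct is" for "is"
    using that
  proof (induction "is" arbitrary: m)
    case (Cons i "is")
    have "(\<lambda>l. (m(i := m i + \<alpha> i)) l + (if l \<in> set is then \<alpha> l else 0))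
        = (\<lambda>l. m l + (if l \<in> set (i # is) then \<alpha> l else 0))"
      using Cons.prems by auto
    with Cons show ?case
      by (simp add: partial_deriv_pow_tensor[OF assms])
  qed simp
  from this[OF enum_UNIV(1)] show ?thesis
    unfolding multi_deriv_def enum_UNIV(2) by simp
qed

text \<open>A multi-index spelled out as the sequence of directions in which \<open>multi_deriv\<close>
  differentiates.\<close>

definition word :: "('n::finite \<Rightarrow> nat) \<Rightarrow> 'n list" where
  "word \<alpha> = concat (map (\<lambda>i. replicate (\<alpha> i) i) (map (from_nat_into UNIV) [0..<CARD('n)]))"

lemma multi_deriv_word: "multi_deriv \<alpha> f = fold partial_deriv (word \<alpha>) f"
proof -
  have r: "fold partial_deriv (replicate n i) f = (partial_deriv i ^^ n) f" for n i f
    by (induction n arbitrary: f) (auto simp: funpow_swap1)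
  have "fold (\<lambda>i. partial_deriv i ^^ \<alpha> i) is f = fold partial_deriv (concat (map (\<lambda>i. replicate (\<alpha> i) i) is)) f" for "is" f
    by (induction "is" arbitrary: f) (auto simp: r)
  then show ?thesis
    by (simp add: multi_deriv_def word_def)
qed

lemma length_word: "length (word \<alpha>) = (\<Sum>i\<in>UNIV. \<alpha> i)"
proof -
  have "length (concat (map (\<lambda>i. replicate (\<alpha> i) i) is)) = sum_list (map \<alpha> is)" for "is"
    by (induction "is") auto
  then have "length (word \<alpha>) = sum_list (map \<alpha> (map (from_nat_into UNIV) [0..<CARD('a)]))"
    unfolding word_def .
  also have "\<dots> = (\<Sum>i\<in>UNIV. \<alpha> i)"
    by (subst sum_list_distinct_conv_sum_set[OF enum_UNIV(1)]) (simp only: enum_UNIV(2))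
  finally show ?thesis .
qed


section \<open>Square-integrable functions\<close>

definition sq_int :: "'a measure \<Rightarrow> ('a \<Rightarrow> real) set" where
  "sq_int M = {f \<in> borel_measurable M. integrable M (\<lambda>x. (f x)\<^sup>2)}"

lemma sq_int_measurable: "f \<in> sq_int M \<Longrightarrow> f \<in> borel_measurable M"
  by (simp add: sq_int_def)

lemma sq_int_mult_integrable:
  assumes "f \<in> sq_int M" "g \<in> sq_int M"
  shows "integrable M (\<lambda>x. f x * g x)"
proof (rule Bochner_Integration.integrable_bound[of M "\<lambda>x. (f x)\<^sup>2 + (g x)\<^sup>2"])
  have "\<bar>a * b\<bar> \<le> a\<^sup>2 + b\<^sup>2" for a b :: real
  proof -
    have "2 * (\<bar>a\<bar> * \<bar>b\<bar>) \<le> a\<^sup>2 + b\<^sup>2" "0 \<le> \<bar>a\<bar> * \<bar>b\<bar>"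
      using sum_squares_bound[of "\<bar>a\<bar>" "\<bar>b\<bar>"] by simp_all
    then show ?thesis unfolding abs_mult by linarith
  qed
  then show "AE x in M. norm (f x * g x) \<le> norm ((f x)\<^sup>2 + (g x)\<^sup>2)"
    by (intro AE_I2) (simp add: abs_of_nonneg)
qed (use assms in \<open>auto simp: sq_int_def\<close>)

lemma sq_int_cmult: "f \<in> sq_int M \<Longrightarrow> (\<lambda>x. c * f x) \<in> sq_int M"
  by (auto simp: sq_int_def power_mult_distrib)

lemma sq_int_add:
  assumes "f \<in> sq_int M" "g \<in> sq_int M"
  shows "(\<lambda>x. f x + g x) \<in> sq_int M"
  using assms sq_int_mult_integrable[OF assms]
  by (auto simp: sq_int_def power2_sum mult.assoc)

lemma sq_int_diff:
  assumes "f \<in> sq_int M" "g \<in> sq_int M"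
  shows "(\<lambda>x. f x - g x) \<in> sq_int M"
  using sq_int_add[OF assms(1) sq_int_cmult[OF assms(2), of "-1"]] by simp

lemma sq_int_bounded_mult:
  assumes "f \<in> sq_int M" "g \<in> borel_measurable M" "\<And>x. x \<in> space M \<Longrightarrow> \<bar>g x\<bar> \<le> C"
  shows "(\<lambda>x. g x * f x) \<in> sq_int M"
    and "(\<integral>x. (g x * f x)\<^sup>2 \<partial>M) \<le> C\<^sup>2 * (\<integral>x. (f x)\<^sup>2 \<partial>M)"
proof -
  have le: "(g x * f x)\<^sup>2 \<le> C\<^sup>2 * (f x)\<^sup>2" if "x \<in> space M" for x
    using assms(3)[OF that] by (auto simp: power_mult_distrib abs_le_square_iff[symmetric] intro!: mult_right_mono)
  have "integrable M (\<lambda>x. (g x * f x)\<^sup>2)"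
    by (rule Bochner_Integration.integrable_bound[of M "\<lambda>x. C\<^sup>2 * (f x)\<^sup>2"])
      (use assms le in \<open>auto simp: sq_int_def\<close>)
  then show "(\<lambda>x. g x * f x) \<in> sq_int M"
    using assms by (auto simp: sq_int_def)
  show "(\<integral>x. (g x * f x)\<^sup>2 \<partial>M) \<le> C\<^sup>2 * (\<integral>x. (f x)\<^sup>2 \<partial>M)"
    unfolding integral_mult_right_zero[symmetric]
    by (rule integral_mono) (use assms le \<open>integrable M (\<lambda>x. (g x * f x)\<^sup>2)\<close> in \<open>auto simp: sq_int_def\<close>)
qed

text \<open>The Cauchy-Schwarz inequality is this fact for the integral of \<open>(f + t g)\<^sup>2\<close> as
  a polynomial in \<open>t\<close>.\<close>

lemma discriminant_nonpos:
  fixes a b c :: real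
  assumes "\<And>t. 0 \<le> a + 2 * b * t + c * t\<^sup>2"
  shows "b\<^sup>2 \<le> a * c"
proof (cases "c = 0")
  case True
  have "b = 0"
  proof (rule ccontr)
    assume "b \<noteq> 0"
    then show False
      using assms[of "- (a + 1) / (2 * b)"] True by (simp add: field_simps)
  qed
  with True show ?thesis by simp
next
  case False
  have c: "0 < c"
  proof (rule ccontr)
    assume "\<not> 0 < c"
    with False have "c < 0" by simp
    define t where "t = 1 + (\<bar>a\<bar> + 2 * \<bar>b\<bar>) / (- c)"
    have t: "1 \<le> t" "- c * t = - c + \<bar>a\<bar> + 2 * \<bar>b\<bar>"
      using \<open>c < 0\<close> by (auto simp: t_def field_simps)
    have "c * t\<^sup>2 = - ((- c + \<bar>a\<bar> + 2 * \<bar>b\<bar>) * t)"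
      unfolding t(2)[symmetric] by (simp add: power2_eq_square)
    moreover have "2 * b * t \<le> 2 * \<bar>b\<bar> * t" "a \<le> \<bar>a\<bar> * t" "0 < - c * t"
      using t(1) \<open>c < 0\<close> by (auto intro!: mult_right_mono simp: abs_mult mult_less_0_iff)
        (smt (verit) mult_le_cancel_left1)
    ultimately show False
      using assms[of t] by (simp add: algebra_simps)
  qed
  then show ?thesis
    using assms[of "- b / c"] by (simp add: field_simps power2_eq_square)
qed

lemma Cauchy_Schwarz_integral:
  assumes "f \<in> sq_int M" "g \<in> sq_int M"
  shows "(\<integral>x. f x * g x \<partial>M)\<^sup>2 \<le> (\<integral>x. (f x)\<^sup>2 \<partial>M) * (\<integral>x. (g x)\<^sup>2 \<partial>M)"
proof (rule discriminant_nonpos)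
  fix t
  have i: "integrable M (\<lambda>x. (f x)\<^sup>2)" "integrable M (\<lambda>x. (g x)\<^sup>2)" "integrable M (\<lambda>x. f x * g x)"
    using assms sq_int_mult_integrable[OF assms] by (auto simp: sq_int_def)
  have "0 \<le> (\<integral>x. (f x + t * g x)\<^sup>2 \<partial>M)" by simp
  also have "(\<lambda>x. (f x + t * g x)\<^sup>2) = (\<lambda>x. (f x)\<^sup>2 + (2 * t) * (f x * g x) + t\<^sup>2 * (g x)\<^sup>2)"
    by (auto simp: power2_eq_square algebra_simps)
  also have "(\<integral>x. (f x)\<^sup>2 + (2 * t) * (f x * g x) + t\<^sup>2 * (g x)\<^sup>2 \<partial>M)
      = (\<integral>x. (f x)\<^sup>2 \<partial>M) + (2 * t) * (\<integral>x. f x * g x \<partial>M) + t\<^sup>2 * (\<integral>x. (g x)\<^sup>2 \<partial>M)"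
    using i by simp
  finally show "0 \<le> (\<integral>x. (f x)\<^sup>2 \<partial>M) + 2 * (\<integral>x. f x * g x \<partial>M) * t + (\<integral>x. (g x)\<^sup>2 \<partial>M) * t\<^sup>2"
    by (simp add: algebra_simps)
qed

lemma sq_int_dist_triangle:
  assumes "f \<in> sq_int M" "g \<in> sq_int M" "h \<in> sq_int M"
  shows "(\<integral>x. (f x - h x)\<^sup>2 \<partial>M) \<le> 2 * (\<integral>x. (f x - g x)\<^sup>2 \<partial>M) + 2 * (\<integral>x. (g x - h x)\<^sup>2 \<partial>M)"
proof -
  have i: "integrable M (\<lambda>x. (f x - g x)\<^sup>2)" "integrable M (\<lambda>x. (g x - h x)\<^sup>2)" "integrable M (\<lambda>x. (f x - h x)\<^sup>2)"
    using sq_int_diff assms by (auto simp: sq_int_def)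
  have "(\<integral>x. (f x - h x)\<^sup>2 \<partial>M) \<le> (\<integral>x. 2 * (f x - g x)\<^sup>2 + 2 * (g x - h x)\<^sup>2 \<partial>M)"
  proof (rule integral_mono)
    fix x
    have "0 \<le> ((f x - g x) - (g x - h x))\<^sup>2" by simp
    then show "(f x - h x)\<^sup>2 \<le> 2 * (f x - g x)\<^sup>2 + 2 * (g x - h x)\<^sup>2"
      by (simp add: power2_eq_square algebra_simps)
  qed (use i in auto)
  then show ?thesis using i by simp
qed

lemma sq_int_tendsto_integral:
  assumes "\<And>m. f m \<in> sq_int M" "F \<in> sq_int M" "g \<in> sq_int M"
    and "(\<lambda>m. \<integral>x. (f m x - F x)\<^sup>2 \<partial>M) \<longlonglongrightarrow> 0"
  shows "(\<lambda>m. \<integral>x. f m x * g x \<partial>M) \<longlonglongrightarrow> (\<integral>x. F x * g x \<partial>M)"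
proof -
  have "(\<lambda>m. (\<integral>x. f m x * g x \<partial>M) - (\<integral>x. F x * g x \<partial>M)) \<longlonglongrightarrow> 0"
  proof (rule tendsto_0_le[where K = 1])
    show "(\<lambda>m. sqrt ((\<integral>x. (f m x - F x)\<^sup>2 \<partial>M) * (\<integral>x. (g x)\<^sup>2 \<partial>M))) \<longlonglongrightarrow> 0"
      using tendsto_real_sqrt[OF tendsto_mult_left_zero[OF assms(4)]] by simp
    show "\<forall>\<^sub>F m in sequentially. norm ((\<integral>x. f m x * g x \<partial>M) - (\<integral>x. F x * g x \<partial>M))
        \<le> norm (sqrt ((\<integral>x. (f m x - F x)\<^sup>2 \<partial>M) * (\<integral>x. (g x)\<^sup>2 \<partial>M))) * 1"
    proof (intro always_eventually allI)
      fix m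
      have "(\<integral>x. f m x * g x \<partial>M) - (\<integral>x. F x * g x \<partial>M) = (\<integral>x. (f m x - F x) * g x \<partial>M)"
        using sq_int_mult_integrable assms by (subst Bochner_Integration.integral_diff[symmetric]) (auto simp: algebra_simps)
      moreover have "\<bar>\<integral>x. (f m x - F x) * g x \<partial>M\<bar> \<le> sqrt ((\<integral>x. (f m x - F x)\<^sup>2 \<partial>M) * (\<integral>x. (g x)\<^sup>2 \<partial>M))"
        using Cauchy_Schwarz_integral[OF sq_int_diff[OF assms(1)[of m] assms(2)] assms(3)]
        by (metis real_sqrt_abs real_sqrt_le_iff)
      ultimately show "norm ((\<integral>x. f m x * g x \<partial>M) - (\<integral>x. F x * g x \<partial>M))
        \<le> norm (sqrt ((\<integral>x. (f m x - F x)\<^sup>2 \<partial>M) * (\<integral>x. (g x)\<^sup>2 \<partial>M))) * 1" by simp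
    qed
  qed
  then show ?thesis by (simp add: LIM_zero_iff)
qed

section \<open>Continuity of translations in the mean\<close>

lemma integrable_translate:
  fixes f :: "'a::euclidean_space \<Rightarrow> real"
  assumes "integrable lborel f"
  shows "integrable lborel (\<lambda>x. f (x + z))" "(\<integral>x. f (x + z) \<partial>lborel) = (\<integral>x. f x \<partial>lborel)"
proof -
  have [measurable]: "f \<in> borel_measurable borel" using borel_measurable_integrable[OF assms] by simp
  have "integrable (distr lborel borel ((+) z)) f"
    using assms by (simp add: lborel_distr_plus)
  then show "integrable lborel (\<lambda>x. f (x + z))"
    by (subst (asm) integrable_distr_eq) (auto simp: add.commute)
  have "(\<integral>x. f x \<partial>lborel) = (\<integral>x. f x \<partial>distr lborel borel ((+) z))"
    by (simp add: lborel_distr_plus)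
  also have "\<dots> = (\<integral>x. f (x + z) \<partial>lborel)"
    by (subst integral_distr) (auto simp: add.commute)
  finally show "(\<integral>x. f (x + z) \<partial>lborel) = (\<integral>x. f x \<partial>lborel)" by simp
qed

lemma nn_integral_translate:
  fixes f :: "'a::euclidean_space \<Rightarrow> ennreal"
  assumes [measurable]: "f \<in> borel_measurable borel"
  shows "(\<integral>\<^sup>+x. f (x + z) \<partial>lborel) = (\<integral>\<^sup>+x. f x \<partial>lborel)"
proof -
  have "(\<integral>\<^sup>+x. f x \<partial>lborel) = (\<integral>\<^sup>+x. f x \<partial>distr lborel borel ((+) z))"
    by (simp add: lborel_distr_plus)
  also have "\<dots> = (\<integral>\<^sup>+x. f (x + z) \<partial>lborel)"
    by (subst nn_integral_distr) (auto simp: add.commute)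
  finally show ?thesis by simp
qed

text \<open>The integral is twice the measure of the points of \<open>U\<close> that the translation moves out
  of \<open>U\<close>. As \<open>U\<close> is open, each point stays inside for small
  translations, and dominated convergence applies.\<close>

lemma translation_tendsto_open:
  fixes U :: "'a::euclidean_space set"
  assumes U: "open U" "emeasure lborel U < \<infinity>"
  shows "((\<lambda>z. \<integral>x. \<bar>indicator U (x + z) - indicator U x\<bar> \<partial>lborel) \<longlongrightarrow> (0::real)) (at 0)"
proof -
  have iU: "integrable lborel (indicator U :: 'a \<Rightarrow> real)"
    using U by auto
  have iUz: "integrable lborel (\<lambda>x. indicator U x * indicator U (x + z) :: real)" for z
  proof (rule Bochner_Integration.integrable_bound[OF iU])
    have [measurable]: "U \<in> sets borel" using U by simp
    show "(\<lambda>x. indicator U x * indicator U (x + z) :: real) \<in> borel_measurable lborel" by measurable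
  qed (auto simp: indicator_def)
  have eq: "(\<integral>x. \<bar>indicator U (x + z) - indicator U x\<bar> \<partial>lborel)
     = 2 * (\<integral>x. indicator U x \<partial>lborel) - 2 * (\<integral>x. indicator U x * indicator U (x + z) \<partial>lborel :: real)" for z
  proof -
    have "(\<lambda>x. \<bar>indicator U (x + z) - indicator U x\<bar>) =
       (\<lambda>x. indicator U (x + z) + indicator U x - 2 * (indicator U x * indicator U (x + z)) :: real)"
      by (auto simp: indicator_def fun_eq_iff)
    then show ?thesis
      using iU iUz integrable_translate[OF iU, of z] by simp
  qed
  have "((\<lambda>z. \<integral>x. indicator U x * indicator U (x + z) \<partial>lborel) \<longlongrightarrow> (\<integral>x. indicator U x \<partial>lborel :: real)) (at 0)"
    unfolding tendsto_at_iff_sequentially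
  proof (intro allI impI)
    fix X :: "nat \<Rightarrow> 'a" assume X: "X \<longlonglongrightarrow> 0"
    show "((\<lambda>z. \<integral>x. indicator U x * indicator U (x + z) \<partial>lborel) \<circ> X) \<longlonglongrightarrow> (\<integral>x. indicator U x \<partial>lborel :: real)"
      unfolding comp_def
    proof (rule integral_dominated_convergence[where w = "indicator U"])
      show "AE x in lborel. (\<lambda>i. indicator U x * indicator U (x + X i)) \<longlonglongrightarrow> (indicator U x :: real)"
      proof (intro AE_I2)
        fix x
        show "(\<lambda>i. indicator U x * indicator U (x + X i)) \<longlonglongrightarrow> (indicator U x :: real)"
        proof (cases "x \<in> U")
          case True
          have "(\<lambda>i. x + X i) \<longlonglongrightarrow> x + 0"
            by (intro tendsto_intros X)
          then have "\<forall>\<^sub>F i in sequentially. x + X i \<in> U"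
            using topological_tendstoD U(1) True by fastforce
          then have "\<forall>\<^sub>F i in sequentially. indicator U x * indicator U (x + X i) = (1::real)"
            by (rule eventually_mono) (use True in auto)
          then show ?thesis
            using True by (simp add: tendsto_eventually)
        qed simp
      qed
    next
      show "(\<lambda>x. indicator U x * indicator U (x + X i) :: real) \<in> borel_measurable lborel" for i
        using iUz[of "X i"] by (rule borel_measurable_integrable)
    qed (use iU borel_measurable_integrable[OF iU] in \<open>auto simp: indicator_def[abs_def]\<close>)
  qed
  from tendsto_diff[OF tendsto_const[of "2 * (\<integral>x. indicator U x \<partial>lborel :: real)"] tendsto_mult[OF tendsto_const[of 2] this]]
  show ?thesis
    unfolding eq by simp
qed

text \<open>Every measurable set of finite measure is approximated from outside by open sets, so the case of
  open sets extends to indicators, to their linear combinations and to limits.\<close>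

lemma L1_translation_tendsto:
  fixes g :: "'a::euclidean_space \<Rightarrow> real"
  assumes "integrable lborel g"
  shows "((\<lambda>z. \<integral>x. \<bar>g (x + z) - g x\<bar> \<partial>lborel) \<longlongrightarrow> 0) (at 0)"
proof -
  \<comment> \<open>The class of such \<open>g\<close> is closed under approximation in the mean.\<close>
  have approx: "((\<lambda>z. \<integral>x. \<bar>g (x + z) - g x\<bar> \<partial>lborel) \<longlongrightarrow> 0) (at 0)"
    if g: "integrable lborel g"
      and *: "\<And>e. 0 < e \<Longrightarrow> \<exists>h. integrable lborel h \<and> (\<integral>x. \<bar>h x - g x\<bar> \<partial>lborel) < e \<and>
         ((\<lambda>z. \<integral>x. \<bar>h (x + z) - h x\<bar> \<partial>lborel) \<longlongrightarrow> 0) (at 0)"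
    for g :: "'a \<Rightarrow> real"
  proof (rule tendstoI)
    fix e :: real assume "0 < e"
    then obtain h where h: "integrable lborel h" "(\<integral>x. \<bar>h x - g x\<bar> \<partial>lborel) < e / 3"
      "((\<lambda>z. \<integral>x. \<bar>h (x + z) - h x\<bar> \<partial>lborel) \<longlongrightarrow> 0) (at 0)"
      using *[of "e / 3"] by auto
    have "\<forall>\<^sub>F z in at 0. (\<integral>x. \<bar>h (x + z) - h x\<bar> \<partial>lborel) < e / 3"
      using h(3) \<open>0 < e\<close> by (intro order_tendstoD(2)[OF h(3)]) simp
    then show "\<forall>\<^sub>F z in at 0. dist (\<integral>x. \<bar>g (x + z) - g x\<bar> \<partial>lborel) 0 < e"
    proof (rule eventually_mono)
      fix z assume z: "(\<integral>x. \<bar>h (x + z) - h x\<bar> \<partial>lborel) < e / 3"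
      have i: "integrable lborel (\<lambda>x. \<bar>h x - g x\<bar>)" "integrable lborel (\<lambda>x. \<bar>h (x + z) - h x\<bar>)"
        "integrable lborel (\<lambda>x. \<bar>g (x + z) - g x\<bar>)"
        using g h(1) integrable_translate(1)[of _ z] by auto
      have t: "integrable lborel (\<lambda>x. \<bar>h (x + z) - g (x + z)\<bar>)"
        "(\<integral>x. \<bar>h (x + z) - g (x + z)\<bar> \<partial>lborel) = (\<integral>x. \<bar>h x - g x\<bar> \<partial>lborel)"
        using integrable_translate[OF i(1), of z] by auto
      have "(\<integral>x. \<bar>g (x + z) - g x\<bar> \<partial>lborel) \<le>
         (\<integral>x. \<bar>h (x + z) - g (x + z)\<bar> + \<bar>h (x + z) - h x\<bar> + \<bar>h x - g x\<bar> \<partial>lborel)"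
        by (rule integral_mono) (use i t in auto)
      also have "\<dots> < e"
        using i t h(2) z by simp
      finally show "dist (\<integral>x. \<bar>g (x + z) - g x\<bar> \<partial>lborel) 0 < e"
        by (simp add: dist_real_def)
    qed
  qed
  show ?thesis
    using assms
  proof (induction rule: integrable_induct)
    case (base A c)
    have iA: "integrable lborel (indicator A :: 'a \<Rightarrow> real)" using base by auto
    have "((\<lambda>z. \<integral>x. \<bar>indicator A (x + z) - indicator A x\<bar> \<partial>lborel) \<longlongrightarrow> (0::real)) (at 0)"
    proof (rule approx[OF iA])
      fix e :: real assume "0 < e"
      then obtain U where U: "open U" "A \<subseteq> U" "emeasure lborel (U - A) < e"
        using outer_regular_lborel base(1) by auto
      have "emeasure lborel U = emeasure lborel (A \<union> (U - A))"
        using U(2) by (simp add: Un_absorb1)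
      also have "\<dots> \<le> emeasure lborel A + emeasure lborel (U - A)"
        by (rule emeasure_subadditive) (use base U in auto)
      also have "\<dots> < \<infinity>"
        using base U by (simp add: less_top[symmetric]) (metis ennreal_less_top order_less_trans less_top)
      finally have Uf: "emeasure lborel U < \<infinity>" .
      have "(\<lambda>x. \<bar>indicator U x - indicator A x\<bar>) = (indicator (U - A) :: 'a \<Rightarrow> real)"
        using U(2) by (auto simp: indicator_def fun_eq_iff)
      moreover have "measure lborel (U - A) < e"
      proof -
        have "emeasure lborel (U - A) \<noteq> \<infinity>" using U(3) by auto
        then have "ennreal (measure lborel (U - A)) < ennreal e"
          using U(3) by (simp add: emeasure_eq_ennreal_measure)
        then show ?thesis by (simp add: ennreal_less_iff)
      qed
      ultimately show "\<exists>h. integrable lborel h \<and> (\<integral>x. \<bar>h x - indicator A x\<bar> \<partial>lborel) < e \<and>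
         ((\<lambda>z. \<integral>x. \<bar>h (x + z) - h x\<bar> \<partial>lborel) \<longlongrightarrow> 0) (at 0)"
        using Uf U(1) base(1) by (intro exI[of _ "indicator U"] conjI translation_tendsto_open) auto
    qed
    from tendsto_mult_left_zero[OF this, of "\<bar>c\<bar>"]
    show ?case
      by (simp add: left_diff_distrib[symmetric] abs_mult)
  next
    case (add f g)
    have "((\<lambda>z. (\<integral>x. \<bar>f (x + z) - f x\<bar> \<partial>lborel) + (\<integral>x. \<bar>g (x + z) - g x\<bar> \<partial>lborel)) \<longlongrightarrow> 0) (at 0)"
      using tendsto_add[OF add.IH] by simp
    then show ?case
    proof (rule tendsto_0_le[where K = 1], intro always_eventually allI)
      fix z
      have i: "integrable lborel (\<lambda>x. \<bar>f (x + z) - f x\<bar>)" "integrable lborel (\<lambda>x. \<bar>g (x + z) - g x\<bar>)"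
        "integrable lborel (\<lambda>x. \<bar>f (x + z) + g (x + z) - (f x + g x)\<bar>)"
        using add integrable_translate(1)[of _ z] by auto
      have "(\<integral>x. \<bar>f (x + z) + g (x + z) - (f x + g x)\<bar> \<partial>lborel) \<le>
         (\<integral>x. \<bar>f (x + z) - f x\<bar> + \<bar>g (x + z) - g x\<bar> \<partial>lborel)"
        by (rule integral_mono) (use i in auto)
      with i show "norm (\<integral>x. \<bar>f (x + z) + g (x + z) - (f x + g x)\<bar> \<partial>lborel) \<le>
         norm ((\<integral>x. \<bar>f (x + z) - f x\<bar> \<partial>lborel) + (\<integral>x. \<bar>g (x + z) - g x\<bar> \<partial>lborel)) * 1"
        by simp
    qed
  next
    case (lim f s)
    show ?case
    proof (rule approx[OF lim(4)])
      fix e :: real assume "0 < e"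
      have "(\<lambda>i. \<integral>x. \<bar>s i x - f x\<bar> \<partial>lborel) \<longlonglongrightarrow> (\<integral>x. 0 \<partial>(lborel :: 'a measure))"
      proof (rule integral_dominated_convergence[where w = "\<lambda>x. 3 * \<bar>f x\<bar>"])
        show "AE x in lborel. (\<lambda>i. \<bar>s i x - f x\<bar>) \<longlonglongrightarrow> 0"
          using lim(2) by (auto simp: tendsto_rabs_zero_iff LIM_zero_iff)
        show "AE x in lborel. norm \<bar>s i x - f x\<bar> \<le> 3 * \<bar>f x\<bar>" for i
        proof (intro AE_I2)
          fix x
          show "norm \<bar>s i x - f x\<bar> \<le> 3 * \<bar>f x\<bar>"
            using lim(3)[of x i] by simp
        qed
      qed (use lim in auto)
      then have "\<forall>\<^sub>F i in sequentially. (\<integral>x. \<bar>s i x - f x\<bar> \<partial>lborel) < e"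
        using \<open>0 < e\<close> by (auto dest: order_tendstoD(2))
      then obtain i where "(\<integral>x. \<bar>s i x - f x\<bar> \<partial>lborel) < e"
        by (auto simp: eventually_sequentially)
      with lim show "\<exists>h. integrable lborel h \<and> (\<integral>x. \<bar>h x - f x\<bar> \<partial>lborel) < e \<and>
         ((\<lambda>z. \<integral>x. \<bar>h (x + z) - h x\<bar> \<partial>lborel) \<longlongrightarrow> 0) (at 0)"
        by blast
    qed
  qed
qed

text \<open>Truncating \<open>g\<close> at height \<open>n\<close> costs little in the quadratic mean, and for
  functions bounded by \<open>n\<close> the integral of a squared difference is at most \<open>2
  n\<close> times that of its absolute value.\<close>

lemma L2_translation_tendsto:
  fixes g :: "'a::euclidean_space \<Rightarrow> real"
  assumes g1: "integrable lborel g" and g2: "integrable lborel (\<lambda>x. (g x)\<^sup>2)"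
  shows "((\<lambda>z. \<integral>x. (g (x + z) - g x)\<^sup>2 \<partial>lborel) \<longlongrightarrow> 0) (at 0)"
proof (rule tendstoI)
  fix e :: real assume "0 < e"
  have [measurable]: "g \<in> borel_measurable borel" using borel_measurable_integrable[OF g1] by simp
  define h where "h n x = max (- real n) (min (real n) (g x))" for n x
  have [measurable]: "h n \<in> borel_measurable borel" for n
    unfolding h_def by measurable
  have gh: "\<bar>g x - h n x\<bar> \<le> \<bar>g x\<bar>" for n x by (auto simp: h_def)
  have "(\<lambda>n. \<integral>x. (g x - h n x)\<^sup>2 \<partial>lborel) \<longlonglongrightarrow> (\<integral>x. 0 \<partial>(lborel :: 'a measure))"
  proof (rule integral_dominated_convergence[where w = "\<lambda>x. (g x)\<^sup>2"])
    show "AE x in lborel. (\<lambda>n. (g x - h n x)\<^sup>2) \<longlonglongrightarrow> 0"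
    proof (intro AE_I2 tendsto_eventually)
      fix x
      obtain N :: nat where "\<bar>g x\<bar> \<le> real N" using real_arch_simple by blast
      then show "\<forall>\<^sub>F n in sequentially. (g x - h n x)\<^sup>2 = 0"
        by (intro eventually_sequentiallyI[of N]) (auto simp: h_def max_def min_def)
    qed
    show "AE x in lborel. norm ((g x - h n x)\<^sup>2) \<le> (g x)\<^sup>2" for n
      using gh by (auto simp: abs_le_square_iff)
  qed (use g2 in auto)
  then have "\<forall>\<^sub>F n in sequentially. (\<integral>x. (g x - h n x)\<^sup>2 \<partial>lborel) < e / 12"
    using \<open>0 < e\<close> by (intro order_tendstoD(2)) auto
  then obtain n where n: "(\<integral>x. (g x - h n x)\<^sup>2 \<partial>lborel) < e / 12"
    by (auto simp: eventually_sequentially)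
  have igh: "integrable lborel (\<lambda>x. (g x - h n x)\<^sup>2)"
    by (rule Bochner_Integration.integrable_bound[OF g2]) (use gh in \<open>auto simp: abs_le_square_iff\<close>)
  have "((\<lambda>z. (6 * real n) * (\<integral>x. \<bar>g (x + z) - g x\<bar> \<partial>lborel)) \<longlongrightarrow> 0) (at 0)"
    using L1_translation_tendsto[OF g1] by (rule tendsto_mult_right_zero)
  then have "\<forall>\<^sub>F z in at 0. (6 * real n) * (\<integral>x. \<bar>g (x + z) - g x\<bar> \<partial>lborel) < e / 2"
    using \<open>0 < e\<close> by (intro order_tendstoD(2)) auto
  then show "\<forall>\<^sub>F z in at 0. dist (\<integral>x. (g (x + z) - g x)\<^sup>2 \<partial>lborel) 0 < e"
  proof (rule eventually_mono)
    fix z assume z: "(6 * real n) * (\<integral>x. \<bar>g (x + z) - g x\<bar> \<partial>lborel) < e / 2"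
    have t: "integrable lborel (\<lambda>x. (g (x + z) - h n (x + z))\<^sup>2)"
      "(\<integral>x. (g (x + z) - h n (x + z))\<^sup>2 \<partial>lborel) = (\<integral>x. (g x - h n x)\<^sup>2 \<partial>lborel)"
      using integrable_translate[OF igh, of z] by auto
    have i1: "integrable lborel (\<lambda>x. \<bar>g (x + z) - g x\<bar>)"
      using g1 integrable_translate(1)[of _ z] by auto
    have "(\<integral>x. (g (x + z) - g x)\<^sup>2 \<partial>lborel) \<le>
      (\<integral>x. 3 * (g (x + z) - h n (x + z))\<^sup>2 + (6 * real n) * \<bar>g (x + z) - g x\<bar> + 3 * (g x - h n x)\<^sup>2 \<partial>lborel)"
    proof (rule integral_mono')
      fix x
      define a b c where "a = g (x + z) - h n (x + z)" and "b = h n (x + z) - h n x" and "c = h n x - g x"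
      have "0 \<le> (a - b)\<^sup>2 + (b - c)\<^sup>2 + (a - c)\<^sup>2" by simp
      then have "(a + b + c)\<^sup>2 \<le> 3 * a\<^sup>2 + 3 * b\<^sup>2 + 3 * c\<^sup>2"
        by (simp add: power2_eq_square algebra_simps)
      moreover have "b\<^sup>2 \<le> 2 * real n * \<bar>g (x + z) - g x\<bar>"
      proof -
        have "\<bar>b\<bar> \<le> 2 * real n" "\<bar>b\<bar> \<le> \<bar>g (x + z) - g x\<bar>"
          by (auto simp: b_def h_def max_def min_def)
        then have "\<bar>b\<bar> * \<bar>b\<bar> \<le> 2 * real n * \<bar>g (x + z) - g x\<bar>"
          by (intro mult_mono) auto
        then show ?thesis by (simp add: power2_eq_square abs_mult_self_eq)
      qed
      moreover have "c\<^sup>2 = (g x - h n x)\<^sup>2" by (simp add: c_def power2_commute)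
      ultimately show "(g (x + z) - g x)\<^sup>2 \<le> 3 * (g (x + z) - h n (x + z))\<^sup>2 + (6 * real n) * \<bar>g (x + z) - g x\<bar> + 3 * (g x - h n x)\<^sup>2"
        by (simp add: a_def b_def c_def)
    qed (use i1 t(1) igh in auto)
    also have "\<dots> = 3 * (\<integral>x. (g x - h n x)\<^sup>2 \<partial>lborel) + (6 * real n) * (\<integral>x. \<bar>g (x + z) - g x\<bar> \<partial>lborel)
        + 3 * (\<integral>x. (g x - h n x)\<^sup>2 \<partial>lborel)"
      using i1 t igh by simp
    also have "\<dots> < e" using n z by simp
    finally show "dist (\<integral>x. (g (x + z) - g x)\<^sup>2 \<partial>lborel) 0 < e"
      by (simp add: dist_real_def)
  qed
qed

lemma (in prob_space) square_expectation_le: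
  assumes f: "integrable M f"
  shows "ennreal ((\<integral>x. f x \<partial>M)\<^sup>2) \<le> (\<integral>\<^sup>+x. ennreal ((f x)\<^sup>2) \<partial>M)"
proof (cases "(\<integral>\<^sup>+x. ennreal ((f x)\<^sup>2) \<partial>M) < \<infinity>")
  case True
  have i: "integrable M (\<lambda>x. (f x)\<^sup>2)"
    using True f by (auto simp: integrable_iff_bounded)
  have "(\<integral>x. f x * 1 \<partial>M)\<^sup>2 \<le> (\<integral>x. (f x)\<^sup>2 \<partial>M) * (\<integral>x. 1\<^sup>2 \<partial>M)"
    by (rule Cauchy_Schwarz_integral) (use f i in \<open>auto simp: sq_int_def\<close>)
  then show ?thesis
    using nn_integral_eq_integral[OF i] by (simp add: prob_space ennreal_leI)
qed (simp add: not_less top_unique)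

text \<open>Averaging over small translations moves \<open>g\<close> in the mean by no more than the largest of these
  translations does: Jensen's inequality for the probability density \<open>\<zeta>\<close>, then Tonelli.\<close>

lemma mollify_bound:
  fixes g :: "'a::euclidean_space \<Rightarrow> real"
  assumes g1: "integrable lborel g"
    and e: "\<And>z. norm z < d \<Longrightarrow> (\<integral>\<^sup>+x. ennreal ((g (x + z) - g x)\<^sup>2) \<partial>lborel) \<le> e"
    and z[measurable]: "\<zeta> \<in> borel_measurable borel"
    and nonneg: "\<And>z. 0 \<le> \<zeta> z" and bdd: "\<And>z. \<zeta> z \<le> C" and supp: "\<And>z. \<zeta> z \<noteq> 0 \<Longrightarrow> norm z < d"
    and one: "(\<integral>\<^sup>+z. ennreal (\<zeta> z) \<partial>lborel) = 1"
  shows "(\<integral>\<^sup>+x. ennreal (((\<integral>y. g y * \<zeta> (y - x) \<partial>lborel) - g x)\<^sup>2) \<partial>lborel) \<le> e"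
proof -
  have [measurable]: "g \<in> borel_measurable borel" using borel_measurable_integrable[OF g1] by simp
  have "ennreal (((\<integral>y. g y * \<zeta> (y - x) \<partial>lborel) - g x)\<^sup>2)
      \<le> (\<integral>\<^sup>+z. ennreal (\<zeta> z) * ennreal ((g (x + z) - g x)\<^sup>2) \<partial>lborel)" for x
  proof -
    define N where "N = density lborel (\<lambda>y. ennreal (\<zeta> (y - x)))"
    have "(\<integral>\<^sup>+y. ennreal (\<zeta> (y - x)) \<partial>lborel) = 1"
      using nn_integral_translate[of "\<lambda>z. ennreal (\<zeta> z)" "- x"] one by simp
    then have iz: "integrable lborel (\<lambda>y. \<zeta> (y - x))" and z1: "(\<integral>y. \<zeta> (y - x) \<partial>lborel) = 1"
      using nonneg by (auto simp: integrable_iff_bounded integral_eq_nn_integral)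
    interpret N: prob_space N
      by (rule prob_spaceI) (use \<open>(\<integral>\<^sup>+y. ennreal (\<zeta> (y - x)) \<partial>lborel) = 1\<close> in \<open>simp add: N_def emeasure_density\<close>)
    have igz: "integrable lborel (\<lambda>y. g y * \<zeta> (y - x))"
    proof (rule Bochner_Integration.integrable_bound[of _ "\<lambda>y. C * g y"])
      have "\<bar>\<zeta> z\<bar> \<le> \<bar>C\<bar>" for z using nonneg[of z] bdd[of z] by simp
      then have "\<bar>\<zeta> (y - x)\<bar> * \<bar>g y\<bar> \<le> \<bar>C\<bar> * \<bar>g y\<bar>" for y
        by (intro mult_right_mono) auto
      then show "AE y in lborel. norm (g y * \<zeta> (y - x)) \<le> norm (C * g y)"
        by (intro AE_I2) (simp add: abs_mult mult.commute)
    qed (use g1 in auto)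
    have eq: "\<zeta> (y - x) * (g y - g x) = g y * \<zeta> (y - x) - g x * \<zeta> (y - x)" for y
      by (simp add: algebra_simps)
    have "integrable N (\<lambda>y. g y - g x)"
      unfolding N_def using igz iz nonneg by (subst integrable_real_density) (auto simp: eq)
    from N.square_expectation_le[OF this]
    have "ennreal ((\<integral>y. g y - g x \<partial>N)\<^sup>2) \<le> (\<integral>\<^sup>+y. ennreal (\<zeta> (y - x)) * ennreal ((g y - g x)\<^sup>2) \<partial>lborel)"
      unfolding N_def by (subst (asm) nn_integral_density) auto
    also have "(\<integral>y. g y - g x \<partial>N) = (\<integral>y. g y * \<zeta> (y - x) \<partial>lborel) - g x"
      unfolding N_def using igz iz z1 nonneg by (subst integral_real_density) (auto simp: eq)
    also have "(\<integral>\<^sup>+y. ennreal (\<zeta> (y - x)) * ennreal ((g y - g x)\<^sup>2) \<partial>lborel)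
        = (\<integral>\<^sup>+z. ennreal (\<zeta> z) * ennreal ((g (x + z) - g x)\<^sup>2) \<partial>lborel)"
      by (subst nn_integral_translate[symmetric, of _ x]) (auto simp: add.commute)
    finally show ?thesis .
  qed
  then have "(\<integral>\<^sup>+x. ennreal (((\<integral>y. g y * \<zeta> (y - x) \<partial>lborel) - g x)\<^sup>2) \<partial>lborel)
      \<le> (\<integral>\<^sup>+x. \<integral>\<^sup>+z. ennreal (\<zeta> z) * ennreal ((g (x + z) - g x)\<^sup>2) \<partial>lborel \<partial>lborel)"
    by (intro nn_integral_mono)
  also have "\<dots> = (\<integral>\<^sup>+z. \<integral>\<^sup>+x. ennreal (\<zeta> z) * ennreal ((g (x + z) - g x)\<^sup>2) \<partial>lborel \<partial>lborel)"
    by (rule lborel_pair.Fubini') measurable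
  also have "\<dots> = (\<integral>\<^sup>+z. ennreal (\<zeta> z) * (\<integral>\<^sup>+x. ennreal ((g (x + z) - g x)\<^sup>2) \<partial>lborel) \<partial>lborel)"
    by (intro nn_integral_cong nn_integral_cmult) measurable
  also have "\<dots> \<le> (\<integral>\<^sup>+z. ennreal (\<zeta> z) * e \<partial>lborel)"
  proof (intro nn_integral_mono)
    fix z :: 'a
    show "ennreal (\<zeta> z) * (\<integral>\<^sup>+x. ennreal ((g (x + z) - g x)\<^sup>2) \<partial>lborel) \<le> ennreal (\<zeta> z) * e"
      using e[of z] supp[of z] by (cases "\<zeta> z = 0") (auto intro: mult_left_mono)
  qed
  also have "\<dots> = e"
    by (subst nn_integral_multc) (auto simp: one)
  finally show ?thesis .
qed


section \<open>Mollification\<close>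

lemma continuous_compact_support:
  fixes f :: "'a::euclidean_space \<Rightarrow> real"
  assumes "continuous_on UNIV f" "compact S" "\<And>x. f x \<noteq> 0 \<Longrightarrow> x \<in> S"
  shows "integrable lborel f" "\<exists>C. \<forall>x. \<bar>f x\<bar> \<le> C"
proof -
  have "integrable lborel (\<lambda>x. indicator S x *\<^sub>R f x)"
    using assms continuous_on_subset by (intro borel_integrable_compact) blast+
  moreover have "(\<lambda>x. indicator S x *\<^sub>R f x) = f"
    using assms(3) by (auto simp: indicator_def fun_eq_iff)
  ultimately show "integrable lborel f" by simp
  have "bounded (f ` S)"
    using assms continuous_on_subset by (intro compact_imp_bounded compact_continuous_image) blast+
  then obtain C where C: "\<And>x. x \<in> S \<Longrightarrow> \<bar>f x\<bar> \<le> C"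
    by (auto simp: bounded_iff)
  have "\<bar>f x\<bar> \<le> max C 0" for x
    using C[of x] assms(3)[of x] by (cases "f x = 0") auto
  then show "\<exists>C. \<forall>x. \<bar>f x\<bar> \<le> C" by blast
qed

lemma deriv_chain_affine:
  assumes "deriv_chain b"
  shows "deriv_chain (\<lambda>j t. a ^ j * b j (a * t + c))"
  unfolding deriv_chain_def
proof (intro allI)
  fix j t
  have "(b j has_real_derivative b (Suc j) (a * t + c)) (at (a * t + c))"
    using assms by (simp add: deriv_chain_def)
  moreover have "((\<lambda>t. a * t + c) has_real_derivative a) (at t)"
    by (auto intro!: derivative_eq_intros)
  ultimately have "((\<lambda>t. b j (a * t + c)) has_real_derivative b (Suc j) (a * t + c) * a) (at t)"
    by (rule DERIV_chain2)
  from DERIV_cmult[OF this, of "a ^ j"]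
  show "((\<lambda>t. a ^ j * b j (a * t + c)) has_real_derivative a ^ Suc j * b (Suc j) (a * t + c)) (at t)"
    by (simp add: mult_ac)
qed

lemma deriv_chain_cmult: "deriv_chain b \<Longrightarrow> deriv_chain (\<lambda>j t. c * b j t)"
  by (auto simp: deriv_chain_def intro!: DERIV_cmult)

definition tensor_cutoff :: "real^'n \<Rightarrow> real \<Rightarrow> ('n \<Rightarrow> nat \<Rightarrow> real \<Rightarrow> real) \<Rightarrow> bool" where
  "tensor_cutoff a s b \<longleftrightarrow> (\<forall>i. deriv_chain (b i)) \<and> (\<forall>x. 0 \<le> tensor b (\<lambda>_. 0) x) \<and>
     (\<forall>x. norm (x - a) \<le> s \<longrightarrow> tensor b (\<lambda>_. 0) x = 1) \<and>
     (\<forall>x. tensor b (\<lambda>_. 0) x \<noteq> 0 \<longrightarrow> norm (x - a) \<le> 2 * real CARD('n) * s)"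

lemma tensor_cutoff_exists:
  fixes a :: "real^'n" and s :: real
  assumes "0 < s"
  shows "\<exists>b. tensor_cutoff a s b"
proof -
  obtain p :: "nat \<Rightarrow> real \<Rightarrow> real" where p: "\<And>j t. (p j has_real_derivative p (Suc j) t) (at t)"
    "\<And>t. 0 \<le> p 0 t" "\<And>t. \<bar>t\<bar> \<le> 1 \<Longrightarrow> p 0 t = 1" "\<And>t. 2 \<le> \<bar>t\<bar> \<Longrightarrow> p 0 t = 0"
    using smooth_plateau_exists by metis
  define b where "b i j t = (1 / s) ^ j * p j ((1 / s) * t + (- a $ i / s))" for i :: 'n and j t
  have "deriv_chain p" by (simp add: deriv_chain_def p(1))
  then have "\<forall>i. deriv_chain (b i)"
    unfolding b_def by (intro allI deriv_chain_affine)
  moreover have "0 \<le> tensor b (\<lambda>_. 0) x" for x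
    by (auto simp: tensor_def b_def p(2) intro: prod_nonneg)
  moreover have b0: "b i 0 t = p 0 ((t - a $ i) / s)" for i t
    by (simp add: b_def diff_divide_distrib)
  have "tensor b (\<lambda>_. 0) x = 1" if "norm (x - a) \<le> s" for x
  proof -
    have "p 0 ((x $ i - a $ i) / s) = 1" for i
      using component_le_norm_cart[of "x - a" i] that assms by (intro p(3)) simp
    then show ?thesis by (simp add: tensor_def b0)
  qed
  moreover have "norm (x - a) \<le> 2 * real CARD('n) * s" if "tensor b (\<lambda>_. 0) x \<noteq> 0" for x
  proof -
    have "\<bar>(x - a) $ i\<bar> \<le> 2 * s" for i
    proof -
      have "p 0 ((x $ i - a $ i) / s) \<noteq> 0"
        using that by (simp add: tensor_def b0)
      then have "\<bar>(x $ i - a $ i) / s\<bar> < 2" using p(4) by force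
      then show ?thesis using assms by (simp add: field_simps)
    qed
    then have "(\<Sum>i\<in>UNIV. \<bar>(x - a) $ i\<bar>) \<le> (\<Sum>i\<in>(UNIV :: 'n set). 2 * s)"
      by (intro sum_mono)
    with norm_le_l1_cart[of "x - a"] show ?thesis by simp
  qed
  ultimately have "tensor_cutoff a s b"
    by (simp add: tensor_cutoff_def)
  then show ?thesis by blast
qed

text \<open>One factor of the product absorbs the constant.\<close>

lemma tensor_scale:
  assumes "\<forall>i. deriv_chain (b i)"
  obtains b' where "\<forall>i. deriv_chain (b' i)" "\<And>m x. tensor b' m x = c * tensor b m x"
proof -
  define i0 :: 'a where "i0 = undefined"
  define b' where "b' = b(i0 := (\<lambda>j t. c * b i0 j t))"
  have "\<forall>i. deriv_chain (b' i)"
    using assms by (auto simp: b'_def deriv_chain_cmult)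
  moreover have "tensor b' m x = c * tensor b m x" for m x
    unfolding tensor_def
    by (subst (1 2) prod.remove[of UNIV i0]) (auto simp: b'_def mult_ac intro!: arg_cong2[where f="(*)"] prod.cong)
  ultimately show ?thesis using that by blast
qed

text \<open>The mollifier is centred at \<open>a\<close> instead of \<open>0\<close>. Shifting it lets a
  convolution look only in directions that stay inside the domain.\<close>

definition tensor_mollifier :: "real^'n \<Rightarrow> real \<Rightarrow> ('n \<Rightarrow> nat \<Rightarrow> real \<Rightarrow> real) \<Rightarrow> bool" where
  "tensor_mollifier a r b \<longleftrightarrow> (\<forall>i. deriv_chain (b i)) \<and> (\<forall>x. 0 \<le> tensor b (\<lambda>_. 0) x) \<and>
     (\<forall>x. tensor b (\<lambda>_. 0) x \<noteq> 0 \<longrightarrow> norm (x - a) \<le> r) \<and>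
     (\<integral>\<^sup>+z. ennreal (tensor b (\<lambda>_. 0) (- z)) \<partial>lborel) = 1"

lemma tensor_mollifier_exists:
  fixes a :: "real^'n"
  assumes "0 < r"
  shows "\<exists>b. tensor_mollifier a r b"
proof -
  define s where "s = r / (2 * real CARD('n))"
  have s: "0 < s" "2 * real CARD('n) * s = r" using assms by (auto simp: s_def)
  obtain b where "tensor_cutoff a s b"
    using tensor_cutoff_exists[OF s(1)] by blast
  then have b: "\<forall>i. deriv_chain (b i)" "\<And>x. 0 \<le> tensor b (\<lambda>_. 0) x"
    "\<And>x. norm (x - a) \<le> s \<Longrightarrow> tensor b (\<lambda>_. 0) x = 1"
    "\<And>x. tensor b (\<lambda>_. 0) x \<noteq> 0 \<Longrightarrow> norm (x - a) \<le> r"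
    unfolding tensor_cutoff_def s(2) by blast+
  define f where "f z = tensor b (\<lambda>_. 0) (- z)" for z
  have cf: "continuous_on UNIV f"
    unfolding f_def by (intro continuous_on_compose2[OF smooth_continuous[OF smooth_tensor[OF b(1)], of UNIV]] continuous_intros) auto
  have "integrable lborel f"
  proof (rule continuous_compact_support(1)[OF cf])
    show "compact (cball (- a) r)" by simp
    fix z assume "f z \<noteq> 0"
    with b(4)[of "- z"] have "norm (- z - a) \<le> r" by (simp add: f_def)
    moreover have "norm (- z - a) = dist (- a) z"
      unfolding dist_norm by (rule arg_cong[where f = norm]) simp
    ultimately show "z \<in> cball (- a) r" by simp
  qed
  then have fin: "(\<integral>\<^sup>+z. ennreal (f z) \<partial>lborel) < \<infinity>"
    using b(2) by (simp add: integrable_iff_bounded f_def)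
  have "emeasure lborel (ball (- a) s) = (\<integral>\<^sup>+z. indicator (ball (- a) s) z \<partial>lborel)"
    by simp
  also have "\<dots> \<le> (\<integral>\<^sup>+z. ennreal (f z) \<partial>lborel)"
  proof (intro nn_integral_mono)
    fix z
    have "f z = 1" if "dist (- a) z < s"
    proof -
      have "norm (- z - a) = dist (- a) z"
        unfolding dist_norm by (rule arg_cong[where f = norm]) simp
      with that show ?thesis unfolding f_def by (intro b(3)) simp
    qed
    then show "indicator (ball (- a) s) z \<le> ennreal (f z)"
      by (auto simp: indicator_def)
  qed
  finally have le: "emeasure lborel (ball (- a) s) \<le> (\<integral>\<^sup>+z. ennreal (f z) \<partial>lborel)" .
  have "emeasure lborel (ball (- a) s) \<noteq> 0"
    using content_ball_pos[OF s(1), of "- a"] by (auto simp: measure_def)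
  then have "0 < emeasure lborel (ball (- a) s)"
    by (simp add: zero_less_iff_neq_zero)
  then have pos: "0 < (\<integral>\<^sup>+z. ennreal (f z) \<partial>lborel)"
    using le by (rule less_le_trans)
  define c where "c = enn2real (\<integral>\<^sup>+z. ennreal (f z) \<partial>lborel)"
  have c: "0 < c" "(\<integral>\<^sup>+z. ennreal (f z) \<partial>lborel) = ennreal c"
    using pos fin by (simp_all add: c_def enn2real_positive_iff less_top)
  obtain b' where b': "\<forall>i. deriv_chain (b' i)" "\<And>m x. tensor b' m x = (1 / c) * tensor b m x"
    using tensor_scale[where c = "1 / c", OF b(1)] by blast
  have [measurable]: "f \<in> borel_measurable borel"
    using cf by (rule borel_measurable_continuous_onI)
  have "(\<integral>\<^sup>+z. ennreal (tensor b' (\<lambda>_. 0) (- z)) \<partial>lborel) = (\<integral>\<^sup>+z. ennreal (1 / c) * ennreal (f z) \<partial>lborel)"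
    unfolding b'(2) f_def using b(2) c(1) by (intro nn_integral_cong ennreal_mult) simp_all
  also have "\<dots> = ennreal (1 / c) * ennreal c"
    unfolding c(2)[symmetric] by (rule nn_integral_cmult) simp
  also have "\<dots> = ennreal (1 / c * c)"
    using c(1) by (intro ennreal_mult[symmetric]) simp_all
  also have "\<dots> = 1" using c(1) by simp
  finally have one: "(\<integral>\<^sup>+z. ennreal (tensor b' (\<lambda>_. 0) (- z)) \<partial>lborel) = 1" .
  have "0 \<le> tensor b' (\<lambda>_. 0) x" for x
    unfolding b'(2) using b(2)[of x] c(1) by simp
  moreover have "norm (x - a) \<le> r" if "tensor b' (\<lambda>_. 0) x \<noteq> 0" for x
    using that b(4)[of x] unfolding b'(2) by simp
  ultimately have "tensor_mollifier a r b'"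
    using b'(1) one by (simp add: tensor_mollifier_def)
  then show ?thesis by blast
qed

lemma L2_eq_sq_int: "L2 \<Omega> = sq_int (lebesgue_on \<Omega>)"
  by (simp add: L2_def sq_int_def)

lemma L2_extend_measurable:
  assumes "open \<Omega>" "u \<in> L2 \<Omega>"
  shows "(\<lambda>x. indicator \<Omega> x * u x) \<in> borel_measurable lebesgue"
proof -
  have "u \<in> borel_measurable (lebesgue_on \<Omega>)" using assms(2) by (simp add: L2_def)
  moreover have "\<Omega> \<inter> space lebesgue \<in> sets lebesgue" using assms(1) by simp
  ultimately show ?thesis
    using borel_measurable_restrict_space_iff[of \<Omega> lebesgue u] by simp
qed

text \<open>Tonelli and translation invariance are applied to Borel functions on the whole space; a Lebesgue
  measurable function agrees almost everywhere with such a function.\<close>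

lemma L2_borel_rep:
  fixes \<Omega> :: "(real^'n) set"
  assumes \<Omega>: "open \<Omega>" "bounded \<Omega>" and u: "u \<in> L2 \<Omega>"
  obtains g where "g \<in> borel_measurable borel" "integrable lborel g" "integrable lborel (\<lambda>x. (g x)\<^sup>2)"
    "AE x in lborel. g x = indicator \<Omega> x * u x"
proof -
  have [measurable]: "\<Omega> \<in> sets borel" using \<Omega> by simp
  have m: "(\<lambda>x. indicator \<Omega> x * u x) \<in> borel_measurable lebesgue"
    by (rule L2_extend_measurable[OF \<Omega>(1) u])
  obtain g where g[measurable]: "g \<in> borel_measurable lborel" and ae: "AE x in lborel. indicator \<Omega> x * u x = g x"
    using bexE[OF completion_ex_borel_measurable_real[OF m]] .
  have "integrable (lebesgue_on \<Omega>) (\<lambda>x. (u x)\<^sup>2)"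
    using u by (simp add: L2_def)
  then have "integrable lebesgue (\<lambda>x. indicator \<Omega> x *\<^sub>R (u x)\<^sup>2)"
    using integrable_restrict_space[of \<Omega> lebesgue "\<lambda>x. (u x)\<^sup>2"] \<Omega>(1) by simp
  moreover have "(\<lambda>x. (g x)\<^sup>2) \<in> borel_measurable lebesgue"
    by (rule measurable_completion) simp
  moreover have "AE x in lebesgue. indicator \<Omega> x *\<^sub>R (u x)\<^sup>2 = (g x)\<^sup>2"
    using AE_completion[OF ae] by (rule eventually_mono) (auto simp: indicator_def split: if_splits)
  ultimately have "integrable lebesgue (\<lambda>x. (g x)\<^sup>2)"
    by (rule integrable_cong_AE_imp)
  then have g2: "integrable lborel (\<lambda>x. (g x)\<^sup>2)"
    using integrable_completion[of "\<lambda>x. (g x)\<^sup>2" lborel] by simp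
  have "emeasure lborel \<Omega> < \<infinity>"
    using \<Omega>(2) emeasure_bounded_finite by blast
  then have i\<Omega>: "integrable lborel (\<lambda>x. indicator \<Omega> x + (g x)\<^sup>2)"
    using g2 by (intro Bochner_Integration.integrable_add integrable_real_indicator) simp_all
  have "integrable lborel g"
  proof (rule Bochner_Integration.integrable_bound[OF i\<Omega>])
    show "AE x in lborel. norm (g x) \<le> norm (indicator \<Omega> x + (g x)\<^sup>2)"
    proof (rule eventually_mono[OF ae])
      fix x assume x: "indicator \<Omega> x * u x = g x"
      have "\<bar>g x\<bar> \<le> 1 + (g x)\<^sup>2"
        using zero_le_power2[of "\<bar>g x\<bar> - 1"] zero_le_power2[of "g x"] by (simp add: power2_diff)
      moreover have "g x = 0" if "x \<notin> \<Omega>"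
        using x that by simp
      ultimately show "norm (g x) \<le> norm (indicator \<Omega> x + (g x)\<^sup>2)"
        by (cases "x \<in> \<Omega>") simp_all
    qed
  qed simp
  moreover have "AE x in lborel. g x = indicator \<Omega> x * u x"
    using ae by (rule eventually_mono) simp
  ultimately show ?thesis using g2 g by (intro that[of g]) simp_all
qed

lemma lebesgue_on_integral_rep:
  fixes \<Omega> :: "(real^'n) set"
  assumes \<Omega>: "open \<Omega>" and u: "u \<in> L2 \<Omega>" and g: "g \<in> borel_measurable borel"
    and ae: "AE x in lborel. g x = indicator \<Omega> x * u x" and h: "h \<in> borel_measurable borel"
  shows "(\<integral>x. u x * h x \<partial>lebesgue_on \<Omega>) = (\<integral>x. g x * h x \<partial>lborel)"
proof -
  have [measurable]: "\<Omega> \<in> sets borel" using \<Omega> by simp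
  have m: "(\<lambda>x. indicator \<Omega> x * u x) \<in> borel_measurable lebesgue"
    by (rule L2_extend_measurable[OF \<Omega> u])
  have h': "h \<in> borel_measurable lebesgue" "g \<in> borel_measurable lebesgue"
    by (rule measurable_completion, simp add: h, rule measurable_completion, simp add: g)
  have "(\<integral>x. u x * h x \<partial>lebesgue_on \<Omega>) = (\<integral>x. (indicator \<Omega> x * u x) * h x \<partial>lebesgue)"
  proof -
    have "\<Omega> \<inter> space lebesgue \<in> sets lebesgue" using \<Omega> by simp
    from integral_restrict_space[OF this, of "\<lambda>x. u x * h x"] show ?thesis
      by (simp only: real_scaleR_def mult.assoc)
  qed
  also have "\<dots> = (\<integral>x. g x * h x \<partial>lebesgue)"
  proof (rule integral_cong_AE)
    show "AE x in lebesgue. (indicator \<Omega> x * u x) * h x = g x * h x"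
      using AE_completion[OF ae] by (rule eventually_mono) simp
  qed (intro borel_measurable_times m h')+
  also have "\<dots> = (\<integral>x. g x * h x \<partial>lborel)"
    by (rule integral_completion) (intro borel_measurable_times, simp_all add: g h)
  finally show ?thesis .
qed

definition convolve :: "(real^'n) set \<Rightarrow> (real^'n \<Rightarrow> real) \<Rightarrow> (real^'n \<Rightarrow> real) \<Rightarrow> real^'n \<Rightarrow> real" where
  "convolve \<Omega> u q x = (\<integral>y. u y * q (x - y) \<partial>lebesgue_on \<Omega>)"

text \<open>The reflection in the last condition reflects that \<open>convolve \<Omega> u \<eta> x\<close>
  weights \<open>u y\<close> by \<open>\<eta> (x - y)\<close>, that is by \<open>\<eta> (-
  z)\<close> with \<open>z = y - x\<close>.\<close>

definition mollifier :: "real \<Rightarrow> (real^'n \<Rightarrow> real) \<Rightarrow> bool" where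
  "mollifier d \<eta> \<longleftrightarrow> continuous_on UNIV \<eta> \<and> (\<forall>x. 0 \<le> \<eta> x) \<and> (\<forall>x. \<eta> x \<noteq> 0 \<longrightarrow> norm x < d) \<and>
     (\<integral>\<^sup>+z. ennreal (\<eta> (- z)) \<partial>lborel) = 1"

text \<open>The threshold \<open>d\<close> is uniform over all mollifiers with small support, whatever their
  shape or position: it is the modulus of continuity of translations.\<close>

lemma mollify_L2:
  fixes \<Omega> :: "(real^'n) set"
  assumes \<Omega>: "open \<Omega>" "bounded \<Omega>" and u: "u \<in> L2 \<Omega>" and \<epsilon>: "0 < \<epsilon>"
  obtains d where "0 < d"
    "\<And>\<eta>. mollifier d \<eta> \<Longrightarrow>
       (\<integral>\<^sup>+x. ennreal ((convolve \<Omega> u \<eta> x - indicator \<Omega> x * u x)\<^sup>2) \<partial>lebesgue) \<le> ennreal \<epsilon>"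
proof -
  obtain g where g: "g \<in> borel_measurable borel" "integrable lborel g" "integrable lborel (\<lambda>x. (g x)\<^sup>2)"
    "AE x in lborel. g x = indicator \<Omega> x * u x"
    using L2_borel_rep[OF \<Omega> u] by blast
  note [measurable] = g(1)
  have "\<forall>\<^sub>F z in at 0. (\<integral>x. (g (x + z) - g x)\<^sup>2 \<partial>lborel) < \<epsilon>"
    using L2_translation_tendsto[OF g(2,3)] \<epsilon> by (intro order_tendstoD(2)) auto
  then obtain d where d: "0 < d" "\<And>z. z \<noteq> 0 \<Longrightarrow> norm z < d \<Longrightarrow> (\<integral>x. (g (x + z) - g x)\<^sup>2 \<partial>lborel) < \<epsilon>"
    unfolding eventually_at by (auto simp: dist_norm)
  have nn: "(\<integral>\<^sup>+x. ennreal ((g (x + z) - g x)\<^sup>2) \<partial>lborel) \<le> ennreal \<epsilon>" if "norm z < d" for z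
  proof -
    have gg: "g \<in> sq_int lborel" "(\<lambda>x. g (x + z)) \<in> sq_int lborel"
      using g integrable_translate(1)[OF g(3), of z] by (auto simp: sq_int_def)
    have "integrable lborel (\<lambda>x. (g (x + z) - g x)\<^sup>2)"
      using sq_int_diff[OF gg(2,1)] by (simp add: sq_int_def)
    then have "(\<integral>\<^sup>+x. ennreal ((g (x + z) - g x)\<^sup>2) \<partial>lborel) = ennreal (\<integral>x. (g (x + z) - g x)\<^sup>2 \<partial>lborel)"
      by (intro nn_integral_eq_integral) auto
    also have "\<dots> \<le> ennreal \<epsilon>"
      using d(2)[of z] that \<epsilon> by (cases "z = 0") (auto intro!: ennreal_leI)
    finally show ?thesis .
  qed
  show ?thesis
  proof (rule that[OF d(1)])
    fix \<eta> :: "real^'n \<Rightarrow> real"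
    assume "mollifier d \<eta>"
    then have \<eta>: "continuous_on UNIV \<eta>" "\<And>x. 0 \<le> \<eta> x" "\<And>x. \<eta> x \<noteq> 0 \<Longrightarrow> norm x < d"
      "(\<integral>\<^sup>+z. ennreal (\<eta> (- z)) \<partial>lborel) = 1"
      by (auto simp: mollifier_def)
    have [measurable]: "\<eta> \<in> borel_measurable borel"
      using \<eta>(1) by (rule borel_measurable_continuous_onI)
    obtain C where C: "\<And>x. \<bar>\<eta> x\<bar> \<le> C"
    proof -
      have "x \<in> cball 0 d" if "\<eta> x \<noteq> 0" for x using \<eta>(3)[OF that] by simp
      from continuous_compact_support(2)[OF \<eta>(1) compact_cball this] show ?thesis using that by blast
    qed
    have cv: "convolve \<Omega> u \<eta> x = (\<integral>y. g y * \<eta> (- (y - x)) \<partial>lborel)" for x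
    proof -
      have "(\<lambda>y. \<eta> (x - y)) \<in> borel_measurable borel" by measurable
      from lebesgue_on_integral_rep[OF \<Omega>(1) u g(1,4) this] show ?thesis by (simp add: convolve_def)
    qed
    have "(\<integral>\<^sup>+x. ennreal ((convolve \<Omega> u \<eta> x - indicator \<Omega> x * u x)\<^sup>2) \<partial>lebesgue)
      = (\<integral>\<^sup>+x. ennreal (((\<integral>y. g y * \<eta> (- (y - x)) \<partial>lborel) - g x)\<^sup>2) \<partial>lborel)"
      unfolding nn_integral_completion cv
      by (rule nn_integral_cong_AE, rule eventually_mono[OF g(4)]) simp
    also have "\<dots> \<le> ennreal \<epsilon>"
    proof (rule mollify_bound[OF g(2) nn _ _ _ _ \<eta>(4), where C = C])
      show "(\<lambda>z. \<eta> (- z)) \<in> borel_measurable borel" by measurable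
      show "0 \<le> \<eta> (- z)" for z by (rule \<eta>(2))
      show "\<eta> (- z) \<le> C" for z using C[of "- z"] by simp
      show "\<eta> (- z) \<noteq> 0 \<Longrightarrow> norm z < d" for z using \<eta>(3)[of "- z"] by simp
    qed
    finally show "(\<integral>\<^sup>+x. ennreal ((convolve \<Omega> u \<eta> x - indicator \<Omega> x * u x)\<^sup>2) \<partial>lebesgue) \<le> ennreal \<epsilon>" .
  qed
qed

section \<open>Test functions and weak derivatives\<close>

lemma test_functionI:
  assumes "smooth \<phi>" "compact S" "S \<subseteq> \<Omega>" "\<And>x. \<phi> x \<noteq> 0 \<Longrightarrow> x \<in> S"
  shows "test_function \<Omega> \<phi>"
proof -
  have "closure {x. \<phi> x \<noteq> 0} \<subseteq> S"
    using assms(2,4) by (intro closure_minimal compact_imp_closed) auto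
  then show ?thesis
    using assms compact_Int_closed[OF assms(2), of "closure {x. \<phi> x \<noteq> 0}"]
    by (auto simp: test_function_def smooth_def Int_absorb1)
qed

lemma test_function_smooth: "test_function \<Omega> \<phi> \<Longrightarrow> smooth \<phi>"
  by (simp add: test_function_def smooth_def)

text \<open>The reflected translate \<open>y \<mapsto> \<eta> (x - y)\<close> of a mollifier is the test
  function to which weak derivatives are applied; its derivatives in \<open>y\<close> stay
  explicit.\<close>

lemma tensor_reflect:
  assumes "\<forall>i. deriv_chain (b i)"
  obtains c where "\<forall>i. deriv_chain (c i)"
    "\<And>m y. tensor c m y = (-1) ^ (\<Sum>i\<in>UNIV. m i) * tensor b m (x - y)"
proof -
  define c where "c i j t = (-1) ^ j * b i j ((-1) * t + x $ i)" for i j t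
  have "\<forall>i. deriv_chain (c i)"
    unfolding c_def using assms by (blast intro: deriv_chain_affine)
  moreover have "tensor c m y = (-1) ^ (\<Sum>i\<in>UNIV. m i) * tensor b m (x - y)" for m y
    by (simp add: tensor_def c_def prod.distrib power_sum)
  ultimately show ?thesis using that by blast
qed

text \<open>Up to a sign, a derivative of \<open>\<eta> (x - y)\<close> in \<open>x\<close> is one in
  \<open>y\<close>, and the definition of the weak derivative moves it from \<open>\<eta>\<close>
  to \<open>u\<close>. This needs \<open>\<eta> (x - y)\<close> to be supported inside the domain.\<close>

lemma weak_deriv_convolve:
  assumes b: "\<forall>i. deriv_chain (b i)" and w: "is_weak_deriv \<Omega> \<alpha> u w"
    and S: "compact S" "S \<subseteq> \<Omega>" "\<And>y. tensor b (\<lambda>_. 0) (x - y) \<noteq> 0 \<Longrightarrow> y \<in> S"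
  shows "convolve \<Omega> u (tensor b \<alpha>) x = convolve \<Omega> w (tensor b (\<lambda>_. 0)) x"
proof -
  obtain c where c: "\<forall>i. deriv_chain (c i)"
    "\<And>m y. tensor c m y = (-1) ^ (\<Sum>i\<in>UNIV. m i) * tensor b m (x - y)"
    using tensor_reflect[OF b] by blast
  define s :: real where "s = (-1) ^ (\<Sum>i\<in>UNIV. \<alpha> i)"
  have "s * s = 1" by (simp add: s_def flip: power_add)
  have "test_function \<Omega> (tensor c (\<lambda>_. 0))"
    using S by (intro test_functionI[OF smooth_tensor[OF c(1)] S(1,2)]) (auto simp: c(2))
  with w have "(\<integral>y. u y * multi_deriv \<alpha> (tensor c (\<lambda>_. 0)) y \<partial>lebesgue_on \<Omega>)
     = s * (\<integral>y. w y * tensor c (\<lambda>_. 0) y \<partial>lebesgue_on \<Omega>)"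
    unfolding is_weak_deriv_def s_def by blast
  also have "multi_deriv \<alpha> (tensor c (\<lambda>_. 0)) = (\<lambda>y. s * tensor b \<alpha> (x - y))"
    by (rule ext) (simp add: multi_deriv_tensor[OF c(1)] c(2) s_def)
  finally have "s * (\<integral>y. u y * tensor b \<alpha> (x - y) \<partial>lebesgue_on \<Omega>)
     = s * (\<integral>y. w y * tensor b (\<lambda>_. 0) (x - y) \<partial>lebesgue_on \<Omega>)"
    by (simp add: c(2) mult.left_commute)
  then show ?thesis
    using \<open>s * s = 1\<close> by (auto simp: convolve_def)
qed

text \<open>Mollifying \<open>w\<close> at a point of positive distance from the complement integrates
  \<open>w\<close> against a test function and gives \<open>0\<close>, while the mollified
  functions converge to \<open>w\<close> in the mean.\<close>

lemma fundamental_lemma: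
  fixes \<Omega> :: "(real^'n) set"
  assumes \<Omega>: "open \<Omega>" "bounded \<Omega>" and w: "w \<in> L2 \<Omega>"
    and 0: "\<And>\<phi>. test_function \<Omega> \<phi> \<Longrightarrow> (\<integral>x. w x * \<phi> x \<partial>lebesgue_on \<Omega>) = 0"
  shows "AE x in lebesgue_on \<Omega>. w x = 0"
proof -
  have m: "(\<lambda>x. indicator \<Omega> x * w x) \<in> borel_measurable lebesgue"
    by (rule L2_extend_measurable[OF \<Omega>(1) w])
  define A where "A r = {x. ball x r \<subseteq> \<Omega>}" for r
  have A_meas: "A r \<in> sets borel" for r
  proof -
    have "- A r = (\<Union>y\<in>- \<Omega>. ball y r)"
      by (auto simp: A_def dist_commute subset_iff)
    then have "closed (A r)"
      by (simp add: closed_def open_UN)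
    then show ?thesis by simp
  qed
  have "AE x in lebesgue. x \<in> A r \<longrightarrow> indicator \<Omega> x * w x = 0" if "0 < r" for r
  proof -
    have le: "(\<integral>\<^sup>+x. ennreal ((indicator \<Omega> x * w x)\<^sup>2) * indicator (A r) x \<partial>lebesgue) \<le> 0 + ennreal \<epsilon>" if "0 < \<epsilon>" for \<epsilon>
    proof -
      obtain d where d: "0 < d" "\<And>\<eta>. mollifier d \<eta> \<Longrightarrow>
         (\<integral>\<^sup>+x. ennreal ((convolve \<Omega> w \<eta> x - indicator \<Omega> x * w x)\<^sup>2) \<partial>lebesgue) \<le> ennreal \<epsilon>"
        using mollify_L2[OF \<Omega> w \<open>0 < \<epsilon>\<close>] by blast
      define q where "q = min d r / 2"
      have q: "0 < q" "q < d" "q < r" using \<open>0 < r\<close> d(1) by (auto simp: q_def)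
      obtain b where "tensor_mollifier (0 :: real^'n) q b"
        using tensor_mollifier_exists[OF q(1)] by blast
      then have b: "\<forall>i. deriv_chain (b i)" "\<And>x. 0 \<le> tensor b (\<lambda>_. 0) x"
        "\<And>x. tensor b (\<lambda>_. 0) x \<noteq> 0 \<Longrightarrow> norm (x - 0) \<le> q"
        "(\<integral>\<^sup>+z. ennreal (tensor b (\<lambda>_. 0) (- z)) \<partial>lborel) = 1"
        by (simp_all add: tensor_mollifier_def)
      have cv0: "convolve \<Omega> w (tensor b (\<lambda>_. 0)) x = 0" if "x \<in> A r" for x
      proof -
        obtain c where c: "\<forall>i. deriv_chain (c i)"
          "\<And>m y. tensor c m y = (-1) ^ (\<Sum>i\<in>UNIV. m i) * tensor b m (x - y)"
          using tensor_reflect[OF b(1)] by blast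
        have "test_function \<Omega> (tensor c (\<lambda>_. 0))"
        proof (rule test_functionI[OF smooth_tensor[OF c(1)], of "cball x q"])
          show "cball x q \<subseteq> \<Omega>" using that q by (force simp: A_def)
          show "y \<in> cball x q" if "tensor c (\<lambda>_. 0) y \<noteq> 0" for y
            using that b(3)[of "x - y"] by (simp add: c(2) dist_norm)
        qed simp
        from 0[OF this] show ?thesis by (simp add: convolve_def c(2))
      qed
      have "(\<integral>\<^sup>+x. ennreal ((indicator \<Omega> x * w x)\<^sup>2) * indicator (A r) x \<partial>lebesgue)
        \<le> (\<integral>\<^sup>+x. ennreal ((convolve \<Omega> w (tensor b (\<lambda>_. 0)) x - indicator \<Omega> x * w x)\<^sup>2) \<partial>lebesgue)"
        by (intro nn_integral_mono) (auto simp: indicator_def cv0)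
      also have "\<dots> \<le> ennreal \<epsilon>"
      proof (rule d(2))
        have "norm x < d" if "tensor b (\<lambda>_. 0) x \<noteq> 0" for x
          using b(3)[OF that] q by simp
        then show "mollifier d (tensor b (\<lambda>_. 0))"
          using b(2,4) smooth_continuous[OF smooth_tensor[OF b(1)]] by (simp add: mollifier_def)
      qed
      finally show ?thesis by simp
    qed
    have *: "(\<integral>\<^sup>+x. ennreal ((indicator \<Omega> x * w x)\<^sup>2) * indicator (A r) x \<partial>lebesgue) \<le> 0"
      by (rule ennreal_le_epsilon) (rule le)
    have "AE x in lebesgue. ennreal ((indicator \<Omega> x * w x)\<^sup>2) * indicator (A r) x = 0"
    proof -
      have "(\<lambda>x. ennreal ((indicator \<Omega> x * w x)\<^sup>2) * indicator (A r) x) \<in> borel_measurable lebesgue"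
      proof -
        have [measurable]: "A r \<in> sets lebesgue" using A_meas[of r] by simp
        note [measurable] = m
        show ?thesis by measurable
      qed
      with * show ?thesis by (simp only: le_zero_eq nn_integral_0_iff_AE)
    qed
    then show ?thesis
      by (rule eventually_mono) (auto simp: indicator_def split: if_splits)
  qed
  then have "AE x in lebesgue. \<forall>j. x \<in> A (1 / Suc j) \<longrightarrow> indicator \<Omega> x * w x = 0"
    unfolding AE_all_countable by simp
  then have "AE x in lebesgue. x \<in> \<Omega> \<longrightarrow> w x = 0"
  proof eventually_elim
    case (elim x)
    show ?case
    proof
      assume x: "x \<in> \<Omega>"
      then obtain r where r: "0 < r" "ball x r \<subseteq> \<Omega>" using \<Omega>(1) open_contains_ball by blast
      then obtain j where "1 / real (Suc j) < r" using nat_approx_posE by blast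
      then have "ball x (1 / real (Suc j)) \<subseteq> \<Omega>"
        using r(2) subset_ball[of "1 / real (Suc j)" r x] by auto
      with elim x show "w x = 0" by (auto simp: A_def)
    qed
  qed
  then show ?thesis
    using \<Omega>(1) by (simp add: AE_restrict_space_iff)
qed


section \<open>Weak derivatives and the Sobolev norm\<close>

locale bounded_open_set =
  fixes \<Omega> :: "(real^'n) set"
  assumes open_\<Omega>: "open \<Omega>" and bounded_\<Omega>: "bounded \<Omega>"
begin

lemma finite_measure_\<Omega>: "finite_measure (lebesgue_on \<Omega>)"
  using open_\<Omega> bounded_\<Omega> by (intro finite_measure_lebesgue_on lmeasurable_open)

lemma continuous_measurable_\<Omega>:
  assumes "continuous_on UNIV f"
  shows "f \<in> borel_measurable (lebesgue_on \<Omega>)"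
proof -
  have "f \<in> borel_measurable lborel"
    using borel_measurable_continuous_onI[OF assms] by simp
  then show ?thesis
    by (intro measurable_restrict_space1 measurable_completion)
qed

lemma continuous_in_L2:
  assumes "continuous_on UNIV f"
  shows "f \<in> L2 \<Omega>"
proof -
  interpret finite_measure "lebesgue_on \<Omega>" by (rule finite_measure_\<Omega>)
  have "compact (f ` closure \<Omega>)"
    using bounded_\<Omega> continuous_on_subset[OF assms] by (intro compact_continuous_image) (auto simp: compact_closure)
  then obtain C where "\<And>y. y \<in> f ` closure \<Omega> \<Longrightarrow> \<bar>y\<bar> \<le> C"
    using compact_imp_bounded[of "f ` closure \<Omega>"] by (auto simp: bounded_iff)
  then have C: "\<And>x. x \<in> \<Omega> \<Longrightarrow> \<bar>f x\<bar> \<le> C"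
    using closure_subset by blast
  have m: "f \<in> borel_measurable (lebesgue_on \<Omega>)"
    by (intro continuous_measurable_\<Omega> assms)
  have "integrable (lebesgue_on \<Omega>) (\<lambda>x. (f x)\<^sup>2)"
  proof (rule Bochner_Integration.integrable_bound[of _ "\<lambda>x. C\<^sup>2"])
    show "AE x in lebesgue_on \<Omega>. norm ((f x)\<^sup>2) \<le> norm (C\<^sup>2)"
    proof (rule AE_I2)
      fix x assume "x \<in> space (lebesgue_on \<Omega>)"
      then have "x \<in> \<Omega>" by simp
      from power_mono[OF C[OF this] abs_ge_zero, of 2]
      show "norm ((f x)\<^sup>2) \<le> norm (C\<^sup>2)" by simp
    qed
  qed (use m in auto)
  with m show ?thesis by (simp add: L2_def)
qed

lemma smooth_in_L2: "smooth f \<Longrightarrow> f \<in> L2 \<Omega>"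
  by (intro continuous_in_L2 smooth_continuous)

lemma L2_add: "f \<in> L2 \<Omega> \<Longrightarrow> g \<in> L2 \<Omega> \<Longrightarrow> (\<lambda>x. f x + g x) \<in> L2 \<Omega>"
  unfolding L2_eq_sq_int by (rule sq_int_add)

lemma L2_diff: "f \<in> L2 \<Omega> \<Longrightarrow> g \<in> L2 \<Omega> \<Longrightarrow> (\<lambda>x. f x - g x) \<in> L2 \<Omega>"
  unfolding L2_eq_sq_int by (rule sq_int_diff)

lemma L2_cmult: "f \<in> L2 \<Omega> \<Longrightarrow> (\<lambda>x. c * f x) \<in> L2 \<Omega>"
  unfolding L2_eq_sq_int by (rule sq_int_cmult)

lemma L2_mult_integrable: "f \<in> L2 \<Omega> \<Longrightarrow> g \<in> L2 \<Omega> \<Longrightarrow> integrable (lebesgue_on \<Omega>) (\<lambda>x. f x * g x)"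
  unfolding L2_eq_sq_int by (rule sq_int_mult_integrable)

lemma smooth_fold_partial: "smooth f \<Longrightarrow> smooth (fold partial_deriv ws f)"
  by (induction ws arbitrary: f) (auto intro: smooth_partial)

lemma test_function_in_L2: "test_function \<Omega> \<phi> \<Longrightarrow> \<phi> \<in> L2 \<Omega>"
  by (intro smooth_in_L2 test_function_smooth)

lemma multi_deriv_test_in_L2: "test_function \<Omega> \<phi> \<Longrightarrow> multi_deriv \<alpha> \<phi> \<in> L2 \<Omega>"
  unfolding multi_deriv_word by (intro smooth_in_L2 smooth_fold_partial test_function_smooth)

text \<open>The fundamental lemma for the difference. It makes the choice in \<open>weak_deriv\<close>
  irrelevant.\<close>

lemma weak_deriv_unique:
  assumes "w \<in> L2 \<Omega>" "w' \<in> L2 \<Omega>" "is_weak_deriv \<Omega> \<alpha> u w" "is_weak_deriv \<Omega> \<alpha> u w'"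
  shows "AE x in lebesgue_on \<Omega>. w x = w' x"
proof -
  have "(\<integral>x. (w x - w' x) * \<phi> x \<partial>lebesgue_on \<Omega>) = 0" if \<phi>: "test_function \<Omega> \<phi>" for \<phi>
  proof -
    have "(\<integral>x. w x * \<phi> x \<partial>lebesgue_on \<Omega>) = (\<integral>x. w' x * \<phi> x \<partial>lebesgue_on \<Omega>)"
      using assms(3,4) \<phi> unfolding is_weak_deriv_def by auto
    moreover have "(\<lambda>x. (w x - w' x) * \<phi> x) = (\<lambda>x. w x * \<phi> x - w' x * \<phi> x)"
      by (auto simp: left_diff_distrib)
    ultimately show ?thesis
      using assms(1,2) test_function_in_L2[OF \<phi>] by (simp add: L2_mult_integrable)
  qed
  from fundamental_lemma[OF open_\<Omega> bounded_\<Omega> L2_diff[OF assms(1,2)] this]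
  show ?thesis by simp
qed

lemma is_weak_deriv_add:
  assumes "is_weak_deriv \<Omega> \<alpha> u w" "is_weak_deriv \<Omega> \<alpha> u' w'"
    and "u \<in> L2 \<Omega>" "u' \<in> L2 \<Omega>" "w \<in> L2 \<Omega>" "w' \<in> L2 \<Omega>"
  shows "is_weak_deriv \<Omega> \<alpha> (\<lambda>x. u x + u' x) (\<lambda>x. w x + w' x)"
  unfolding is_weak_deriv_def
proof (intro allI impI)
  fix \<phi> assume \<phi>: "test_function \<Omega> \<phi>"
  show "(\<integral>x. (u x + u' x) * multi_deriv \<alpha> \<phi> x \<partial>lebesgue_on \<Omega>) =
        (-1) ^ (\<Sum>i\<in>UNIV. \<alpha> i) * (\<integral>x. (w x + w' x) * \<phi> x \<partial>lebesgue_on \<Omega>)"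
    using assms \<phi> test_function_in_L2[OF \<phi>] multi_deriv_test_in_L2[OF \<phi>, of \<alpha>]
    by (simp add: L2_mult_integrable distrib_right distrib_left is_weak_deriv_def)
qed

lemma is_weak_deriv_cmult:
  assumes "is_weak_deriv \<Omega> \<alpha> u w"
  shows "is_weak_deriv \<Omega> \<alpha> (\<lambda>x. c * u x) (\<lambda>x. c * w x)"
  using assms by (simp add: is_weak_deriv_def mult.assoc mult.left_commute)

lemma sobolev_L2: "u \<in> sobolev k \<Omega> \<Longrightarrow> u \<in> L2 \<Omega>"
  by (simp add: sobolev_def)

lemma weak_deriv_props:
  assumes "u \<in> sobolev k \<Omega>" "(\<Sum>i\<in>UNIV. \<alpha> i) \<le> k"
  shows "weak_deriv \<Omega> \<alpha> u \<in> L2 \<Omega>" "is_weak_deriv \<Omega> \<alpha> u (weak_deriv \<Omega> \<alpha> u)"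
proof -
  have "\<exists>w. w \<in> L2 \<Omega> \<and> is_weak_deriv \<Omega> \<alpha> u w"
    using assms by (auto simp: sobolev_def)
  from someI_ex[OF this] show "weak_deriv \<Omega> \<alpha> u \<in> L2 \<Omega>" "is_weak_deriv \<Omega> \<alpha> u (weak_deriv \<Omega> \<alpha> u)"
    by (auto simp: weak_deriv_def)
qed

lemma sobolev_add:
  assumes "u \<in> sobolev k \<Omega>" "v \<in> sobolev k \<Omega>"
  shows "(\<lambda>x. u x + v x) \<in> sobolev k \<Omega>"
  unfolding sobolev_def
proof (intro CollectI conjI allI impI)
  show "(\<lambda>x. u x + v x) \<in> L2 \<Omega>" using assms by (intro L2_add sobolev_L2)
  fix \<alpha> :: "'n \<Rightarrow> nat" assume "sum \<alpha> UNIV \<le> k"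
  with assms show "\<exists>w\<in>L2 \<Omega>. is_weak_deriv \<Omega> \<alpha> (\<lambda>x. u x + v x) w"
    by (intro bexI[of _ "\<lambda>x. weak_deriv \<Omega> \<alpha> u x + weak_deriv \<Omega> \<alpha> v x"]
        is_weak_deriv_add L2_add weak_deriv_props sobolev_L2)
qed

lemma sobolev_cmult:
  assumes "u \<in> sobolev k \<Omega>"
  shows "(\<lambda>x. c * u x) \<in> sobolev k \<Omega>"
  unfolding sobolev_def
proof (intro CollectI conjI allI impI)
  show "(\<lambda>x. c * u x) \<in> L2 \<Omega>" using assms by (intro L2_cmult sobolev_L2)
  fix \<alpha> :: "'n \<Rightarrow> nat" assume "sum \<alpha> UNIV \<le> k"
  with assms show "\<exists>w\<in>L2 \<Omega>. is_weak_deriv \<Omega> \<alpha> (\<lambda>x. c * u x) w"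
    by (intro bexI[of _ "\<lambda>x. c * weak_deriv \<Omega> \<alpha> u x"] is_weak_deriv_cmult L2_cmult weak_deriv_props)
qed

text \<open>The norm may be computed from any weak derivatives. Written with \<open>L2_set\<close>, it
  inherits the triangle inequality from Euclidean space and from the Minkowski inequality.\<close>

lemma sobolev_norm_eq:
  assumes u: "u \<in> sobolev k \<Omega>"
    and w: "\<And>\<alpha>. sum \<alpha> UNIV \<le> k \<Longrightarrow> w \<alpha> \<in> L2 \<Omega> \<and> is_weak_deriv \<Omega> \<alpha> u (w \<alpha>)"
  shows "sobolev_norm k \<Omega> u = L2_set (\<lambda>\<alpha>. sqrt (\<integral>x. (w \<alpha> x)\<^sup>2 \<partial>lebesgue_on \<Omega>)) {\<alpha>. sum \<alpha> UNIV \<le> k}"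
proof -
  have "(\<integral>x. (weak_deriv \<Omega> \<alpha> u x)\<^sup>2 \<partial>lebesgue_on \<Omega>) = (\<integral>x. (w \<alpha> x)\<^sup>2 \<partial>lebesgue_on \<Omega>)"
    if \<alpha>: "sum \<alpha> UNIV \<le> k" for \<alpha>
  proof (rule integral_cong_AE)
    have "AE x in lebesgue_on \<Omega>. weak_deriv \<Omega> \<alpha> u x = w \<alpha> x"
      using weak_deriv_props[OF u \<alpha>] w[OF \<alpha>] by (intro weak_deriv_unique) auto
    then show "AE x in lebesgue_on \<Omega>. (weak_deriv \<Omega> \<alpha> u x)\<^sup>2 = (w \<alpha> x)\<^sup>2"
      by (rule eventually_mono) simp
  qed (use weak_deriv_props(1)[OF u \<alpha>] w[OF \<alpha>] in \<open>auto simp: L2_def\<close>)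
  then show ?thesis
    unfolding sobolev_norm_def L2_set_def by (intro arg_cong[where f = sqrt] sum.cong) auto
qed

lemma sobolev_norm_nonneg: "0 \<le> sobolev_norm k \<Omega> u"
  unfolding sobolev_norm_def by (intro real_sqrt_ge_zero sum_nonneg) simp

lemma sobolev_norm_cmult:
  assumes u: "u \<in> sobolev k \<Omega>"
  shows "sobolev_norm k \<Omega> (\<lambda>x. c * u x) = \<bar>c\<bar> * sobolev_norm k \<Omega> u"
proof -
  have "sobolev_norm k \<Omega> (\<lambda>x. c * u x) =
    L2_set (\<lambda>\<alpha>. sqrt (\<integral>x. (c * weak_deriv \<Omega> \<alpha> u x)\<^sup>2 \<partial>lebesgue_on \<Omega>)) {\<alpha>. sum \<alpha> UNIV \<le> k}"
    by (rule sobolev_norm_eq) (use u in \<open>auto intro: sobolev_cmult is_weak_deriv_cmult L2_cmult weak_deriv_props\<close>)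
  also have "\<dots> = L2_set (\<lambda>\<alpha>. \<bar>c\<bar> * sqrt (\<integral>x. (weak_deriv \<Omega> \<alpha> u x)\<^sup>2 \<partial>lebesgue_on \<Omega>)) {\<alpha>. sum \<alpha> UNIV \<le> k}"
    by (simp add: power_mult_distrib real_sqrt_mult)
  also have "\<dots> = \<bar>c\<bar> * L2_set (\<lambda>\<alpha>. sqrt (\<integral>x. (weak_deriv \<Omega> \<alpha> u x)\<^sup>2 \<partial>lebesgue_on \<Omega>)) {\<alpha>. sum \<alpha> UNIV \<le> k}"
    by (simp add: L2_set_right_distrib)
  also have "L2_set (\<lambda>\<alpha>. sqrt (\<integral>x. (weak_deriv \<Omega> \<alpha> u x)\<^sup>2 \<partial>lebesgue_on \<Omega>)) {\<alpha>. sum \<alpha> UNIV \<le> k} = sobolev_norm k \<Omega> u"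
    by (rule sobolev_norm_eq[symmetric]) (use u in \<open>auto intro: weak_deriv_props\<close>)
  finally show ?thesis .
qed

lemma Minkowski_L2:
  assumes "f \<in> L2 \<Omega>" "g \<in> L2 \<Omega>"
  shows "sqrt (\<integral>x. (f x + g x)\<^sup>2 \<partial>lebesgue_on \<Omega>) \<le>
     sqrt (\<integral>x. (f x)\<^sup>2 \<partial>lebesgue_on \<Omega>) + sqrt (\<integral>x. (g x)\<^sup>2 \<partial>lebesgue_on \<Omega>)"
proof -
  let ?a = "\<integral>x. (f x)\<^sup>2 \<partial>lebesgue_on \<Omega>" and ?c = "\<integral>x. (g x)\<^sup>2 \<partial>lebesgue_on \<Omega>"
    and ?b = "\<integral>x. f x * g x \<partial>lebesgue_on \<Omega>"
  have i: "integrable (lebesgue_on \<Omega>) (\<lambda>x. (f x)\<^sup>2)" "integrable (lebesgue_on \<Omega>) (\<lambda>x. (g x)\<^sup>2)"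
    "integrable (lebesgue_on \<Omega>) (\<lambda>x. f x * g x)"
    using assms L2_mult_integrable[OF assms] by (auto simp: L2_def)
  have "(\<integral>x. (f x + g x)\<^sup>2 \<partial>lebesgue_on \<Omega>) = (\<integral>x. (f x)\<^sup>2 + 2 * (f x * g x) + (g x)\<^sup>2 \<partial>lebesgue_on \<Omega>)"
    by (intro Bochner_Integration.integral_cong) (auto simp: power2_sum)
  also have "\<dots> = ?a + 2 * ?b + ?c"
    using i by simp
  also have "\<dots> \<le> ?a + 2 * (sqrt ?a * sqrt ?c) + ?c"
  proof -
    have "?b\<^sup>2 \<le> ?a * ?c"
      using Cauchy_Schwarz_integral assms unfolding L2_eq_sq_int by blast
    then have "\<bar>?b\<bar> \<le> sqrt (?a * ?c)"
      using real_sqrt_le_mono by fastforce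
    then show ?thesis by (simp add: real_sqrt_mult)
  qed
  also have "\<dots> = (sqrt ?a + sqrt ?c)\<^sup>2"
    by (simp add: power2_sum)
  finally show ?thesis
    by (intro real_le_lsqrt) auto
qed

lemma sobolev_norm_triangle:
  assumes u: "u \<in> sobolev k \<Omega>" and v: "v \<in> sobolev k \<Omega>"
  shows "sobolev_norm k \<Omega> (\<lambda>x. u x + v x) \<le> sobolev_norm k \<Omega> u + sobolev_norm k \<Omega> v"
proof -
  let ?I = "{\<alpha>. sum \<alpha> UNIV \<le> k} :: ('n \<Rightarrow> nat) set"
  let ?N = "\<lambda>w. sqrt (\<integral>x. (w x)\<^sup>2 \<partial>lebesgue_on \<Omega>)"
  have "sobolev_norm k \<Omega> (\<lambda>x. u x + v x) = L2_set (\<lambda>\<alpha>. ?N (\<lambda>x. weak_deriv \<Omega> \<alpha> u x + weak_deriv \<Omega> \<alpha> v x)) ?I"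
    by (rule sobolev_norm_eq) (use u v in \<open>auto intro!: sobolev_add is_weak_deriv_add L2_add weak_deriv_props intro: sobolev_L2\<close>)
  also have "\<dots> \<le> L2_set (\<lambda>\<alpha>. ?N (weak_deriv \<Omega> \<alpha> u) + ?N (weak_deriv \<Omega> \<alpha> v)) ?I"
    using u v by (intro L2_set_mono Minkowski_L2 weak_deriv_props real_sqrt_ge_zero) auto
  also have "\<dots> \<le> L2_set (\<lambda>\<alpha>. ?N (weak_deriv \<Omega> \<alpha> u)) ?I + L2_set (\<lambda>\<alpha>. ?N (weak_deriv \<Omega> \<alpha> v)) ?I"
    by (rule L2_set_triangle_ineq)
  also have "L2_set (\<lambda>\<alpha>. ?N (weak_deriv \<Omega> \<alpha> u)) ?I = sobolev_norm k \<Omega> u"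
    by (rule sobolev_norm_eq[symmetric]) (use u in \<open>auto intro: weak_deriv_props\<close>)
  also have "L2_set (\<lambda>\<alpha>. ?N (weak_deriv \<Omega> \<alpha> v)) ?I = sobolev_norm k \<Omega> v"
    by (rule sobolev_norm_eq[symmetric]) (use v in \<open>auto intro: weak_deriv_props\<close>)
  finally show ?thesis .
qed

end

section \<open>Smooth functions in Sobolev spaces\<close>

lemma partial_deriv_outside_support:
  assumes "smooth h" "closed S" "\<And>x. h x \<noteq> 0 \<Longrightarrow> x \<in> S" "x \<notin> S"
  shows "partial_deriv i h x = 0"
proof -
  have "partial_deriv i h x = partial_deriv i (\<lambda>_. 0) x"
    by (rule partial_deriv_transform_open[of "- S"]) (use assms in auto)
  then show ?thesis by (simp add: partial_deriv_const)
qed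

lemma line_derivative:
  assumes "smooth h"
  shows "((\<lambda>t. h (x + t *\<^sub>R axis i 1)) has_real_derivative partial_deriv i h (x + t *\<^sub>R axis i 1)) (at t)"
proof -
  let ?D = "frechet_derivative h (at (x + t *\<^sub>R axis i 1))"
  have D: "(h has_derivative ?D) (at (x + t *\<^sub>R axis i 1))"
    by (rule smooth_has_derivative[OF assms])
  have "((\<lambda>t. x + t *\<^sub>R axis i 1) has_derivative (\<lambda>s. s *\<^sub>R axis i 1)) (at t)"
    by (auto intro!: derivative_eq_intros)
  from has_derivative_compose[OF this D]
  have "((\<lambda>t. h (x + t *\<^sub>R axis i 1)) has_derivative (\<lambda>s. ?D (s *\<^sub>R axis i 1))) (at t)" .
  moreover have "?D (s *\<^sub>R axis i 1) = s * partial_deriv i h (x + t *\<^sub>R axis i 1)" for s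
    using linear_cmul[OF has_derivative_linear[OF D], of s "axis i 1"] by (simp add: partial_deriv_def)
  moreover have "(\<lambda>s. s * partial_deriv i h (x + t *\<^sub>R axis i 1)) = (*) (partial_deriv i h (x + t *\<^sub>R axis i 1))"
    by (simp add: fun_eq_iff mult.commute)
  ultimately show ?thesis
    by (simp add: has_field_derivative_def)
qed

text \<open>Translation invariance of Lebesgue measure makes the integral of every difference quotient of
  \<open>h\<close> vanish, and the difference quotients converge boundedly to the derivative.\<close>

lemma integral_partial_deriv_0:
  fixes h :: "real^'n \<Rightarrow> real"
  assumes h: "smooth h" and S: "compact S" "\<And>x. h x \<noteq> 0 \<Longrightarrow> x \<in> S"
  shows "(\<integral>x. partial_deriv i h x \<partial>lborel) = 0"
proof -
  define e :: "real^'n" where "e = axis i 1"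
  have ne: "norm e = 1" by (simp add: e_def norm_axis_1)
  define t where "t m = 1 / real (Suc m)" for m
  have t: "0 < t m" "t m \<le> 1" for m by (auto simp: t_def)
  have t0: "t \<longlonglongrightarrow> 0" unfolding t_def by (rule LIMSEQ_Suc[OF lim_1_over_n])
  have ih: "integrable lborel h"
    by (rule continuous_compact_support(1)[OF smooth_continuous[OF h] S])
  have supp': "x \<in> S" if "partial_deriv i h x \<noteq> 0" for x
    using partial_deriv_outside_support[OF h compact_imp_closed[OF S(1)] S(2)] that by blast
  obtain C where C: "\<And>x. \<bar>partial_deriv i h x\<bar> \<le> C"
    using continuous_compact_support(2)[OF smooth_continuous[OF smooth_partial[OF h]] S(1) supp'] by blast
  have "0 \<le> C" using C[of 0] by linarith
  obtain R where R: "\<And>x. x \<in> S \<Longrightarrow> norm x \<le> R"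
    using compact_imp_bounded[OF S(1)] by (auto simp: bounded_iff)
  define q where "q m x = (h (x + t m *\<^sub>R e) - h x) / t m" for m x
  have bound: "\<bar>q m x\<bar> \<le> C * indicator (cball 0 (R + 1)) x" for m x
  proof (cases "x \<in> cball 0 (R + 1)")
    case True
    have "\<exists>z>0. z < t m \<and> h (x + t m *\<^sub>R axis i 1) - h (x + 0 *\<^sub>R axis i 1) = (t m - 0) * partial_deriv i h (x + z *\<^sub>R axis i 1)"
      by (rule MVT2[OF t(1) line_derivative[OF h]])
    then obtain z where "h (x + t m *\<^sub>R e) - h x = t m * partial_deriv i h (x + z *\<^sub>R e)"
      by (auto simp: e_def)
    then have "q m x = partial_deriv i h (x + z *\<^sub>R e)"
      using t(1)[of m] by (simp add: q_def)
    with C True show ?thesis by simp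
  next
    case False
    have "h x = 0" using R[of x] S(2)[of x] False by force
    moreover have "h (x + t m *\<^sub>R e) = 0"
    proof (rule ccontr)
      assume "h (x + t m *\<^sub>R e) \<noteq> 0"
      then have "norm (x + t m *\<^sub>R e) \<le> R" using R S(2) by blast
      moreover have "norm x \<le> norm (x + t m *\<^sub>R e) + norm (t m *\<^sub>R e)"
        by (metis add_diff_cancel norm_triangle_ineq4)
      moreover have "norm (t m *\<^sub>R e) \<le> 1" using t[of m] ne by simp
      ultimately show False using False by simp
    qed
    ultimately show ?thesis using False by (simp add: q_def)
  qed
  have "(\<lambda>m. \<integral>x. q m x \<partial>lborel) \<longlonglongrightarrow> (\<integral>x. partial_deriv i h x \<partial>lborel)"
  proof (rule integral_dominated_convergence[where w = "\<lambda>x. C * indicator (cball 0 (R + 1)) x"])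
    show "partial_deriv i h \<in> borel_measurable lborel"
      using borel_measurable_continuous_onI[OF smooth_continuous[OF smooth_partial[OF h]]] by simp
    have [measurable]: "h \<in> borel_measurable borel"
      by (rule borel_measurable_continuous_onI[OF smooth_continuous[OF h]])
    show "q m \<in> borel_measurable lborel" for m
      unfolding q_def by measurable
    show "integrable lborel (\<lambda>x. C * indicator (cball 0 (R + 1)) (x :: real^'n))"
      using emeasure_bounded_finite[of "cball 0 (R + 1) :: (real^'n) set"]
      by (intro integrable_mult_right integrable_real_indicator) auto
    show "AE x in lborel. norm (q m x) \<le> C * indicator (cball 0 (R + 1)) x" for m
      using bound by (intro AE_I2) simp
    show "AE x in lborel. (\<lambda>m. q m x) \<longlonglongrightarrow> partial_deriv i h x"
    proof (rule AE_I2)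
      fix x
      have "((\<lambda>s. (h (x + s *\<^sub>R e) - h x) / s) \<longlongrightarrow> partial_deriv i h x) (at 0)"
        using line_derivative[OF h, of x i 0] by (simp add: DERIV_def e_def)
      moreover have "filterlim t (at 0) sequentially"
        using t0 t(1) by (auto simp: filterlim_at intro!: always_eventually less_imp_neq[symmetric])
      ultimately show "(\<lambda>m. q m x) \<longlonglongrightarrow> partial_deriv i h x"
        unfolding q_def by (rule filterlim_compose)
    qed
  qed
  moreover have "(\<integral>x. q m x \<partial>lborel) = 0" for m
    unfolding q_def using integrable_translate[OF ih, of "t m *\<^sub>R e"] ih by simp
  ultimately show ?thesis
    by (simp add: LIMSEQ_const_iff)
qed

lemma test_function_supp:
  assumes "test_function \<Omega> \<phi>"
  obtains S where "compact S" "S \<subseteq> \<Omega>" "\<And>x. \<phi> x \<noteq> 0 \<Longrightarrow> x \<in> S"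
proof (rule that)
  show "compact (closure {x. \<phi> x \<noteq> 0})" "closure {x. \<phi> x \<noteq> 0} \<subseteq> \<Omega>"
    using assms by (auto simp: test_function_def)
  show "x \<in> closure {x. \<phi> x \<noteq> 0}" if "\<phi> x \<noteq> 0" for x
    using that closure_subset[of "{x. \<phi> x \<noteq> 0}"] by blast
qed

lemma test_function_partial:
  assumes "test_function \<Omega> \<phi>"
  shows "test_function \<Omega> (partial_deriv i \<phi>)"
proof -
  obtain S where S: "compact S" "S \<subseteq> \<Omega>" "\<And>x. \<phi> x \<noteq> 0 \<Longrightarrow> x \<in> S"
    using test_function_supp[OF assms] by blast
  have "x \<in> S" if "partial_deriv i \<phi> x \<noteq> 0" for x
    using partial_deriv_outside_support[OF test_function_smooth[OF assms] compact_imp_closed[OF S(1)] S(3)] that by blast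
  then show ?thesis
    using S by (intro test_functionI[of _ S] smooth_partial test_function_smooth[OF assms])
qed

context bounded_open_set
begin

lemma integration_by_parts:
  assumes f: "smooth f" and \<phi>: "test_function \<Omega> \<phi>"
  shows "(\<integral>x. f x * partial_deriv i \<phi> x \<partial>lebesgue_on \<Omega>) = - (\<integral>x. partial_deriv i f x * \<phi> x \<partial>lebesgue_on \<Omega>)"
proof -
  obtain S where S: "compact S" "S \<subseteq> \<Omega>" "\<And>x. \<phi> x \<noteq> 0 \<Longrightarrow> x \<in> S"
    using test_function_supp[OF \<phi>] by blast
  have s\<phi>: "smooth \<phi>" using \<phi> by (rule test_function_smooth)
  define h where "h x = f x * \<phi> x" for x
  have h: "smooth h" "\<And>x. h x \<noteq> 0 \<Longrightarrow> x \<in> S"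
    unfolding h_def using f s\<phi> S(3) by (auto intro: smooth_mult)
  have out: "partial_deriv i h x = 0" if "x \<notin> \<Omega>" for x
    using partial_deriv_outside_support[OF h(1) compact_imp_closed[OF S(1)] h(2)] that S(2) by blast
  have "(\<integral>x. partial_deriv i h x \<partial>lebesgue_on \<Omega>) = (\<integral>x. indicator \<Omega> x *\<^sub>R partial_deriv i h x \<partial>lebesgue)"
    using open_\<Omega> by (intro integral_restrict_space) simp
  also have "(\<lambda>x. indicator \<Omega> x *\<^sub>R partial_deriv i h x) = partial_deriv i h"
    using out by (auto simp: indicator_def fun_eq_iff)
  also have "(\<integral>x. partial_deriv i h x \<partial>lebesgue) = (\<integral>x. partial_deriv i h x \<partial>lborel)"
    using borel_measurable_continuous_onI[OF smooth_continuous[OF smooth_partial[OF h(1)]]]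
    by (intro integral_completion) simp
  also have "\<dots> = 0" by (rule integral_partial_deriv_0[OF h(1) S(1) h(2)])
  finally have "(\<integral>x. partial_deriv i f x * \<phi> x + f x * partial_deriv i \<phi> x \<partial>lebesgue_on \<Omega>) = 0"
    unfolding h_def partial_deriv_mult[OF f s\<phi>] .
  then show ?thesis
    using f s\<phi> by (simp add: L2_mult_integrable smooth_in_L2 smooth_partial)
qed

text \<open>The directions move over to \<open>f\<close> one by one and arrive there in reverse order.\<close>

lemma integration_by_parts_fold:
  assumes "smooth f" "test_function \<Omega> \<phi>"
  shows "(\<integral>x. f x * fold partial_deriv ws \<phi> x \<partial>lebesgue_on \<Omega>) =
     (-1) ^ length ws * (\<integral>x. fold partial_deriv (rev ws) f x * \<phi> x \<partial>lebesgue_on \<Omega>)"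
  using assms
proof (induction ws arbitrary: \<phi>)
  case (Cons i ws)
  have "(\<integral>x. f x * fold partial_deriv (i # ws) \<phi> x \<partial>lebesgue_on \<Omega>)
     = (-1) ^ length ws * (\<integral>x. fold partial_deriv (rev ws) f x * partial_deriv i \<phi> x \<partial>lebesgue_on \<Omega>)"
    using Cons.IH[OF Cons.prems(1) test_function_partial[OF Cons.prems(2)]] by simp
  then show ?case
    using integration_by_parts[OF smooth_fold_partial[OF Cons.prems(1)] Cons.prems(2)] by simp
qed simp

lemma smooth_is_weak_deriv:
  "smooth f \<Longrightarrow> is_weak_deriv \<Omega> \<alpha> f (fold partial_deriv (rev (word \<alpha>)) f)"
  unfolding is_weak_deriv_def multi_deriv_word length_word[symmetric]
  using integration_by_parts_fold by blast

lemma smooth_in_sobolev: "smooth f \<Longrightarrow> f \<in> sobolev k \<Omega>"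
  unfolding sobolev_def
  by (blast intro: smooth_in_L2 smooth_fold_partial smooth_is_weak_deriv)

end

lemma finite_multi_indices: "finite {\<alpha> :: 'n::finite \<Rightarrow> nat. sum \<alpha> UNIV \<le> k}"
proof (rule finite_subset)
  show "{\<alpha> :: 'n \<Rightarrow> nat. sum \<alpha> UNIV \<le> k} \<subseteq> PiE UNIV (\<lambda>_. {..k})"
  proof
    fix \<alpha> :: "'n \<Rightarrow> nat" assume "\<alpha> \<in> {\<alpha>. sum \<alpha> UNIV \<le> k}"
    then have "\<alpha> i \<le> k" for i
      using member_le_sum[of i UNIV \<alpha>] by simp
    then show "\<alpha> \<in> PiE UNIV (\<lambda>_. {..k})" by auto
  qed
qed (simp add: finite_PiE)

text \<open>Convergence in the mean on \<open>A\<close> of all classical derivatives up to order \<open>k\<close>, to unspecified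
  limits.\<close>

primrec l2conv :: "nat \<Rightarrow> (real^'n) set \<Rightarrow> (nat \<Rightarrow> real^'n \<Rightarrow> real) \<Rightarrow> bool" where
  "l2conv 0 A f \<longleftrightarrow> (\<exists>F\<in>L2 A. (\<lambda>m. \<integral>x. (f m x - F x)\<^sup>2 \<partial>lebesgue_on A) \<longlonglongrightarrow> 0)"
| "l2conv (Suc k) A f \<longleftrightarrow> (\<exists>F\<in>L2 A. (\<lambda>m. \<integral>x. (f m x - F x)\<^sup>2 \<partial>lebesgue_on A) \<longlonglongrightarrow> 0) \<and>
     (\<forall>i. l2conv k A (\<lambda>m. partial_deriv i (f m)))"

lemma l2conv_limit: "l2conv k A f \<Longrightarrow> \<exists>F\<in>L2 A. (\<lambda>m. \<integral>x. (f m x - F x)\<^sup>2 \<partial>lebesgue_on A) \<longlonglongrightarrow> 0"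
  by (cases k) auto

lemma l2conv_SucD: "l2conv (Suc k) A f \<Longrightarrow> l2conv k A f"
  by (induction k arbitrary: f) auto

lemma l2conv_fold:
  "l2conv k A f \<Longrightarrow> length ws \<le> k \<Longrightarrow>
     \<exists>F\<in>L2 A. (\<lambda>m. \<integral>x. (fold partial_deriv ws (f m) x - F x)\<^sup>2 \<partial>lebesgue_on A) \<longlonglongrightarrow> 0"
proof (induction ws arbitrary: k f)
  case Nil
  then show ?case using l2conv_limit by simp
next
  case (Cons i ws)
  then obtain k' where "k = Suc k'" "length ws \<le> k'" by (cases k) auto
  then have "l2conv k' A (\<lambda>m. partial_deriv i (f m))" "length ws \<le> k'"
    using Cons.prems by auto
  from Cons.IH[OF this] show ?case by simp
qed

context bounded_open_set
begin

text \<open>The defining identity of weak derivatives passes to limits in the mean on both sides. The limits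
  of the classical derivatives are therefore weak derivatives of \<open>u\<close>, and the norm of
  the difference is computed from them.\<close>

theorem l2conv_imp_sobolev_norm_tendsto:
  assumes u: "u \<in> L2 \<Omega>" and f: "\<And>m. smooth (f m)"
    and fu: "(\<lambda>m. \<integral>x. (f m x - u x)\<^sup>2 \<partial>lebesgue_on \<Omega>) \<longlonglongrightarrow> 0" and c: "l2conv k \<Omega> f"
  shows "(\<lambda>m. sobolev_norm k \<Omega> (\<lambda>x. f m x - u x)) \<longlonglongrightarrow> 0"
proof -
  let ?D = "\<lambda>\<alpha> m. fold partial_deriv (rev (word \<alpha>)) (f m)"
  define P where "P \<alpha> F \<longleftrightarrow> F \<in> L2 \<Omega> \<and> (\<lambda>m. \<integral>x. (?D \<alpha> m x - F x)\<^sup>2 \<partial>lebesgue_on \<Omega>) \<longlonglongrightarrow> 0" for \<alpha> F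
  define G where "G \<alpha> = (SOME F. P \<alpha> F)" for \<alpha>
  have "P \<alpha> (G \<alpha>)" if "sum \<alpha> UNIV \<le> k" for \<alpha>
  proof -
    have "\<exists>F. P \<alpha> F"
      using l2conv_fold[OF c, of "rev (word \<alpha>)"] that by (auto simp: length_word P_def)
    then show ?thesis unfolding G_def by (rule someI_ex)
  qed
  then have G: "\<And>\<alpha>. sum \<alpha> UNIV \<le> k \<Longrightarrow> G \<alpha> \<in> L2 \<Omega>"
    "\<And>\<alpha>. sum \<alpha> UNIV \<le> k \<Longrightarrow> (\<lambda>m. \<integral>x. (?D \<alpha> m x - G \<alpha> x)\<^sup>2 \<partial>lebesgue_on \<Omega>) \<longlonglongrightarrow> 0"
    unfolding P_def by blast+
  have DL: "?D \<alpha> m \<in> L2 \<Omega>" for \<alpha> m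
    by (intro smooth_in_L2 smooth_fold_partial f)
  have wd: "is_weak_deriv \<Omega> \<alpha> u (G \<alpha>)" if \<alpha>: "sum \<alpha> UNIV \<le> k" for \<alpha>
    unfolding is_weak_deriv_def
  proof (intro allI impI)
    fix \<phi> assume \<phi>: "test_function \<Omega> \<phi>"
    have l1: "(\<lambda>m. \<integral>x. f m x * multi_deriv \<alpha> \<phi> x \<partial>lebesgue_on \<Omega>) \<longlonglongrightarrow> (\<integral>x. u x * multi_deriv \<alpha> \<phi> x \<partial>lebesgue_on \<Omega>)"
      using smooth_in_L2[OF f] u multi_deriv_test_in_L2[OF \<phi>] fu
      unfolding L2_eq_sq_int by (intro sq_int_tendsto_integral)
    have l2: "(\<lambda>m. (-1) ^ sum \<alpha> UNIV * (\<integral>x. ?D \<alpha> m x * \<phi> x \<partial>lebesgue_on \<Omega>))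
       \<longlonglongrightarrow> (-1) ^ sum \<alpha> UNIV * (\<integral>x. G \<alpha> x * \<phi> x \<partial>lebesgue_on \<Omega>)"
      using DL G(1)[OF \<alpha>] test_function_in_L2[OF \<phi>] G(2)[OF \<alpha>]
      unfolding L2_eq_sq_int by (intro tendsto_mult tendsto_const sq_int_tendsto_integral)
    have eq: "(\<integral>x. f m x * multi_deriv \<alpha> \<phi> x \<partial>lebesgue_on \<Omega>)
       = (-1) ^ sum \<alpha> UNIV * (\<integral>x. ?D \<alpha> m x * \<phi> x \<partial>lebesgue_on \<Omega>)" for m
      using smooth_is_weak_deriv[OF f] \<phi> by (simp add: is_weak_deriv_def)
    show "(\<integral>x. u x * multi_deriv \<alpha> \<phi> x \<partial>lebesgue_on \<Omega>)
       = (-1) ^ sum \<alpha> UNIV * (\<integral>x. G \<alpha> x * \<phi> x \<partial>lebesgue_on \<Omega>)"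
      using l1 unfolding eq by (rule LIMSEQ_unique[OF _ l2])
  qed
  have us: "u \<in> sobolev k \<Omega>"
    unfolding sobolev_def using u wd G(1) by blast
  have dw: "is_weak_deriv \<Omega> \<alpha> (\<lambda>x. f m x - u x) (\<lambda>x. ?D \<alpha> m x - G \<alpha> x)" if "sum \<alpha> UNIV \<le> k" for \<alpha> m
    using is_weak_deriv_add[OF smooth_is_weak_deriv[OF f] is_weak_deriv_cmult[OF wd[OF that], of "-1"] smooth_in_L2[OF f]
      L2_cmult[OF u] DL L2_cmult[OF G(1)[OF that]], of m] by simp
  have ds: "(\<lambda>x. f m x - u x) \<in> sobolev k \<Omega>" for m
    using sobolev_add[OF smooth_in_sobolev[OF f] sobolev_cmult[OF us, of "-1"], of m] by simp
  have eq: "sobolev_norm k \<Omega> (\<lambda>x. f m x - u x) =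
    sqrt (\<Sum>\<alpha> | sum \<alpha> UNIV \<le> k. \<integral>x. (?D \<alpha> m x - G \<alpha> x)\<^sup>2 \<partial>lebesgue_on \<Omega>)" for m
  proof -
    have "sobolev_norm k \<Omega> (\<lambda>x. f m x - u x) =
      L2_set (\<lambda>\<alpha>. sqrt (\<integral>x. (?D \<alpha> m x - G \<alpha> x)\<^sup>2 \<partial>lebesgue_on \<Omega>)) {\<alpha>. sum \<alpha> UNIV \<le> k}"
      by (rule sobolev_norm_eq[OF ds]) (intro conjI L2_diff DL G(1) dw)
    then show ?thesis by (simp add: L2_set_def)
  qed
  have "(\<lambda>m. sqrt (\<Sum>\<alpha> | sum \<alpha> UNIV \<le> k. \<integral>x. (?D \<alpha> m x - G \<alpha> x)\<^sup>2 \<partial>lebesgue_on \<Omega>)) \<longlonglongrightarrow>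
    sqrt (\<Sum>\<alpha> | sum (\<alpha> :: 'n \<Rightarrow> nat) UNIV \<le> k. 0)"
    by (intro tendsto_real_sqrt tendsto_sum G(2)) simp
  then show ?thesis unfolding eq by simp
qed

end


section \<open>Convolutions\<close>

lemma frechet_eq_partials:
  fixes q :: "real^'n \<Rightarrow> real"
  assumes "smooth q"
  shows "frechet_derivative q (at w) h = (\<Sum>i\<in>UNIV. h $ i * partial_deriv i q w)"
proof -
  have l: "linear (frechet_derivative q (at w))"
    using smooth_has_derivative[OF assms] has_derivative_linear by blast
  have "frechet_derivative q (at w) h = frechet_derivative q (at w) (\<Sum>i\<in>UNIV. h $ i *\<^sub>R axis i 1)"
    using basis_expansion[of h] by (simp add: scalar_mult_eq_scaleR)
  also have "\<dots> = (\<Sum>i\<in>UNIV. h $ i * partial_deriv i q w)"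
    by (simp add: linear_sum[OF l] linear_cmul[OF l] partial_deriv_def)
  finally show ?thesis .
qed

text \<open>The partial derivatives are uniformly continuous on compact sets. The uniformity allows the
  expansion under an integral.\<close>

lemma smooth_uniform_taylor:
  fixes q :: "real^'n \<Rightarrow> real"
  assumes q: "smooth q" and K: "bounded K" and \<epsilon>: "0 < \<epsilon>"
  shows "\<exists>\<delta>>0. \<forall>z\<in>K. \<forall>h. norm h < \<delta> \<longrightarrow>
     \<bar>q (z + h) - q z - (\<Sum>i\<in>UNIV. h $ i * partial_deriv i q z)\<bar> \<le> \<epsilon> * norm h"
proof -
  obtain R where R: "\<And>z. z \<in> K \<Longrightarrow> norm z \<le> R" using K by (auto simp: bounded_iff)
  define n where "n = real CARD('n)"
  have n: "0 < n" by (simp add: n_def)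
  define Q where "Q i \<delta> \<longleftrightarrow> 0 < \<delta> \<and> (\<forall>z\<in>cball 0 (R + 1). \<forall>w\<in>cball 0 (R + 1). dist w z < \<delta> \<longrightarrow>
    \<bar>partial_deriv i q w - partial_deriv i q z\<bar> < \<epsilon> / n)" for i \<delta>
  have "\<exists>\<delta>. Q i \<delta>" for i
  proof -
    have "uniformly_continuous_on (cball 0 (R + 1)) (partial_deriv i q)"
      by (intro compact_uniformly_continuous smooth_continuous smooth_partial q compact_cball)
    moreover have "0 < \<epsilon> / n" using \<epsilon> n by simp
    ultimately obtain \<delta> where "0 < \<delta>" "\<And>z w. z \<in> cball 0 (R + 1) \<Longrightarrow> w \<in> cball 0 (R + 1) \<Longrightarrow> dist w z < \<delta> \<Longrightarrow>
        dist (partial_deriv i q w) (partial_deriv i q z) < \<epsilon> / n"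
      by (rule uniformly_continuous_onE) blast
    then show ?thesis unfolding Q_def dist_real_def by blast
  qed
  then obtain \<delta> where Q: "\<And>i. Q i (\<delta> i)"
    by metis
  then have \<delta>: "\<And>i. 0 < \<delta> i" "\<And>i z w. z \<in> cball 0 (R + 1) \<Longrightarrow> w \<in> cball 0 (R + 1) \<Longrightarrow> dist w z < \<delta> i \<Longrightarrow>
      \<bar>partial_deriv i q w - partial_deriv i q z\<bar> < \<epsilon> / n"
    unfolding Q_def by blast+
  define d where "d = min 1 (Min (range \<delta>))"
  have d: "0 < d" "d \<le> 1" "\<And>i. d \<le> \<delta> i"
    using \<delta>(1) by (auto simp: d_def min.coboundedI2)
  show ?thesis
  proof (intro exI[of _ d] conjI ballI allI impI d(1))
    fix z h :: "real^'n" assume z: "z \<in> K" and h: "norm h < d"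
    have "((\<lambda>t. q (z + t *\<^sub>R h)) has_real_derivative (\<Sum>i\<in>UNIV. h $ i * partial_deriv i q (z + t *\<^sub>R h))) (at t)" for t
    proof -
      have "((\<lambda>t. z + t *\<^sub>R h) has_derivative (\<lambda>s. s *\<^sub>R h)) (at t)"
        by (auto intro!: derivative_eq_intros)
      from has_derivative_compose[OF this smooth_has_derivative[OF q]]
      have "((\<lambda>t. q (z + t *\<^sub>R h)) has_derivative (\<lambda>s. frechet_derivative q (at (z + t *\<^sub>R h)) (s *\<^sub>R h))) (at t)" .
      moreover have "(\<lambda>s. frechet_derivative q (at (z + t *\<^sub>R h)) (s *\<^sub>R h)) = (*) (\<Sum>i\<in>UNIV. h $ i * partial_deriv i q (z + t *\<^sub>R h))"
        by (simp add: fun_eq_iff frechet_eq_partials[OF q] sum_distrib_left mult_ac)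
      ultimately show ?thesis by (simp add: has_field_derivative_def)
    qed
    from MVT2[of 0 1, OF _ this] obtain t where t: "0 < t" "t < 1"
      "q (z + h) - q z = (\<Sum>i\<in>UNIV. h $ i * partial_deriv i q (z + t *\<^sub>R h))"
      by auto
    have "\<bar>h $ i * (partial_deriv i q (z + t *\<^sub>R h) - partial_deriv i q z)\<bar> \<le> norm h * (\<epsilon> / n)" for i
    proof -
      have th: "norm (t *\<^sub>R h) \<le> norm h" using t by (simp add: mult_left_le_one_le)
      have "norm (z + t *\<^sub>R h) \<le> R + 1"
        using norm_triangle_ineq[of z "t *\<^sub>R h"] th h d(2) R[OF z] by linarith
      moreover have "norm z \<le> R + 1" using R[OF z] by linarith
      moreover have "dist (z + t *\<^sub>R h) z < \<delta> i"
        using th h d(3)[of i] by (simp add: dist_norm)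
      ultimately have "\<bar>partial_deriv i q (z + t *\<^sub>R h) - partial_deriv i q z\<bar> < \<epsilon> / n"
        using \<delta>(2) by simp
      then show ?thesis
        unfolding abs_mult using component_le_norm_cart[of h i] by (intro mult_mono) auto
    qed
    then have "(\<Sum>i\<in>UNIV. \<bar>h $ i * (partial_deriv i q (z + t *\<^sub>R h) - partial_deriv i q z)\<bar>) \<le> (\<Sum>i\<in>(UNIV::'n set). norm h * (\<epsilon> / n))"
      by (intro sum_mono)
    also have "\<dots> = \<epsilon> * norm h" using n by (simp add: n_def)
    finally have "\<bar>\<Sum>i\<in>UNIV. h $ i * (partial_deriv i q (z + t *\<^sub>R h) - partial_deriv i q z)\<bar> \<le> \<epsilon> * norm h"
      using sum_abs[of "\<lambda>i. h $ i * (partial_deriv i q (z + t *\<^sub>R h) - partial_deriv i q z)" UNIV] by linarith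
    then show "\<bar>q (z + h) - q z - (\<Sum>i\<in>UNIV. h $ i * partial_deriv i q z)\<bar> \<le> \<epsilon> * norm h"
      unfolding t(3) by (simp add: right_diff_distrib sum_subtractf)
  qed
qed

context bounded_open_set
begin

lemma L2_integrable: "u \<in> L2 \<Omega> \<Longrightarrow> integrable (lebesgue_on \<Omega>) u"
  using L2_mult_integrable[OF _ smooth_in_L2[OF smooth_const[of 1]]] by simp

lemma convolve_integrable:
  assumes "u \<in> L2 \<Omega>" "continuous_on UNIV q"
  shows "integrable (lebesgue_on \<Omega>) (\<lambda>y. u y * q (x - y))"
  by (intro L2_mult_integrable assms(1) continuous_in_L2 continuous_on_compose2[OF assms(2)] continuous_intros) auto

text \<open>Only \<open>q\<close> depends on the variable of differentiation, so the uniform Taylor expansion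
  of \<open>q\<close> is integrated against \<open>u\<close>.\<close>

lemma convolve_has_derivative:
  assumes u: "u \<in> L2 \<Omega>" and q: "smooth q"
  shows "(convolve \<Omega> u q has_derivative (\<lambda>h. \<Sum>i\<in>UNIV. h $ i * convolve \<Omega> u (partial_deriv i q) x)) (at x)"
  unfolding has_derivative_at_alt
proof (intro conjI allI impI)
  show "bounded_linear (\<lambda>h. \<Sum>i\<in>UNIV. h $ i * convolve \<Omega> u (partial_deriv i q) x)"
    by (intro bounded_linear_sum bounded_linear_mult_const bounded_linear_vec_nth)
  fix e :: real assume e: "0 < e"
  define I where "I = (\<integral>y. \<bar>u y\<bar> \<partial>lebesgue_on \<Omega>)"
  have I: "0 \<le> I" by (simp add: I_def)
  have "bounded ((\<lambda>y. x - y) ` \<Omega>)"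
  proof -
    obtain R where "\<And>y. y \<in> \<Omega> \<Longrightarrow> norm y \<le> R" using bounded_\<Omega> by (auto simp: bounded_iff)
    then have "norm (x - y) \<le> norm x + R" if "y \<in> \<Omega>" for y
      using norm_triangle_ineq4[of x y] that by force
    then show ?thesis by (auto simp: bounded_iff)
  qed
  then obtain d where d: "0 < d" "\<And>y h. y \<in> \<Omega> \<Longrightarrow> norm h < d \<Longrightarrow>
     \<bar>q (x - y + h) - q (x - y) - (\<Sum>i\<in>UNIV. h $ i * partial_deriv i q (x - y))\<bar> \<le> e / (I + 1) * norm h"
    using smooth_uniform_taylor[OF q, of "(\<lambda>y. x - y) ` \<Omega>" "e / (I + 1)"] e I by auto
  show "\<exists>d>0. \<forall>y. norm (y - x) < d \<longrightarrow> norm (convolve \<Omega> u q y - convolve \<Omega> u q x -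
       (\<Sum>i\<in>UNIV. (y - x) $ i * convolve \<Omega> u (partial_deriv i q) x)) \<le> e * norm (y - x)"
  proof (intro exI[of _ d] conjI allI impI d(1))
    fix x' assume x': "norm (x' - x) < d"
    define h where "h = x' - x"
    have h: "norm h < d" "x' = x + h" using x' by (auto simp: h_def)
    let ?r = "\<lambda>y. q (x - y + h) - q (x - y) - (\<Sum>i\<in>UNIV. h $ i * partial_deriv i q (x - y))"
    note int = convolve_integrable[OF u smooth_continuous[OF q]] convolve_integrable[OF u smooth_continuous[OF smooth_partial[OF q]]]
    have eq: "u y * ?r y = u y * q (x + h - y) - u y * q (x - y) - (\<Sum>i\<in>UNIV. h $ i * (u y * partial_deriv i q (x - y)))" for y
      by (simp add: right_diff_distrib sum_distrib_left mult_ac add_diff_eq diff_add_eq)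
    have ir: "integrable (lebesgue_on \<Omega>) (\<lambda>y. u y * ?r y)"
      unfolding eq by (intro Bochner_Integration.integrable_diff Bochner_Integration.integrable_sum integrable_mult_right int)
    have diff: "convolve \<Omega> u q x' - convolve \<Omega> u q x - (\<Sum>i\<in>UNIV. h $ i * convolve \<Omega> u (partial_deriv i q) x)
       = (\<integral>y. u y * ?r y \<partial>lebesgue_on \<Omega>)"
      unfolding eq h(2) convolve_def by (simp add: int)
    have "\<bar>\<integral>y. u y * ?r y \<partial>lebesgue_on \<Omega>\<bar> \<le> (\<integral>y. \<bar>u y\<bar> * (e / (I + 1) * norm h) \<partial>lebesgue_on \<Omega>)"
    proof (rule order_trans[OF integral_abs_bound], rule integral_mono)
      show "\<bar>u y * ?r y\<bar> \<le> \<bar>u y\<bar> * (e / (I + 1) * norm h)" if "y \<in> space (lebesgue_on \<Omega>)" for y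
        unfolding abs_mult using d(2)[OF _ h(1), of y] that by (intro mult_left_mono) auto
    qed (use ir L2_integrable[OF u] in auto)
    also have "(\<integral>y. \<bar>u y\<bar> * (e / (I + 1) * norm h) \<partial>lebesgue_on \<Omega>) = I * (e / (I + 1) * norm h)"
      unfolding I_def by (rule integral_mult_left_zero)
    also have "I * (e / (I + 1) * norm h) \<le> e * norm h"
    proof -
      have "I / (I + 1) * (e * norm h) \<le> 1 * (e * norm h)"
        using I e by (intro mult_right_mono) auto
      then show ?thesis by (simp add: mult_ac)
    qed
    finally show "norm (convolve \<Omega> u q x' - convolve \<Omega> u q x -
       (\<Sum>i\<in>UNIV. (x' - x) $ i * convolve \<Omega> u (partial_deriv i q) x)) \<le> e * norm (x' - x)"
      unfolding h_def[symmetric] diff real_norm_def .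
  qed
qed

lemma partial_deriv_convolve:
  assumes "u \<in> L2 \<Omega>" "smooth q"
  shows "partial_deriv i (convolve \<Omega> u q) = convolve \<Omega> u (partial_deriv i q)"
proof
  fix x
  have "partial_deriv i (convolve \<Omega> u q) x = (\<Sum>l\<in>UNIV. axis i 1 $ l * convolve \<Omega> u (partial_deriv l q) x)"
    by (rule partial_deriv_eq[OF convolve_has_derivative[OF assms]])
  also have "\<dots> = (\<Sum>l\<in>UNIV. if l = i then convolve \<Omega> u (partial_deriv l q) x else 0)"
    by (intro sum.cong) (auto simp: axis_def)
  finally show "partial_deriv i (convolve \<Omega> u q) x = convolve \<Omega> u (partial_deriv i q) x" by simp
qed

lemma smooth_convolve:
  assumes "u \<in> L2 \<Omega>" "smooth q"
  shows "smooth (convolve \<Omega> u q)"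
proof (rule smooth_coinduct[of "convolve \<Omega> u ` {q. smooth q}"])
  show "(\<forall>x. f differentiable at x) \<and> (\<forall>i. partial_deriv i f \<in> convolve \<Omega> u ` {q. smooth q})"
    if "f \<in> convolve \<Omega> u ` {q. smooth q}" for f
    using that assms(1)
    by (auto simp: partial_deriv_convolve smooth_partial intro: differentiableI convolve_has_derivative)
qed (use assms in auto)

section \<open>Cutting off and gluing\<close>

lemma L2_restrict:
  assumes A: "open A" "A \<subseteq> \<Omega>" and w: "w \<in> L2 \<Omega>"
  shows "w \<in> L2 A"
proof -
  have "w \<in> borel_measurable (lebesgue_on \<Omega>)" "integrable (lebesgue_on \<Omega>) (\<lambda>x. (w x)\<^sup>2)"
    using w by (auto simp: L2_def)
  then have "integrable lebesgue (\<lambda>x. indicator \<Omega> x *\<^sub>R (w x)\<^sup>2)"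
    using integrable_restrict_space[of \<Omega> lebesgue "\<lambda>x. (w x)\<^sup>2"] open_\<Omega> by simp
  then have "integrable lebesgue (\<lambda>x. indicator A x *\<^sub>R (indicator \<Omega> x *\<^sub>R (w x)\<^sup>2))"
    using A(1) by (intro integrable_mult_indicator[of A]) simp_all
  moreover have "(\<lambda>x. indicator A x *\<^sub>R (indicator \<Omega> x *\<^sub>R (w x)\<^sup>2)) = (\<lambda>x. indicator A x *\<^sub>R (w x)\<^sup>2)"
    using A(2) by (auto simp: indicator_def fun_eq_iff)
  ultimately have "integrable (lebesgue_on A) (\<lambda>x. (w x)\<^sup>2)"
    using integrable_restrict_space[of A lebesgue "\<lambda>x. (w x)\<^sup>2"] A(1) by simp
  moreover have "w \<in> borel_measurable (lebesgue_on A)"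
    using \<open>w \<in> borel_measurable (lebesgue_on \<Omega>)\<close> A(2) by (rule measurable_restrict_mono)
  ultimately show ?thesis by (simp add: L2_def)
qed

lemma L2_extend:
  assumes A: "open A" "A \<subseteq> \<Omega>" and w: "w \<in> L2 A"
  shows "(\<lambda>x. indicator A x * w x) \<in> L2 \<Omega>"
proof -
  have m: "(\<lambda>x. indicator A x * w x) \<in> borel_measurable lebesgue"
    by (rule L2_extend_measurable[OF A(1) w])
  have "integrable (lebesgue_on A) (\<lambda>x. (w x)\<^sup>2)"
    using w by (auto simp: L2_def)
  then have "integrable lebesgue (\<lambda>x. indicator A x *\<^sub>R (w x)\<^sup>2)"
    using integrable_restrict_space[of A lebesgue "\<lambda>x. (w x)\<^sup>2"] A(1) by simp
  moreover have "(\<lambda>x. indicator \<Omega> x *\<^sub>R (indicator A x * w x)\<^sup>2) = (\<lambda>x. indicator A x *\<^sub>R (w x)\<^sup>2)"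
    using A(2) by (auto simp: indicator_def fun_eq_iff)
  ultimately have "integrable (lebesgue_on \<Omega>) (\<lambda>x. (indicator A x * w x)\<^sup>2)"
    using integrable_restrict_space[of \<Omega> lebesgue "\<lambda>x. (indicator A x * w x)\<^sup>2"] open_\<Omega> by simp
  with m show ?thesis
    by (simp add: L2_def measurable_restrict_space1)
qed

lemma integral_subset_eq:
  fixes h :: "real^'n \<Rightarrow> real"
  assumes A: "open A" "A \<subseteq> \<Omega>" and "\<And>x. x \<in> \<Omega> \<Longrightarrow> x \<notin> A \<Longrightarrow> h x = 0"
  shows "(\<integral>x. h x \<partial>lebesgue_on \<Omega>) = (\<integral>x. h x \<partial>lebesgue_on A)"
proof -
  have "(\<lambda>x. indicator \<Omega> x *\<^sub>R h x) = (\<lambda>x. indicator A x *\<^sub>R h x)"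
    using assms by (auto simp: indicator_def fun_eq_iff)
  then show ?thesis
    using integral_restrict_space[of \<Omega> lebesgue h] integral_restrict_space[of A lebesgue h] A(1) open_\<Omega> by simp
qed

lemma l2conv_add:
  assumes "\<And>m. smooth (f m)" "\<And>m. smooth (g m)" "l2conv k \<Omega> f" "l2conv k \<Omega> g"
  shows "l2conv k \<Omega> (\<lambda>m x. f m x + g m x)"
proof -
  have *: "\<exists>H\<in>L2 \<Omega>. (\<lambda>m. \<integral>x. (f m x + g m x - H x)\<^sup>2 \<partial>lebesgue_on \<Omega>) \<longlonglongrightarrow> 0"
    if f: "\<And>m. smooth (f m)" "\<exists>F\<in>L2 \<Omega>. (\<lambda>m. \<integral>x. (f m x - F x)\<^sup>2 \<partial>lebesgue_on \<Omega>) \<longlonglongrightarrow> 0"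
      and g: "\<And>m. smooth (g m)" "\<exists>F\<in>L2 \<Omega>. (\<lambda>m. \<integral>x. (g m x - F x)\<^sup>2 \<partial>lebesgue_on \<Omega>) \<longlonglongrightarrow> 0"
    for f g :: "nat \<Rightarrow> real^'n \<Rightarrow> real"
  proof -
    obtain F where F: "F \<in> L2 \<Omega>" "(\<lambda>m. \<integral>x. (f m x - F x)\<^sup>2 \<partial>lebesgue_on \<Omega>) \<longlonglongrightarrow> 0" using f by blast
    obtain G where G: "G \<in> L2 \<Omega>" "(\<lambda>m. \<integral>x. (g m x - G x)\<^sup>2 \<partial>lebesgue_on \<Omega>) \<longlonglongrightarrow> 0" using g by blast
    have "(\<lambda>m. \<integral>x. (f m x + g m x - (F x + G x))\<^sup>2 \<partial>lebesgue_on \<Omega>) \<longlonglongrightarrow> 0"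
    proof (rule tendsto_sandwich[OF _ _ tendsto_const])
      show "(\<lambda>m. 2 * (\<integral>x. (f m x - F x)\<^sup>2 \<partial>lebesgue_on \<Omega>) + 2 * (\<integral>x. (g m x - G x)\<^sup>2 \<partial>lebesgue_on \<Omega>)) \<longlonglongrightarrow> 0"
        using tendsto_add[OF tendsto_mult_right_zero[OF F(2), of 2] tendsto_mult_right_zero[OF G(2), of 2]] by simp
      have "(\<integral>x. (f m x + g m x - (F x + G x))\<^sup>2 \<partial>lebesgue_on \<Omega>) \<le>
         2 * (\<integral>x. (f m x - F x)\<^sup>2 \<partial>lebesgue_on \<Omega>) + 2 * (\<integral>x. (g m x - G x)\<^sup>2 \<partial>lebesgue_on \<Omega>)" for m
      proof -
        have fg: "f m \<in> L2 \<Omega>" "g m \<in> L2 \<Omega>" using f(1) g(1) by (auto intro: smooth_in_L2)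
        have "(\<integral>x. (f m x + g m x - (F x + G x))\<^sup>2 \<partial>lebesgue_on \<Omega>) \<le>
         2 * (\<integral>x. (f m x + g m x - (F x + g m x))\<^sup>2 \<partial>lebesgue_on \<Omega>) + 2 * (\<integral>x. (F x + g m x - (F x + G x))\<^sup>2 \<partial>lebesgue_on \<Omega>)"
          using L2_add[OF fg] L2_add[OF F(1) fg(2)] L2_add[OF F(1) G(1)] unfolding L2_eq_sq_int
          by (rule sq_int_dist_triangle)
        then show ?thesis by simp
      qed
      then show "\<forall>\<^sub>F m in sequentially. (\<integral>x. (f m x + g m x - (F x + G x))\<^sup>2 \<partial>lebesgue_on \<Omega>) \<le>
         2 * (\<integral>x. (f m x - F x)\<^sup>2 \<partial>lebesgue_on \<Omega>) + 2 * (\<integral>x. (g m x - G x)\<^sup>2 \<partial>lebesgue_on \<Omega>)"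
        by (rule always_eventually[OF allI])
    qed simp
    with L2_add[OF F(1) G(1)] show ?thesis
      by (intro bexI[of _ "\<lambda>x. F x + G x"])
  qed
  show ?thesis
    using assms
  proof (induction k arbitrary: f g)
    case 0
    then show ?case using *[of f g] by simp
  next
    case (Suc k)
    have "l2conv k \<Omega> (\<lambda>m x. partial_deriv i (f m) x + partial_deriv i (g m) x)" for i
      using Suc.prems by (intro Suc.IH smooth_partial) auto
    then show ?case
      using Suc.prems *[of f g] by (simp add: partial_deriv_add)
  qed
qed

text \<open>Outside \<open>A\<close> both functions vanish, and on \<open>A\<close> the cutoff is bounded.\<close>

lemma cutoff_tendsto:
  assumes A: "open A" "A \<subseteq> \<Omega>" and \<psi>: "smooth \<psi>" "\<And>x. x \<in> \<Omega> \<Longrightarrow> \<psi> x \<noteq> 0 \<Longrightarrow> x \<in> A"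
    and f: "\<And>m. smooth (f m)" and F: "F \<in> L2 A" "(\<lambda>m. \<integral>x. (f m x - F x)\<^sup>2 \<partial>lebesgue_on A) \<longlonglongrightarrow> 0"
    and G: "\<And>x. x \<in> A \<Longrightarrow> G x = F x"
  shows "(\<lambda>m. \<integral>x. (\<psi> x * f m x - \<psi> x * G x)\<^sup>2 \<partial>lebesgue_on \<Omega>) \<longlonglongrightarrow> 0"
proof -
  interpret A: bounded_open_set A
    using A bounded_\<Omega> by unfold_locales (auto intro: bounded_subset)
  obtain C where C: "\<And>x. x \<in> A \<Longrightarrow> \<bar>\<psi> x\<bar> \<le> C"
    using smooth_bounded_on[OF \<psi>(1) A.bounded_\<Omega>] by (auto simp: bounded_iff)
  show ?thesis
  proof (rule tendsto_sandwich[OF _ _ tendsto_const])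
    show "(\<lambda>m. C\<^sup>2 * (\<integral>x. (f m x - F x)\<^sup>2 \<partial>lebesgue_on A)) \<longlonglongrightarrow> 0"
      by (rule tendsto_mult_right_zero[OF F(2)])
    have "(\<integral>x. (\<psi> x * f m x - \<psi> x * G x)\<^sup>2 \<partial>lebesgue_on \<Omega>) \<le> C\<^sup>2 * (\<integral>x. (f m x - F x)\<^sup>2 \<partial>lebesgue_on A)" for m
    proof -
      have "(\<integral>x. (\<psi> x * f m x - \<psi> x * G x)\<^sup>2 \<partial>lebesgue_on \<Omega>) = (\<integral>x. (\<psi> x * f m x - \<psi> x * G x)\<^sup>2 \<partial>lebesgue_on A)"
        using \<psi>(2) by (intro integral_subset_eq A) auto
      also have "\<dots> = (\<integral>x. (\<psi> x * (f m x - F x))\<^sup>2 \<partial>lebesgue_on A)"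
        using G by (intro Bochner_Integration.integral_cong) (auto simp: right_diff_distrib)
      also have "\<dots> \<le> C\<^sup>2 * (\<integral>x. (f m x - F x)\<^sup>2 \<partial>lebesgue_on A)"
        using A.L2_diff[OF A.smooth_in_L2[OF f] F(1), of m] C A.smooth_in_L2[OF \<psi>(1)]
        unfolding L2_eq_sq_int by (intro sq_int_bounded_mult(2) sq_int_measurable) auto
      finally show ?thesis .
    qed
    then show "\<forall>\<^sub>F m in sequentially. (\<integral>x. (\<psi> x * f m x - \<psi> x * G x)\<^sup>2 \<partial>lebesgue_on \<Omega>) \<le> C\<^sup>2 * (\<integral>x. (f m x - F x)\<^sup>2 \<partial>lebesgue_on A)"
      by (rule always_eventually[OF allI])
  qed simp
qed

text \<open>The derivative of \<open>\<psi> f\<close> is a sum of two products of the same kind, since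
  derivatives of \<open>\<psi>\<close> are supported in the closed set \<open>S\<close> as well;
  hence the induction on \<open>k\<close>.\<close>

lemma l2conv_cutoff:
  assumes A: "open A" "A \<subseteq> \<Omega>" and S: "closed S" "S \<inter> \<Omega> \<subseteq> A"
    and "smooth \<psi>" "\<And>x. \<psi> x \<noteq> 0 \<Longrightarrow> x \<in> S" "\<And>m. smooth (f m)" "l2conv k A f"
  shows "l2conv k \<Omega> (\<lambda>m x. \<psi> x * f m x)"
proof -
  interpret A: bounded_open_set A
    using A bounded_\<Omega> by unfold_locales (auto intro: bounded_subset)
  have *: "\<exists>H\<in>L2 \<Omega>. (\<lambda>m. \<integral>x. (\<psi> x * f m x - H x)\<^sup>2 \<partial>lebesgue_on \<Omega>) \<longlonglongrightarrow> 0"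
    if \<psi>: "smooth \<psi>" "\<And>x. \<psi> x \<noteq> 0 \<Longrightarrow> x \<in> S" and f: "\<And>m. smooth (f m)"
      "\<exists>F\<in>L2 A. (\<lambda>m. \<integral>x. (f m x - F x)\<^sup>2 \<partial>lebesgue_on A) \<longlonglongrightarrow> 0"
    for \<psi> and f :: "nat \<Rightarrow> real^'n \<Rightarrow> real"
  proof -
    obtain F where F: "F \<in> L2 A" "(\<lambda>m. \<integral>x. (f m x - F x)\<^sup>2 \<partial>lebesgue_on A) \<longlonglongrightarrow> 0" using f by blast
    have "\<And>x. x \<in> \<Omega> \<Longrightarrow> \<psi> x \<noteq> 0 \<Longrightarrow> x \<in> A" using \<psi>(2) S(2) by blast
    from cutoff_tendsto[OF A \<psi>(1) this f(1) F, of "\<lambda>x. indicator A x * F x"]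
    have "(\<lambda>m. \<integral>x. (\<psi> x * f m x - \<psi> x * (indicator A x * F x))\<^sup>2 \<partial>lebesgue_on \<Omega>) \<longlonglongrightarrow> 0" by simp
    moreover obtain C where "\<And>x. x \<in> \<Omega> \<Longrightarrow> \<bar>\<psi> x\<bar> \<le> C"
      using smooth_bounded_on[OF \<psi>(1) bounded_\<Omega>] by (auto simp: bounded_iff)
    then have "(\<lambda>x. \<psi> x * (indicator A x * F x)) \<in> L2 \<Omega>"
      using sq_int_bounded_mult(1)[OF L2_extend[OF A F(1), unfolded L2_eq_sq_int]
          sq_int_measurable[OF smooth_in_L2[OF \<psi>(1), unfolded L2_eq_sq_int]], of C]
      unfolding L2_eq_sq_int by simp
    ultimately show ?thesis
      by (intro bexI[of _ "\<lambda>x. \<psi> x * (indicator A x * F x)"])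
  qed
  show ?thesis
    using assms(5-)
  proof (induction k arbitrary: \<psi> f)
    case 0
    then show ?case using *[of \<psi> f] by simp
  next
    case (Suc k)
    have "x \<in> S" if "partial_deriv i \<psi> x \<noteq> 0" for i x
      using partial_deriv_outside_support[OF Suc.prems(1) S(1) Suc.prems(2)] that by blast
    then have 1: "l2conv k \<Omega> (\<lambda>m x. partial_deriv i \<psi> x * f m x)" for i
      using Suc.prems by (intro Suc.IH smooth_partial l2conv_SucD[OF Suc.prems(4)])
    have 2: "l2conv k \<Omega> (\<lambda>m x. \<psi> x * partial_deriv i (f m) x)" for i
      using Suc.prems by (intro Suc.IH smooth_partial) auto
    have "l2conv k \<Omega> (\<lambda>m. partial_deriv i (\<lambda>x. \<psi> x * f m x))" for i
      unfolding partial_deriv_mult[OF Suc.prems(1,3)]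
      by (rule l2conv_add[OF _ _ 1 2]) (intro smooth_mult smooth_partial Suc.prems)+
    then show ?case
      using *[OF Suc.prems(1-3) l2conv_limit[OF Suc.prems(4)]] by simp
  qed
qed

end


section \<open>Density of smooth functions\<close>

text \<open>Near \<open>x\<close>, every point of \<open>\<Omega>\<close> is the vertex of a truncated open cone contained in \<open>\<Omega>\<close>, and
  all these cones are translates of a single one.\<close>

definition uniform_cone :: "(real^'n) set \<Rightarrow> real^'n \<Rightarrow> real \<Rightarrow> bool" where
  "uniform_cone \<Omega> x r \<longleftrightarrow> (\<exists>e \<kappa> \<delta>\<^sub>0. 0 < \<kappa> \<and> 0 < \<delta>\<^sub>0 \<and>
     (\<forall>y\<in>\<Omega> \<inter> ball x r. \<forall>\<delta>. 0 < \<delta> \<and> \<delta> < \<delta>\<^sub>0 \<longrightarrow> cball (y + \<delta> *\<^sub>R e) (\<kappa> * \<delta>) \<subseteq> \<Omega>))"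

text \<open>For an interior point the cones degenerate to small balls, with axis \<open>0\<close>. At a
  boundary point the axis is the vertical direction of the chart: going up by
  \<open>\<delta>\<close> gains more height than the Lipschitz graph can rise over a horizontal
  displacement of order \<open>\<kappa> \<delta>\<close>.\<close>

lemma lipschitz_uniform_cone:
  assumes \<Omega>: "bounded_lipschitz_domain \<Omega>" and x: "x \<in> closure \<Omega>"
  shows "\<exists>r>0. uniform_cone \<Omega> x r"
proof (cases "x \<in> \<Omega>")
  case True
  then obtain R where R: "0 < R" "ball x R \<subseteq> \<Omega>"
    using \<Omega> open_contains_ball unfolding bounded_lipschitz_domain_def by blast
  have "cball (y + \<delta> *\<^sub>R 0) (1 * \<delta>) \<subseteq> \<Omega>" if "y \<in> \<Omega> \<inter> ball x (R / 2)" "0 < \<delta> \<and> \<delta> < R / 2" for y \<delta>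
  proof
    fix z assume "z \<in> cball (y + \<delta> *\<^sub>R 0) (1 * \<delta>)"
    then have "dist x z < R"
      using that dist_triangle[of x z y] by simp
    with R(2) show "z \<in> \<Omega>" by auto
  qed
  then have "uniform_cone \<Omega> x (R / 2)"
    unfolding uniform_cone_def using R(1) by (intro exI[of _ 0] exI[of _ 1] exI[of _ "R / 2"]) auto
  then show ?thesis using R(1) half_gt_zero by blast
next
  case False
  have "open \<Omega>" using \<Omega> by (simp add: bounded_lipschitz_domain_def)
  with False x have "x \<in> frontier \<Omega>" by (simp add: frontier_def interior_open)
  then obtain r e L g where r: "0 < r" and e: "norm e = 1"
    and L: "L-lipschitz_on {z. z \<bullet> e = 0} (g :: real^'a \<Rightarrow> real)"
    and g: "\<Omega> \<inter> ball x r = {y \<in> ball x r. g (y - (y \<bullet> e) *\<^sub>R e) < y \<bullet> e}"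
    using \<Omega> unfolding bounded_lipschitz_domain_def lipschitz_boundary_def by blast
  have L0: "0 \<le> L" using L by (rule lipschitz_on_nonneg)
  \<comment> \<open>The opening \<open>\<kappa>\<close> balances the loss \<open>\<kappa> \<delta>\<close> of height against the rise \<open>2 L \<kappa> \<delta>\<close> of the graph.\<close>
  define \<kappa> where "\<kappa> = 1 / (1 + 2 * L)"
  have \<kappa>: "0 < \<kappa>" "\<kappa> \<le> 1" "2 * L * \<kappa> = 1 - \<kappa>"
    using L0 by (auto simp: \<kappa>_def field_simps)
  have ee: "e \<bullet> e = 1" using e by (simp add: norm_eq_1)
  have "cball (y + \<delta> *\<^sub>R e) (\<kappa> * \<delta>) \<subseteq> \<Omega>" if y: "y \<in> \<Omega> \<inter> ball x (r / 2)" and \<delta>: "0 < \<delta> \<and> \<delta> < r / 4" for y \<delta>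
  proof
    fix z assume z: "z \<in> cball (y + \<delta> *\<^sub>R e) (\<kappa> * \<delta>)"
    define d where "d = z - (y + \<delta> *\<^sub>R e)"
    have zd: "z = y + \<delta> *\<^sub>R e + d" by (simp add: d_def)
    have d: "norm d \<le> \<kappa> * \<delta>" using z by (simp add: d_def dist_norm norm_minus_commute)
    have \<kappa>\<delta>: "\<kappa> * \<delta> \<le> \<delta>" using \<kappa>(2) \<delta> by (simp add: mult_left_le_one_le)
    have "dist x z \<le> dist x y + dist y z" by (rule dist_triangle)
    also have "dist y z \<le> norm (\<delta> *\<^sub>R e) + norm d"
    proof -
      have "y - z = - (\<delta> *\<^sub>R e + d)" by (simp add: zd)
      then have "dist y z = norm (\<delta> *\<^sub>R e + d)"
        by (simp only: dist_norm norm_minus_cancel)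
      then show ?thesis by (simp only: norm_triangle_ineq)
    qed
    also have "norm (\<delta> *\<^sub>R e) + norm d \<le> \<delta> + \<delta>"
    proof -
      have "norm (\<delta> *\<^sub>R e) = \<delta>" using e \<delta> by simp
      then show ?thesis using d \<kappa>\<delta> by linarith
    qed
    finally have zb: "z \<in> ball x r" using y \<delta> by simp
    let ?p = "\<lambda>v. v - (v \<bullet> e) *\<^sub>R e"
    have de: "\<bar>d \<bullet> e\<bar> \<le> norm d" using Cauchy_Schwarz_ineq2[of d e] e by simp
    have pz: "?p z - ?p y = ?p d"
      by (simp add: zd inner_add_left ee algebra_simps)
    have "norm (?p d) \<le> norm d + norm ((d \<bullet> e) *\<^sub>R e)" by (rule norm_triangle_ineq4)
    also have "\<dots> \<le> 2 * norm d" using de e by simp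
    finally have pd: "norm (?p d) \<le> 2 * (\<kappa> * \<delta>)" using d by linarith
    have "dist (g (?p z)) (g (?p y)) \<le> L * dist (?p z) (?p y)"
      by (rule lipschitz_onD[OF L]) (simp_all add: inner_diff_left ee)
    also have "\<dots> \<le> L * (2 * (\<kappa> * \<delta>))"
      unfolding dist_norm pz using L0 pd by (intro mult_left_mono)
    also have "\<dots> = (2 * L * \<kappa>) * \<delta>" by simp
    also have "\<dots> = (1 - \<kappa>) * \<delta>" by (simp only: \<kappa>(3))
    finally have "g (?p z) \<le> g (?p y) + (1 - \<kappa>) * \<delta>" by (simp add: dist_real_def)
    also have "g (?p y) < y \<bullet> e"
    proof -
      have "y \<in> \<Omega> \<inter> ball x r" using y r by auto
      then show ?thesis unfolding g by blast
    qed
    also have "y \<bullet> e + (1 - \<kappa>) * \<delta> \<le> z \<bullet> e"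
    proof -
      have "z \<bullet> e = y \<bullet> e + \<delta> + d \<bullet> e" by (simp add: zd inner_add_left ee)
      moreover have "(1 - \<kappa>) * \<delta> = \<delta> - \<kappa> * \<delta>" by (simp add: left_diff_distrib)
      ultimately show ?thesis using de d by linarith
    qed
    finally have "g (?p z) < z \<bullet> e" by simp
    with zb have "z \<in> \<Omega> \<inter> ball x r" unfolding g by blast
    then show "z \<in> \<Omega>" by blast
  qed
  then have "uniform_cone \<Omega> x (r / 2)"
    unfolding uniform_cone_def using r \<kappa>(1) by (intro exI[of _ e] exI[of _ \<kappa>] exI[of _ "r / 4"]) auto
  then show ?thesis using r half_gt_zero by blast
qed

context bounded_open_set
begin

text \<open>Centre and radius of the supports both tend to \<open>0\<close>, so the mollifiers eventually meet
  the uniform threshold.\<close>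

lemma convolve_tendsto_L2:
  assumes w: "w \<in> L2 \<Omega>" and A: "open A" "A \<subseteq> \<Omega>"
    and b: "\<And>m. tensor_mollifier (a m) (r m) (b m)" and a: "a \<longlonglongrightarrow> 0" and r: "r \<longlonglongrightarrow> 0"
  shows "(\<lambda>m. \<integral>x. (convolve \<Omega> w (tensor (b m) (\<lambda>_. 0)) x - w x)\<^sup>2 \<partial>lebesgue_on A) \<longlonglongrightarrow> 0"
proof (rule tendstoI)
  fix \<epsilon> :: real assume "0 < \<epsilon>"
  interpret A: bounded_open_set A
    using A bounded_\<Omega> by unfold_locales (auto intro: bounded_subset)
  obtain d where d: "0 < d" "\<And>\<eta>. mollifier d \<eta> \<Longrightarrow>
       (\<integral>\<^sup>+x. ennreal ((convolve \<Omega> w \<eta> x - indicator \<Omega> x * w x)\<^sup>2) \<partial>lebesgue) \<le> ennreal (\<epsilon> / 2)"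
    using mollify_L2[OF open_\<Omega> bounded_\<Omega> w, of "\<epsilon> / 2"] \<open>0 < \<epsilon>\<close> by auto
  have "(\<lambda>m. norm (a m) + r m) \<longlonglongrightarrow> 0"
    using tendsto_add[OF tendsto_norm[OF a] r] by simp
  then have "\<forall>\<^sub>F m in sequentially. norm (a m) + r m < d"
    using d(1) by (rule order_tendstoD(2))
  then show "\<forall>\<^sub>F m in sequentially. dist (\<integral>x. (convolve \<Omega> w (tensor (b m) (\<lambda>_. 0)) x - w x)\<^sup>2 \<partial>lebesgue_on A) 0 < \<epsilon>"
  proof (rule eventually_mono)
    fix m assume m: "norm (a m) + r m < d"
    let ?\<eta> = "tensor (b m) (\<lambda>_. 0)"
    note bm = b[of m, unfolded tensor_mollifier_def]
    have sm: "smooth ?\<eta>" using bm by (intro smooth_tensor) simp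
    have "norm x < d" if "?\<eta> x \<noteq> 0" for x
    proof -
      have "norm (x - a m) \<le> r m" using bm that by blast
      with m show ?thesis using norm_triangle_ineq[of "a m" "x - a m"] by simp
    qed
    then have "mollifier d ?\<eta>"
      using bm smooth_continuous[OF sm] by (simp add: mollifier_def)
    from d(2)[OF this]
    have le: "(\<integral>\<^sup>+x. ennreal ((convolve \<Omega> w ?\<eta> x - indicator \<Omega> x * w x)\<^sup>2) \<partial>lebesgue) \<le> ennreal (\<epsilon> / 2)" .
    let ?h = "\<lambda>x. (convolve \<Omega> w ?\<eta> x - w x)\<^sup>2"
    have mh: "?h \<in> borel_measurable (lebesgue_on A)"
      using A.L2_diff[OF A.smooth_in_L2[OF smooth_convolve[OF w sm]] L2_restrict[OF A w]]
      by (simp add: L2_def borel_measurable_integrable)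
    have "(\<integral>\<^sup>+x. ennreal (?h x) \<partial>lebesgue_on A) = (\<integral>\<^sup>+x. ennreal (?h x) * indicator A x \<partial>lebesgue)"
      using A(1) by (intro nn_integral_restrict_space) simp
    also have "\<dots> \<le> (\<integral>\<^sup>+x. ennreal ((convolve \<Omega> w ?\<eta> x - indicator \<Omega> x * w x)\<^sup>2) \<partial>lebesgue)"
      using A(2) by (intro nn_integral_mono) (auto simp: indicator_def)
    also note le
    finally have "(\<integral>\<^sup>+x. ennreal (?h x) \<partial>lebesgue_on A) \<le> ennreal (\<epsilon> / 2)" .
    moreover have "(\<integral>x. ?h x \<partial>lebesgue_on A) = enn2real (\<integral>\<^sup>+x. ennreal (?h x) \<partial>lebesgue_on A)"
      by (rule integral_eq_nn_integral[OF mh]) simp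
    ultimately have "(\<integral>x. ?h x \<partial>lebesgue_on A) \<le> \<epsilon> / 2"
      using \<open>0 < \<epsilon>\<close> enn2real_mono[of _ "ennreal (\<epsilon> / 2)"] by fastforce
    moreover have "0 \<le> (\<integral>x. ?h x \<partial>lebesgue_on A)" by simp
    ultimately show "dist (\<integral>x. ?h x \<partial>lebesgue_on A) 0 < \<epsilon>"
      using \<open>0 < \<epsilon>\<close> by (simp add: dist_real_def)
  qed
qed

text \<open>On \<open>A\<close> every derivative of \<open>u * \<eta>\<close> is the mollification of a weak
  derivative of \<open>u\<close>, and these converge in the mean. Since derivatives of
  \<open>\<eta>\<close> are indexed by multi-indices, the induction may differentiate in any
  order.\<close>

lemma l2conv_convolve:
  assumes u: "u \<in> sobolev k \<Omega>" and A: "open A" "A \<subseteq> \<Omega>"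
    and b: "\<And>m. tensor_mollifier (a m) (r m) (b m)" and a: "a \<longlonglongrightarrow> 0" and r: "r \<longlonglongrightarrow> 0"
    and supp: "\<And>m x. x \<in> A \<Longrightarrow> \<exists>S. compact S \<and> S \<subseteq> \<Omega> \<and> (\<forall>y. tensor (b m) (\<lambda>_. 0) (x - y) \<noteq> 0 \<longrightarrow> y \<in> S)"
  shows "sum \<alpha> UNIV + j \<le> k \<Longrightarrow> l2conv j A (\<lambda>m. convolve \<Omega> u (tensor (b m) \<alpha>))"
proof (induction j arbitrary: \<alpha>)
  have chain: "\<forall>i. deriv_chain (b m i)" for m
    using b by (simp add: tensor_mollifier_def)
  have lim: "\<exists>F\<in>L2 A. (\<lambda>m. \<integral>x. (convolve \<Omega> u (tensor (b m) \<alpha>) x - F x)\<^sup>2 \<partial>lebesgue_on A) \<longlonglongrightarrow> 0"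
    if \<alpha>: "sum \<alpha> UNIV \<le> k" for \<alpha>
  proof (rule bexI)
    let ?w = "weak_deriv \<Omega> \<alpha> u"
    show "?w \<in> L2 A" by (rule L2_restrict[OF A weak_deriv_props(1)[OF u \<alpha>]])
    have "convolve \<Omega> u (tensor (b m) \<alpha>) x = convolve \<Omega> ?w (tensor (b m) (\<lambda>_. 0)) x" if x: "x \<in> A" for m x
    proof -
      obtain S where "compact S" "S \<subseteq> \<Omega>" "\<And>y. tensor (b m) (\<lambda>_. 0) (x - y) \<noteq> 0 \<Longrightarrow> y \<in> S"
        using supp[OF x] by blast
      then show ?thesis by (rule weak_deriv_convolve[OF chain weak_deriv_props(2)[OF u \<alpha>]])
    qed
    then have "(\<integral>x. (convolve \<Omega> u (tensor (b m) \<alpha>) x - ?w x)\<^sup>2 \<partial>lebesgue_on A)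
       = (\<integral>x. (convolve \<Omega> ?w (tensor (b m) (\<lambda>_. 0)) x - ?w x)\<^sup>2 \<partial>lebesgue_on A)" for m
      by (intro Bochner_Integration.integral_cong) auto
    then show "(\<lambda>m. \<integral>x. (convolve \<Omega> u (tensor (b m) \<alpha>) x - ?w x)\<^sup>2 \<partial>lebesgue_on A) \<longlonglongrightarrow> 0"
      using convolve_tendsto_L2[OF weak_deriv_props(1)[OF u \<alpha>] A b a r] by simp
  qed
  {
    case 0
    then show ?case using lim by simp
  next
    case (Suc j)
    have "l2conv j A (\<lambda>m. partial_deriv i (convolve \<Omega> u (tensor (b m) \<alpha>)))" for i
    proof -
      have "sum (\<alpha>(i := Suc (\<alpha> i))) UNIV = Suc (sum \<alpha> UNIV)"
        by (subst (1 2) sum.remove[of UNIV i]) auto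
      then have "l2conv j A (\<lambda>m. convolve \<Omega> u (tensor (b m) (\<alpha>(i := Suc (\<alpha> i)))))"
        using Suc.prems by (intro Suc.IH) simp
      then show ?thesis
        by (simp add: partial_deriv_convolve[OF sobolev_L2[OF u] smooth_tensor[OF chain]] partial_deriv_tensor[OF chain])
    qed
    with lim[of \<alpha>] Suc.prems show ?case by simp
  }
qed

text \<open>The mollifiers are supported in balls around \<open>- \<delta> e\<close> of radius \<open>\<kappa>
  \<delta>\<close>. The values of \<open>u\<close> that contribute to the convolution at
  \<open>y\<close> are then those in the cone with vertex \<open>y\<close>, which lies in the
  domain even when \<open>y\<close> is arbitrarily close to the boundary.\<close>

lemma local_mollification:
  assumes u: "u \<in> sobolev k \<Omega>" and cone: "uniform_cone \<Omega> x r"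
  shows "\<exists>b. (\<forall>m i. deriv_chain (b m i)) \<and>
     l2conv k (\<Omega> \<inter> ball x r) (\<lambda>m. convolve \<Omega> u (tensor (b m) (\<lambda>_. 0))) \<and>
     (\<lambda>m. \<integral>x. (convolve \<Omega> u (tensor (b m) (\<lambda>_. 0)) x - u x)\<^sup>2 \<partial>lebesgue_on (\<Omega> \<inter> ball x r)) \<longlonglongrightarrow> 0"
proof -
  obtain e \<kappa> \<delta>\<^sub>0 where c: "0 < \<kappa>" "0 < \<delta>\<^sub>0"
    "\<And>y \<delta>. y \<in> \<Omega> \<inter> ball x r \<Longrightarrow> 0 < \<delta> \<and> \<delta> < \<delta>\<^sub>0 \<Longrightarrow> cball (y + \<delta> *\<^sub>R e) (\<kappa> * \<delta>) \<subseteq> \<Omega>"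
    using cone unfolding uniform_cone_def by blast
  define \<delta> where "\<delta> m = \<delta>\<^sub>0 * (1 / real (Suc (Suc m)))" for m
  have \<delta>: "0 < \<delta> m" "\<delta> m < \<delta>\<^sub>0" for m
  proof -
    show "0 < \<delta> m" using c(2) by (simp add: \<delta>_def)
    have "\<delta>\<^sub>0 * (1 / real (Suc (Suc m))) < \<delta>\<^sub>0 * 1"
      using c(2) by (intro mult_strict_left_mono) simp_all
    then show "\<delta> m < \<delta>\<^sub>0" by (simp add: \<delta>_def)
  qed
  have \<delta>0: "\<delta> \<longlonglongrightarrow> 0"
    unfolding \<delta>_def by (intro tendsto_mult_right_zero LIMSEQ_Suc[OF LIMSEQ_Suc[OF lim_1_over_n]])
  have "\<exists>b. tensor_mollifier (- (\<delta> m *\<^sub>R e)) (\<kappa> * \<delta> m) b" for m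
    using c(1) \<delta>(1)[of m] by (intro tensor_mollifier_exists) simp
  then obtain b where b: "\<And>m. tensor_mollifier (- (\<delta> m *\<^sub>R e)) (\<kappa> * \<delta> m) (b m)"
    by metis
  have a0: "(\<lambda>m. - (\<delta> m *\<^sub>R e)) \<longlonglongrightarrow> 0"
    using tendsto_minus[OF tendsto_scaleR[OF \<delta>0 tendsto_const[of e]]] by simp
  have r0: "(\<lambda>m. \<kappa> * \<delta> m) \<longlonglongrightarrow> 0"
    using \<delta>0 by (rule tendsto_mult_right_zero)
  have A: "open (\<Omega> \<inter> ball x r)" "\<Omega> \<inter> ball x r \<subseteq> \<Omega>"
    using open_\<Omega> by auto
  have "l2conv k (\<Omega> \<inter> ball x r) (\<lambda>m. convolve \<Omega> u (tensor (b m) (\<lambda>_. 0)))"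
  proof (rule l2conv_convolve[OF u A b a0 r0])
    fix m y assume y: "y \<in> \<Omega> \<inter> ball x r"
    have "z \<in> cball (y + \<delta> m *\<^sub>R e) (\<kappa> * \<delta> m)" if "tensor (b m) (\<lambda>_. 0) (y - z) \<noteq> 0" for z
    proof -
      have "norm (y - z - (- (\<delta> m *\<^sub>R e))) \<le> \<kappa> * \<delta> m"
        using b[of m] that unfolding tensor_mollifier_def by blast
      moreover have "y + \<delta> m *\<^sub>R e - z = y - z - (- (\<delta> m *\<^sub>R e))" by simp
      ultimately show ?thesis by (simp only: mem_cball dist_norm)
    qed
    then show "\<exists>S. compact S \<and> S \<subseteq> \<Omega> \<and> (\<forall>z. tensor (b m) (\<lambda>_. 0) (y - z) \<noteq> 0 \<longrightarrow> z \<in> S)"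
      using c(3)[OF y] \<delta>[of m] by (intro exI[of _ "cball (y + \<delta> m *\<^sub>R e) (\<kappa> * \<delta> m)"]) auto
  qed simp
  moreover have "(\<lambda>m. \<integral>x. (convolve \<Omega> u (tensor (b m) (\<lambda>_. 0)) x - u x)\<^sup>2 \<partial>lebesgue_on (\<Omega> \<inter> ball x r)) \<longlonglongrightarrow> 0"
    by (rule convolve_tendsto_L2[OF sobolev_L2[OF u] A b a0 r0])
  ultimately show ?thesis
    using b unfolding tensor_mollifier_def by blast
qed

lemma l2conv_zero: "l2conv k \<Omega> (\<lambda>m x. 0)"
proof (induction k)
  case 0
  show ?case using smooth_in_L2[OF smooth_const[of 0]] by (auto intro!: bexI[of _ "\<lambda>x. 0"])
next
  case (Suc k)
  then show ?case
    using smooth_in_L2[OF smooth_const[of 0]] by (auto simp: partial_deriv_const intro!: bexI[of _ "\<lambda>x. 0"])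
qed

lemma smooth_mult_L2:
  assumes "smooth \<rho>" "u \<in> L2 \<Omega>"
  shows "(\<lambda>x. \<rho> x * u x) \<in> L2 \<Omega>"
proof -
  obtain C where C: "\<And>x. x \<in> \<Omega> \<Longrightarrow> \<bar>\<rho> x\<bar> \<le> C"
    using smooth_bounded_on[OF assms(1) bounded_\<Omega>] by (auto simp: bounded_iff)
  have "\<rho> \<in> borel_measurable (lebesgue_on \<Omega>)"
    using smooth_in_L2[OF assms(1)] by (simp add: L2_def)
  then show ?thesis
    using assms(2) C sq_int_bounded_mult(1)[of u "lebesgue_on \<Omega>" \<rho> C] unfolding L2_eq_sq_int by simp
qed

text \<open>One more ball is added to the region where the approximation has been achieved: with a cutoff
  \<open>\<psi>\<close> of the new ball, \<open>(1 - \<psi>) f + \<psi> g\<close> takes over the old approximation \<open>f\<close> outside and the new one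
  \<open>g\<close> inside the ball.\<close>

lemma glue_step:
  assumes u: "u \<in> sobolev k \<Omega>" and r: "0 < r" and \<psi>: "smooth \<psi>" "\<And>y. \<psi> y \<noteq> 0 \<Longrightarrow> y \<in> cball x (r / 2)"
    and f: "\<And>m. smooth (f m)" "l2conv k \<Omega> f" and \<rho>: "smooth \<rho>"
    and f\<rho>: "(\<lambda>m. \<integral>y. (f m y - \<rho> y * u y)\<^sup>2 \<partial>lebesgue_on \<Omega>) \<longlonglongrightarrow> 0"
    and g: "\<And>m. smooth (g m)" "l2conv k (\<Omega> \<inter> ball x r) g"
    and gu: "(\<lambda>m. \<integral>y. (g m y - u y)\<^sup>2 \<partial>lebesgue_on (\<Omega> \<inter> ball x r)) \<longlonglongrightarrow> 0"
  shows "l2conv k \<Omega> (\<lambda>m y. (1 - \<psi> y) * f m y + \<psi> y * g m y)"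
    and "(\<lambda>m. \<integral>y. ((1 - \<psi> y) * f m y + \<psi> y * g m y - ((1 - \<psi> y) * \<rho> y + \<psi> y) * u y)\<^sup>2 \<partial>lebesgue_on \<Omega>) \<longlonglongrightarrow> 0"
proof -
  have A: "open (\<Omega> \<inter> ball x r)" "\<Omega> \<inter> ball x r \<subseteq> \<Omega>" using open_\<Omega> by auto
  have sub: "cball x (r / 2) \<inter> \<Omega> \<subseteq> \<Omega> \<inter> ball x r" using r by auto
  have s1: "smooth (\<lambda>y. 1 - \<psi> y)" by (intro smooth_diff smooth_const \<psi>)
  have "l2conv k \<Omega> (\<lambda>m y. (1 - \<psi> y) * f m y)"
    by (rule l2conv_cutoff[of \<Omega> UNIV]) (use open_\<Omega> s1 f in auto)
  moreover have "l2conv k \<Omega> (\<lambda>m y. \<psi> y * g m y)"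
    by (rule l2conv_cutoff[OF A closed_cball sub \<psi> g])
  ultimately show "l2conv k \<Omega> (\<lambda>m y. (1 - \<psi> y) * f m y + \<psi> y * g m y)"
    by (intro l2conv_add smooth_mult s1 f \<psi>(1) g(1))
  have uL: "u \<in> L2 \<Omega>" by (rule sobolev_L2[OF u])
  have 1: "(\<lambda>m. \<integral>y. ((1 - \<psi> y) * f m y - (1 - \<psi> y) * (\<rho> y * u y))\<^sup>2 \<partial>lebesgue_on \<Omega>) \<longlonglongrightarrow> 0"
    by (rule cutoff_tendsto[OF open_\<Omega> subset_refl s1 _ f(1) smooth_mult_L2[OF \<rho> uL] f\<rho>]) auto
  have 2: "(\<lambda>m. \<integral>y. (\<psi> y * g m y - \<psi> y * u y)\<^sup>2 \<partial>lebesgue_on \<Omega>) \<longlonglongrightarrow> 0"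
    by (rule cutoff_tendsto[OF A \<psi>(1) _ g(1) L2_restrict[OF A uL] gu]) (use \<psi>(2) sub in blast)+
  show "(\<lambda>m. \<integral>y. ((1 - \<psi> y) * f m y + \<psi> y * g m y - ((1 - \<psi> y) * \<rho> y + \<psi> y) * u y)\<^sup>2 \<partial>lebesgue_on \<Omega>) \<longlonglongrightarrow> 0"
  proof (rule tendsto_sandwich[OF _ _ tendsto_const])
    let ?a = "\<lambda>m y. (1 - \<psi> y) * f m y" and ?b = "\<lambda>m y. \<psi> y * g m y"
      and ?A = "\<lambda>y. (1 - \<psi> y) * (\<rho> y * u y)" and ?B = "\<lambda>y. \<psi> y * u y"
    show "(\<lambda>m. 2 * (\<integral>y. (?a m y - ?A y)\<^sup>2 \<partial>lebesgue_on \<Omega>) + 2 * (\<integral>y. (?b m y - ?B y)\<^sup>2 \<partial>lebesgue_on \<Omega>)) \<longlonglongrightarrow> 0"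
      using tendsto_add[OF tendsto_mult_right_zero[OF 1, of 2] tendsto_mult_right_zero[OF 2, of 2]] by simp
    have "(\<integral>y. (?a m y + ?b m y - ((1 - \<psi> y) * \<rho> y + \<psi> y) * u y)\<^sup>2 \<partial>lebesgue_on \<Omega>)
        \<le> 2 * (\<integral>y. (?a m y - ?A y)\<^sup>2 \<partial>lebesgue_on \<Omega>) + 2 * (\<integral>y. (?b m y - ?B y)\<^sup>2 \<partial>lebesgue_on \<Omega>)" for m
    proof -
      have L: "?a m \<in> L2 \<Omega>" "?b m \<in> L2 \<Omega>" "?A \<in> L2 \<Omega>" "?B \<in> L2 \<Omega>"
        by (intro smooth_in_L2 smooth_mult smooth_mult_L2 s1 f \<psi>(1) g(1) uL \<rho>)+
      have le: "(\<integral>y. (?a m y + ?b m y - (?A y + ?B y))\<^sup>2 \<partial>lebesgue_on \<Omega>)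
        \<le> 2 * (\<integral>y. (?a m y + ?b m y - (?A y + ?b m y))\<^sup>2 \<partial>lebesgue_on \<Omega>) + 2 * (\<integral>y. (?A y + ?b m y - (?A y + ?B y))\<^sup>2 \<partial>lebesgue_on \<Omega>)"
        using L2_add[OF L(1,2)] L2_add[OF L(3,2)] L2_add[OF L(3,4)] unfolding L2_eq_sq_int
        by (rule sq_int_dist_triangle)
      have "?A y + ?B y = ((1 - \<psi> y) * \<rho> y + \<psi> y) * u y" for y
        by (simp add: algebra_simps)
      then show ?thesis
        using le[unfolded add_diff_cancel_right add_diff_cancel_left] by (simp only:)
    qed
    then show "\<forall>\<^sub>F m in sequentially. (\<integral>y. (?a m y + ?b m y - ((1 - \<psi> y) * \<rho> y + \<psi> y) * u y)\<^sup>2 \<partial>lebesgue_on \<Omega>)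
        \<le> 2 * (\<integral>y. (?a m y - ?A y)\<^sup>2 \<partial>lebesgue_on \<Omega>) + 2 * (\<integral>y. (?b m y - ?B y)\<^sup>2 \<partial>lebesgue_on \<Omega>)"
      by (rule always_eventually[OF allI])
  qed simp
qed

text \<open>Finitely many balls with uniform cones cover the compact closure of the domain; the local
  mollifications are glued ball by ball. Besides \<open>f\<close> the induction maintains a
  function \<open>\<rho>\<close>, equal to \<open>1\<close> on the balls treated so far, such that
  \<open>f\<close> converges to \<open>\<rho> u\<close>. Recording membership in a class
  \<open>X\<close> closed under the operations used allows later statements about how these smooth
  functions can be approximated in turn.\<close>

theorem smooth_approximation:
  fixes X :: "(real^'n \<Rightarrow> real) set"
  assumes u: "u \<in> sobolev k \<Omega>" and cone: "\<And>x. x \<in> closure \<Omega> \<Longrightarrow> \<exists>r>0. uniform_cone \<Omega> x r"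
    and X_smooth: "\<And>f. f \<in> X \<Longrightarrow> smooth f" and X_const: "\<And>c. (\<lambda>x. c) \<in> X"
    and X_add: "\<And>f g. f \<in> X \<Longrightarrow> g \<in> X \<Longrightarrow> (\<lambda>x. f x + g x) \<in> X"
    and X_mult: "\<And>f g. f \<in> X \<Longrightarrow> g \<in> X \<Longrightarrow> (\<lambda>x. f x * g x) \<in> X"
    and X_tensor: "\<And>b. \<forall>i. deriv_chain (b i) \<Longrightarrow> tensor b (\<lambda>_. 0) \<in> X"
    and X_convolve: "\<And>b. \<forall>i. deriv_chain (b i) \<Longrightarrow> convolve \<Omega> u (tensor b (\<lambda>_. 0)) \<in> X"
  shows "\<exists>f. (\<forall>m. f m \<in> X) \<and> l2conv k \<Omega> f \<and> (\<lambda>m. \<integral>x. (f m x - u x)\<^sup>2 \<partial>lebesgue_on \<Omega>) \<longlonglongrightarrow> 0"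
proof -
  define n where "n = real CARD('n)"
  have n: "0 < n" by (simp add: n_def)
  obtain r where r: "\<And>x. x \<in> closure \<Omega> \<Longrightarrow> 0 < r x \<and> uniform_cone \<Omega> x (r x)"
    using cone by metis
  \<comment> \<open>A cutoff equal to \<open>1\<close> on the ball of radius \<open>s x\<close> is supported in the ball of radius \<open>2 n (s x) = r x / 2\<close>.\<close>
  define s where "s x = r x / (4 * n)" for x
  have s: "0 < s x" "2 * n * s x = r x / 2" if "x \<in> closure \<Omega>" for x
    using r[OF that] n by (auto simp: s_def)
  have "compact (closure \<Omega>)" using bounded_\<Omega> by (simp add: compact_closure)
  moreover have "closure \<Omega> \<subseteq> (\<Union>x\<in>closure \<Omega>. ball x (s x))"
    using s(1) by force
  ultimately obtain F where F: "F \<subseteq> closure \<Omega>" "finite F" "closure \<Omega> \<subseteq> (\<Union>x\<in>F. ball x (s x))"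
    using compactE_image[of "closure \<Omega>" "closure \<Omega>" "\<lambda>x. ball x (s x)"] by auto
  have "\<exists>f \<rho>. (\<forall>m. f m \<in> X) \<and> l2conv k \<Omega> f \<and> smooth \<rho> \<and> (\<forall>x\<in>G. \<forall>y\<in>ball x (s x). \<rho> y = 1) \<and>
       (\<lambda>m. \<integral>x. (f m x - \<rho> x * u x)\<^sup>2 \<partial>lebesgue_on \<Omega>) \<longlonglongrightarrow> 0" if "finite G" "G \<subseteq> closure \<Omega>" for G
    using that
  proof (induction G rule: finite_induct)
    case empty
    show ?case
      by (rule exI[of _ "\<lambda>m x. 0"], rule exI[of _ "\<lambda>x. 0"]) (simp add: X_const l2conv_zero smooth_const)
  next
    case (insert x G)
    then obtain f \<rho> where f: "\<And>m. f m \<in> X" "l2conv k \<Omega> f" and \<rho>: "smooth \<rho>" "\<forall>x\<in>G. \<forall>y\<in>ball x (s x). \<rho> y = 1"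
      and f\<rho>: "(\<lambda>m. \<integral>x. (f m x - \<rho> x * u x)\<^sup>2 \<partial>lebesgue_on \<Omega>) \<longlonglongrightarrow> 0"
      by auto
    have x: "x \<in> closure \<Omega>" using insert.prems by simp
    obtain c where c: "\<forall>m i. deriv_chain (c m i)"
      "l2conv k (\<Omega> \<inter> ball x (r x)) (\<lambda>m. convolve \<Omega> u (tensor (c m) (\<lambda>_. 0)))"
      "(\<lambda>m. \<integral>y. (convolve \<Omega> u (tensor (c m) (\<lambda>_. 0)) y - u y)\<^sup>2 \<partial>lebesgue_on (\<Omega> \<inter> ball x (r x))) \<longlonglongrightarrow> 0"
      using local_mollification[OF u conjunct2[OF r[OF x]]] by blast
    obtain b where "tensor_cutoff x (s x) b"
      using tensor_cutoff_exists[OF s(1)[OF x]] by blast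
    then have b: "\<forall>i. deriv_chain (b i)" "\<And>y. norm (y - x) \<le> s x \<Longrightarrow> tensor b (\<lambda>_. 0) y = 1"
      "\<And>y. tensor b (\<lambda>_. 0) y \<noteq> 0 \<Longrightarrow> norm (y - x) \<le> 2 * real CARD('n) * s x"
      unfolding tensor_cutoff_def by blast+
    define \<psi> where "\<psi> = tensor b (\<lambda>_. 0)"
    define g where "g m = convolve \<Omega> u (tensor (c m) (\<lambda>_. 0))" for m
    have \<psi>X: "\<psi> \<in> X" unfolding \<psi>_def by (rule X_tensor[OF b(1)])
    have gX: "g m \<in> X" for m unfolding g_def using c(1) by (intro X_convolve) simp
    have supp: "y \<in> cball x (r x / 2)" if "\<psi> y \<noteq> 0" for y
    proof -
      have "norm (y - x) \<le> 2 * real CARD('n) * s x" using b(3) that unfolding \<psi>_def by blast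
      also have "\<dots> = r x / 2" using s(2)[OF x] by (simp add: n_def)
      finally show ?thesis by (simp add: dist_norm norm_minus_commute)
    qed
    have one: "\<psi> y = 1" if "y \<in> ball x (s x)" for y
      unfolding \<psi>_def using that by (intro b(2)) (simp add: dist_norm norm_minus_commute)
    let ?f = "\<lambda>m y. (1 - \<psi> y) * f m y + \<psi> y * g m y" and ?\<rho> = "\<lambda>y. (1 - \<psi> y) * \<rho> y + \<psi> y"
    have "(\<lambda>y. 1 + (-1) * \<psi> y) \<in> X"
      by (rule X_add[OF X_const X_mult[OF X_const \<psi>X]])
    then have "(\<lambda>y. 1 - \<psi> y) \<in> X" by simp
    then have "?f m \<in> X" for m
      by (intro X_add X_mult \<psi>X gX f(1))
    moreover have "l2conv k \<Omega> ?f" "(\<lambda>m. \<integral>y. (?f m y - ?\<rho> y * u y)\<^sup>2 \<partial>lebesgue_on \<Omega>) \<longlonglongrightarrow> 0"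
    proof -
      have sm: "\<And>m. smooth (f m)" "\<And>m. smooth (g m)" "smooth \<psi>" "0 < r x"
        using X_smooth f(1) gX \<psi>X r[OF x] by blast+
      have cg: "l2conv k (\<Omega> \<inter> ball x (r x)) g"
        "(\<lambda>m. \<integral>y. (g m y - u y)\<^sup>2 \<partial>lebesgue_on (\<Omega> \<inter> ball x (r x))) \<longlonglongrightarrow> 0"
        unfolding g_def by (rule c(2), rule c(3))
      note gl = glue_step[where \<psi> = \<psi> and x = x and r = "r x" and f = f and g = g and \<rho> = \<rho>,
        OF u sm(4,3) supp sm(1) f(2) \<rho>(1) f\<rho> sm(2) cg]
      show "l2conv k \<Omega> ?f" by (rule gl(1))
      show "(\<lambda>m. \<integral>y. (?f m y - ?\<rho> y * u y)\<^sup>2 \<partial>lebesgue_on \<Omega>) \<longlonglongrightarrow> 0" by (rule gl(2))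
    qed
    moreover have "smooth ?\<rho>"
      by (intro smooth_add smooth_mult smooth_diff smooth_const X_smooth[OF \<psi>X] \<rho>(1))
    moreover have "\<forall>z\<in>insert x G. \<forall>y\<in>ball z (s z). ?\<rho> y = 1"
      using \<rho>(2) one by auto
    ultimately show ?case
      by (intro exI[of _ ?f] exI[of _ ?\<rho>]) blast
  qed
  from this[OF F(2,1)] obtain f \<rho> where f: "\<forall>m. f m \<in> X" "l2conv k \<Omega> f" "\<forall>x\<in>F. \<forall>y\<in>ball x (s x). \<rho> y = 1"
    "(\<lambda>m. \<integral>x. (f m x - \<rho> x * u x)\<^sup>2 \<partial>lebesgue_on \<Omega>) \<longlonglongrightarrow> 0"
    by blast
  have "\<rho> x = 1" if "x \<in> \<Omega>" for x
    using f(3) F(3) closure_subset[of \<Omega>] that by blast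
  then have "(\<integral>x. (f m x - \<rho> x * u x)\<^sup>2 \<partial>lebesgue_on \<Omega>) = (\<integral>x. (f m x - u x)\<^sup>2 \<partial>lebesgue_on \<Omega>)" for m
    by (intro Bochner_Integration.integral_cong) auto
  with f show ?thesis by auto
qed

end


section \<open>Exponential sums\<close>

text \<open>Exponentials are functions of \<open>w \<bullet> x\<close> alone, like the units of a network, and
  at the same time their span is closed under products, which the span of the sigmoid units is
  not. They mediate between the two.\<close>

inductive_set exp_sums :: "(real^'n \<Rightarrow> real) set" where
  exp: "(\<lambda>x. c * exp (w \<bullet> x)) \<in> exp_sums"
| add: "f \<in> exp_sums \<Longrightarrow> g \<in> exp_sums \<Longrightarrow> (\<lambda>x. f x + g x) \<in> exp_sums"

lemma exp_has_derivative:
  "((\<lambda>x. c * exp (w \<bullet> x)) has_derivative (\<lambda>h. c * (exp (w \<bullet> x) * (w \<bullet> h)))) (at x)"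
  by (auto intro!: derivative_eq_intros)

lemma partial_deriv_exp:
  "partial_deriv i (\<lambda>x. c * exp (w \<bullet> x)) = (\<lambda>x. (c * w $ i) * exp (w \<bullet> x))"
  by (rule ext, subst partial_deriv_eq[OF exp_has_derivative]) (simp add: inner_axis)

lemma smooth_exp: "smooth (\<lambda>x. c * exp (w \<bullet> x))"
  by (rule smooth_coinduct[of "range (\<lambda>c x. c * exp (w \<bullet> x))"])
    (auto simp: partial_deriv_exp intro: differentiableI[OF exp_has_derivative])

lemma smooth_exp_sums: "f \<in> exp_sums \<Longrightarrow> smooth f"
  by (induction rule: exp_sums.induct) (auto intro: smooth_exp smooth_add)

lemma const_exp_sums: "(\<lambda>x. c) \<in> exp_sums"
  using exp_sums.exp[of c 0] by simp

lemma exp_sums_mult: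
  assumes "f \<in> exp_sums" "g \<in> exp_sums"
  shows "(\<lambda>x. f x * g x) \<in> exp_sums"
  using assms
proof (induction arbitrary: g rule: exp_sums.induct)
  case (exp c w)
  then show ?case
  proof (induction rule: exp_sums.induct)
    case (exp c' w')
    have "(\<lambda>x. c * exp (w \<bullet> x) * (c' * exp (w' \<bullet> x))) = (\<lambda>x. (c * c') * exp ((w + w') \<bullet> x))"
      by (simp add: inner_add_left exp_add fun_eq_iff)
    then show ?case by (simp only: exp_sums.exp)
  next
    case (add f g)
    show ?case unfolding distrib_left by (rule exp_sums.add[OF add.IH])
  qed
next
  case (add f h)
  show ?case
    unfolding distrib_right by (rule exp_sums.add[OF add.IH(1)[OF add.prems] add.IH(2)[OF add.prems]])
qed

text \<open>The factor \<open>exp (w \<bullet> x)\<close> of \<open>exp (w \<bullet> (x - y))\<close> leaves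
  the integral.\<close>

lemma (in bounded_open_set) convolve_exp_sums:
  assumes "q \<in> exp_sums" "u \<in> L2 \<Omega>"
  shows "convolve \<Omega> u q \<in> exp_sums"
  using assms(1)
proof (induction rule: exp_sums.induct)
  case (exp c w)
  have "convolve \<Omega> u (\<lambda>x. c * exp (w \<bullet> x)) x = (c * (\<integral>y. u y * exp ((- w) \<bullet> y) \<partial>lebesgue_on \<Omega>)) * exp (w \<bullet> x)" for x
  proof -
    have "convolve \<Omega> u (\<lambda>x. c * exp (w \<bullet> x)) x = (\<integral>y. (c * exp (w \<bullet> x)) * (u y * exp ((- w) \<bullet> y)) \<partial>lebesgue_on \<Omega>)"
      unfolding convolve_def by (intro Bochner_Integration.integral_cong) (simp_all add: inner_diff_right exp_diff exp_minus divide_inverse mult_ac)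
    also have "\<dots> = (c * exp (w \<bullet> x)) * (\<integral>y. u y * exp ((- w) \<bullet> y) \<partial>lebesgue_on \<Omega>)"
      by (rule integral_mult_right_zero)
    finally show ?thesis by (simp only: mult_ac)
  qed
  then have "convolve \<Omega> u (\<lambda>x. c * exp (w \<bullet> x)) = (\<lambda>x. (c * (\<integral>y. u y * exp ((- w) \<bullet> y) \<partial>lebesgue_on \<Omega>)) * exp (w \<bullet> x))"
    by (rule ext)
  then show ?case by (simp only: exp_sums.exp)
next
  case (add f g)
  have "convolve \<Omega> u (\<lambda>x. f x + g x) = (\<lambda>x. convolve \<Omega> u f x + convolve \<Omega> u g x)"
    unfolding convolve_def
    using convolve_integrable[OF assms(2) smooth_continuous[OF smooth_exp_sums]] add.hyps
    by (simp add: distrib_left fun_eq_iff)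
  with add.IH show ?case by (simp only: exp_sums.add)
qed

text \<open>The upper bound comes from \<open>exp y \<le> 1 / (1 - y)\<close>.\<close>

lemma exp_remainder:
  fixes y :: real
  assumes "\<bar>y\<bar> \<le> 1 / 2"
  shows "\<bar>exp y - 1 - y\<bar> \<le> 2 * y\<^sup>2"
proof -
  have y: "y \<le> 1 / 2" using assms by linarith
  have "exp y * (1 - y) \<le> exp y * exp (- y)"
    using exp_ge_add_one_self[of "- y"] by (intro mult_left_mono) auto
  then have "exp y * (1 - y) \<le> 1" by (simp flip: exp_add)
  moreover have "1 \<le> (1 + y + 2 * y\<^sup>2) * (1 - y)"
  proof -
    have "(1 + y + 2 * y\<^sup>2) * (1 - y) = 1 + y\<^sup>2 * (1 - 2 * y)"
      by (simp add: algebra_simps power2_eq_square)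
    moreover have "0 \<le> y\<^sup>2 * (1 - 2 * y)" using y by (intro mult_nonneg_nonneg) auto
    ultimately show ?thesis by linarith
  qed
  ultimately have "exp y * (1 - y) \<le> (1 + y + 2 * y\<^sup>2) * (1 - y)" by linarith
  then have "exp y \<le> 1 + y + 2 * y\<^sup>2"
    using y by (simp add: mult_le_cancel_right)
  with exp_ge_add_one_self[of y] show ?thesis by linarith
qed

text \<open>Each derivative brings down a factor \<open>1 / (m + 1)\<close>. Stating this for varying
  coefficients \<open>c m\<close> lets derivatives fall under the same statement with limit
  \<open>0\<close>.\<close>

lemma ulim_flattening_exp:
  assumes K: "bounded K" and c: "c \<longlonglongrightarrow> c0"
  shows "ulim k K (\<lambda>m x. c m * exp (axis i (1 / real (Suc m)) \<bullet> x)) (\<lambda>x. c0)"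
  using c
proof (induction k arbitrary: c c0)
  obtain R where R: "\<And>x. x \<in> K \<Longrightarrow> norm x \<le> R" using K by (auto simp: bounded_iff)
  have e: "uniform_limit K (\<lambda>m x. exp (axis i (1 / real (Suc m)) \<bullet> x)) (\<lambda>x. 1) sequentially"
  proof (rule uniform_limitI)
    fix e :: real assume "0 < e"
    have "(\<lambda>m. exp (\<bar>R\<bar> * (1 / real (Suc m))) - 1) \<longlonglongrightarrow> exp (\<bar>R\<bar> * 0) - 1"
      by (intro tendsto_intros LIMSEQ_Suc[OF lim_1_over_n])
    then have "\<forall>\<^sub>F m in sequentially. exp (\<bar>R\<bar> * (1 / real (Suc m))) - 1 < e"
      using \<open>0 < e\<close> by (intro order_tendstoD(2)) auto
    then show "\<forall>\<^sub>F m in sequentially. \<forall>x\<in>K. dist (exp (axis i (1 / real (Suc m)) \<bullet> x)) 1 < e"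
    proof (rule eventually_mono, intro ballI)
      fix m x assume m: "exp (\<bar>R\<bar> * (1 / real (Suc m))) - 1 < e" and x: "x \<in> K"
      define y where "y = axis i (1 / real (Suc m)) \<bullet> x"
      have "y = x $ i * (1 / real (Suc m))" by (simp add: y_def inner_axis')
      then have "\<bar>y\<bar> = \<bar>x $ i\<bar> * (1 / real (Suc m))" by (simp add: abs_mult)
      also have "\<dots> \<le> \<bar>R\<bar> * (1 / real (Suc m))"
        using component_le_norm_cart[of x i] R[OF x] by (intro mult_right_mono) auto
      finally have "exp \<bar>y\<bar> \<le> exp (\<bar>R\<bar> * (1 / real (Suc m)))" by simp
      moreover have "\<bar>exp y - 1\<bar> \<le> exp \<bar>y\<bar> - 1"
      proof (cases "0 \<le> y")
        case False
        have "0 \<le> (exp (y / 2) - exp (- y / 2))\<^sup>2" by simp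
        also have "\<dots> = exp y + exp (- y) - 2"
          by (simp add: power2_diff flip: exp_add exp_of_nat_mult)
        finally show ?thesis using False by simp
      qed simp
      ultimately show "dist (exp (axis i (1 / real (Suc m)) \<bullet> x)) 1 < e"
        using m unfolding y_def dist_real_def by linarith
    qed
  qed
  have u: "uniform_limit K (\<lambda>m x. c m * exp (axis i (1 / real (Suc m)) \<bullet> x)) (\<lambda>x. c0) sequentially"
    if "c \<longlonglongrightarrow> c0" for c c0
  proof -
    have "uniform_limit K (\<lambda>m x. c m) (\<lambda>x. c0) sequentially"
      using that by (simp add: uniform_limit_iff tendsto_iff)
    from uniform_lim_mult[OF this e] show ?thesis
      by (simp add: image_constant_conv)
  qed
  {
    case 0
    then show ?case using u by (simp add: ulim_0)
  next
    case (Suc k)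
    have "ulim k K (\<lambda>m x. (c m * (axis i (1 / real (Suc m)) $ l)) * exp (axis i (1 / real (Suc m)) \<bullet> x)) (\<lambda>x. 0)" for l
    proof (rule Suc.IH)
      have "(\<lambda>m. c m * ((1 / real (Suc m)) * (if l = i then 1 else 0))) \<longlonglongrightarrow> c0 * (0 * (if l = i then 1 else 0))"
        by (intro tendsto_intros Suc.prems LIMSEQ_Suc[OF lim_1_over_n])
      then show "(\<lambda>m. c m * (axis i (1 / real (Suc m)) $ l)) \<longlonglongrightarrow> 0"
        by (simp add: axis_def if_distrib cong: if_cong)
    qed
    with u[OF Suc.prems] show ?case
      by (simp add: ulim_Suc partial_deriv_exp partial_deriv_const)
  }
qed

lemma coordinate_has_derivative:
  assumes "(f has_real_derivative f') (at (x $ i))"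
  shows "((\<lambda>x. f (x $ i)) has_derivative (\<lambda>h. f' * h $ i)) (at x)"
  using has_derivative_compose[OF bounded_linear.has_derivative[OF bounded_linear_vec_nth has_derivative_ident]
      assms[unfolded has_field_derivative_def]] .

lemma partial_deriv_coordinate:
  assumes "\<And>t. (f has_real_derivative f' t) (at t)"
  shows "partial_deriv l (\<lambda>x. f (x $ i)) = (\<lambda>x. if l = i then f' (x $ i) else 0)"
  by (rule ext, subst partial_deriv_eq[OF coordinate_has_derivative[OF assms]]) (simp add: axis_def)

lemma smooth_coordinate:
  assumes "deriv_chain b"
  shows "smooth (\<lambda>x. b j (x $ i))"
proof (rule smooth_coinduct[of "range (\<lambda>j x. b j (x $ i)) \<union> {\<lambda>x. 0}"])
  have d: "(b j has_real_derivative b (Suc j) t) (at t)" for j t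
    using assms by (simp add: deriv_chain_def)
  have pd: "partial_deriv l (\<lambda>x. b j (x $ i)) \<in> range (\<lambda>j x. b j (x $ i)) \<union> {\<lambda>x. 0}" for j l
    by (cases "l = i") (auto simp: partial_deriv_coordinate[OF d])
  have df: "(\<lambda>x. b j (x $ i)) differentiable at x" for j x
    by (rule differentiableI[OF coordinate_has_derivative[OF d]])
  show "(\<forall>x. f differentiable at x) \<and> (\<forall>l. partial_deriv l f \<in> range (\<lambda>j x. b j (x $ i)) \<union> {\<lambda>x. 0})"
    if f: "f \<in> range (\<lambda>j x. b j (x $ i)) \<union> {\<lambda>x. 0}" for f
  proof (cases "f = (\<lambda>x. 0)")
    case True
    then show ?thesis by (simp add: partial_deriv_const)
  next
    case False
    then obtain j where "f = (\<lambda>x. b j (x $ i))" using f by blast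
    then show ?thesis using pd df by simp
  qed
qed auto

lemma deriv_chain_poly: "deriv_chain (\<lambda>j. poly ((pderiv ^^ j) p))"
  by (simp add: deriv_chain_def poly_DERIV)

lemma smooth_poly_coordinate: "smooth (\<lambda>x. poly p (x $ i))"
  using smooth_coordinate[OF deriv_chain_poly, of 0 p i] by simp

text \<open>The difference quotient \<open>(exp (h t) - 1) / h\<close> tends to \<open>t\<close> with all
  derivatives as \<open>h\<close> tends to \<open>0\<close>; thus polynomials come within reach of
  exponential sums.\<close>

lemma coordinate_in_closure:
  assumes K: "bounded K"
  shows "(\<lambda>x. x $ i) \<in> C_k_closure k K exp_sums"
proof (rule C_k_closureI)
  let ?s = "\<lambda>m x. real (Suc m) * exp (axis i (1 / real (Suc m)) \<bullet> x) + (- real (Suc m)) * exp (0 \<bullet> x)"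
  show "smooth (\<lambda>x. x $ i)" using smooth_poly_coordinate[of "[:0, 1:]" i] by simp
  show s: "?s m \<in> exp_sums" for m by (intro exp_sums.intros)
  show "smooth (?s m)" for m by (rule smooth_exp_sums[OF s])
  obtain R where R: "\<And>x. x \<in> K \<Longrightarrow> norm x \<le> R" using K by (auto simp: bounded_iff)
  have u: "uniform_limit K ?s (\<lambda>x. x $ i) sequentially"
  proof (rule uniform_limitI)
    fix e :: real assume "0 < e"
    have "(\<lambda>m. 2 * \<bar>R\<bar>\<^sup>2 * (1 / real (Suc m))) \<longlonglongrightarrow> 0"
      by (intro tendsto_mult_right_zero LIMSEQ_Suc[OF lim_1_over_n])
    then have 1: "\<forall>\<^sub>F m in sequentially. 2 * \<bar>R\<bar>\<^sup>2 * (1 / real (Suc m)) < e"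
      using \<open>0 < e\<close> by (intro order_tendstoD(2)) auto
    have "(\<lambda>m. \<bar>R\<bar> * (1 / real (Suc m))) \<longlonglongrightarrow> 0"
      by (intro tendsto_mult_right_zero LIMSEQ_Suc[OF lim_1_over_n])
    then have 2: "\<forall>\<^sub>F m in sequentially. \<bar>R\<bar> * (1 / real (Suc m)) < 1 / 2"
      by (intro order_tendstoD(2)) auto
    show "\<forall>\<^sub>F m in sequentially. \<forall>x\<in>K. dist (?s m x) (x $ i) < e"
      using 1 2
    proof eventually_elim
      case (elim m)
      show ?case
      proof
        fix x assume x: "x \<in> K"
        define M where "M = real (Suc m)"
        have M: "0 < M" by (simp add: M_def)
        define y where "y = x $ i / M"
        have y: "axis i (1 / M) \<bullet> x = y" "M * y = x $ i" using M by (simp_all add: y_def inner_axis')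
        have "\<bar>x $ i\<bar> \<le> \<bar>R\<bar>" using component_le_norm_cart[of x i] R[OF x] by linarith
        then have yR: "\<bar>y\<bar> \<le> \<bar>R\<bar> / M" using M by (simp add: y_def divide_right_mono)
        moreover have "\<bar>R\<bar> / M < 1 / 2" using elim(2) by (simp add: M_def del: of_nat_Suc)
        ultimately have "\<bar>y\<bar> \<le> 1 / 2" by linarith
        have "\<bar>M * (exp y - 1 - y)\<bar> = M * \<bar>exp y - 1 - y\<bar>" using M by (simp add: abs_mult)
        also have "\<dots> \<le> M * (2 * y\<^sup>2)"
          using exp_remainder[OF \<open>\<bar>y\<bar> \<le> 1 / 2\<close>] M by (intro mult_left_mono) auto
        also have "\<dots> \<le> M * (2 * (\<bar>R\<bar> / M)\<^sup>2)"
          using power_mono[OF yR abs_ge_zero, of 2] M by (intro mult_left_mono) auto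
        also have "\<dots> = 2 * \<bar>R\<bar>\<^sup>2 * (1 / M)" using M by (simp add: power2_eq_square field_simps)
        also have "\<dots> < e" using elim(1) by (simp add: M_def)
        finally have "\<bar>M * (exp y - 1 - y)\<bar> < e" .
        moreover have "?s m x - x $ i = M * (exp y - 1 - y)"
          unfolding M_def[symmetric] y(1) using y(2) by (simp add: algebra_simps)
        ultimately show "dist (?s m x) (x $ i) < e" by (simp add: dist_real_def)
      qed
    qed
  qed
  show "ulim k K ?s (\<lambda>x. x $ i)"
  proof (cases k)
    case 0
    with u show ?thesis by (simp add: ulim_0)
  next
    case (Suc k')
    have "ulim k' K (\<lambda>m. partial_deriv l (?s m)) (partial_deriv l (\<lambda>x. x $ i))" for l
    proof -
      have c: "(\<lambda>m. if l = i then 1 else (0::real)) \<longlonglongrightarrow> (if l = i then 1 else 0)" by simp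
      have "partial_deriv l (?s m) = (\<lambda>x. (if l = i then 1 else 0) * exp (axis i (1 / real (Suc m)) \<bullet> x))" for m
        unfolding partial_deriv_add[OF smooth_exp smooth_exp] partial_deriv_exp
        by (auto simp: axis_def fun_eq_iff simp del: of_nat_Suc)
      moreover have "partial_deriv l (\<lambda>x. x $ i) = (\<lambda>x. if l = i then 1 else 0)"
        by (rule partial_deriv_coordinate) simp
      ultimately show ?thesis
        using ulim_flattening_exp[OF K c, of k' i] by (simp del: of_nat_Suc)
    qed
    with u Suc show ?thesis by (simp add: ulim_Suc)
  qed
qed

lemma const_in_closure: "(\<lambda>x. c) \<in> C_k_closure k K exp_sums"
  by (rule C_k_closure_subset[OF const_exp_sums smooth_const])

lemma poly_in_closure:
  assumes "bounded K"
  shows "(\<lambda>x. poly p (x $ i)) \<in> C_k_closure k K exp_sums"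
proof (induction p)
  case 0
  then show ?case using const_in_closure[of 0] by simp
next
  case (pCons a p)
  have "(\<lambda>x. a + x $ i * poly p (x $ i)) \<in> C_k_closure k K exp_sums"
    by (intro C_k_closure_add C_k_closure_mult const_in_closure coordinate_in_closure assms pCons exp_sums.add exp_sums_mult)
  then show ?case by simp
qed

lemma poly_antiderivative: "\<exists>P. pderiv P = (p :: real poly)"
proof -
  define P where "P = (\<Sum>i\<le>degree p. monom (coeff p i / real (Suc i)) (Suc i))"
  have sum: "pderiv (sum f A) = (\<Sum>i\<in>A. pderiv (f i))" for f :: "nat \<Rightarrow> real poly" and A
    by (induction A rule: infinite_finite_induct) (simp_all add: pderiv_add)
  have "pderiv P = (\<Sum>i\<le>degree p. monom (coeff p i) i)"
    unfolding P_def sum by (simp add: pderiv_monom del: of_nat_Suc)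
  also have "\<dots> = p" by (rule poly_as_sum_of_monoms)
  finally show ?thesis ..
qed

text \<open>Weierstrass approximation together with \<open>k\<close> derivatives: approximate the highest derivative and
  integrate.\<close>

lemma Weierstrass_with_derivatives:
  assumes "deriv_chain b" and R: "0 < R" and "0 < \<epsilon>"
  shows "\<exists>p. cclose k (cball 0 R) \<epsilon> (\<lambda>x :: real^'n. poly p (x $ i)) (\<lambda>x. b 0 (x $ i))"
  using assms(1,3)
proof (induction k arbitrary: b \<epsilon>)
  case 0
  have "continuous_on {-R..R} (b 0)"
    using 0(1) unfolding deriv_chain_def by (meson DERIV_isCont continuous_at_imp_continuous_on)
  then obtain g where g: "real_polynomial_function g" "\<And>t. t \<in> {-R..R} \<Longrightarrow> \<bar>b 0 t - g t\<bar> < \<epsilon>"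
    using Stone_Weierstrass_real_polynomial_function[of "{-R..R}" "b 0" \<epsilon>] 0(2) by auto
  from g(1) obtain a n where "g = (\<lambda>t. \<Sum>i\<le>n. a i * t ^ i)"
    by (auto simp: real_polynomial_function_iff_sum)
  then have "g = poly (\<Sum>i\<le>n. monom (a i) i)"
    by (simp add: poly_sum poly_monom fun_eq_iff)
  moreover have "x $ i \<in> {-R..R}" if "x \<in> cball 0 R" for x :: "real^'n"
    using component_le_norm_cart[of x i] that by (simp add: abs_le_iff)
  ultimately show ?case
    using g(2) by (intro exI[of _ "\<Sum>i\<le>n. monom (a i) i"]) (simp add: abs_minus_commute)
next
  case (Suc k)
  have db: "(b 0 has_real_derivative b (Suc 0) t) (at t)" for t
    using Suc.prems by (simp add: deriv_chain_def)
  have "deriv_chain (\<lambda>j. b (Suc j))" using Suc.prems(1) by (simp add: deriv_chain_def)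
  \<comment> \<open>Integrating an error \<open>e\<close> of the derivative from \<open>0\<close> to \<open>t\<close> gives at most \<open>e R < \<epsilon>\<close>.\<close>
  moreover define e where "e = min \<epsilon> (\<epsilon> / (R + 1))"
  have e: "0 < e" "e \<le> \<epsilon>" "e * R < \<epsilon>"
  proof -
    show "0 < e" "e \<le> \<epsilon>" using Suc.prems R by (auto simp: e_def)
    have "e * R \<le> \<epsilon> / (R + 1) * R" using R by (intro mult_right_mono) (auto simp: e_def)
    also have "\<dots> < \<epsilon>" using R Suc.prems(2) by (simp add: field_simps)
    finally show "e * R < \<epsilon>" .
  qed
  ultimately obtain p where p: "cclose k (cball 0 R) e (\<lambda>x :: real^'n. poly p (x $ i)) (\<lambda>x. b (Suc 0) (x $ i))"
    using Suc.IH by blast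
  obtain P0 where P0: "pderiv P0 = p" using poly_antiderivative by blast
  define P where "P = P0 + [:b 0 0 - poly P0 0:]"
  have P: "pderiv P = p" "poly P 0 = b 0 0" using P0 by (simp_all add: P_def pderiv_add pderiv_pCons)
  have dP: "(poly P has_real_derivative poly p t) (at t)" for t
    using poly_DERIV[of P t] P(1) by simp
  have "\<bar>poly P t - b 0 t\<bar> < \<epsilon>" if t: "\<bar>t\<bar> \<le> R" for t
  proof -
    have "norm ((poly P t - b 0 t) - (poly P 0 - b 0 0)) \<le> e * norm (t - 0)"
    proof (rule field_differentiable_bound[of "{-R..R}" "\<lambda>t. poly P t - b 0 t" "\<lambda>t. poly p t - b (Suc 0) t"])
      show "((\<lambda>t. poly P t - b 0 t) has_field_derivative poly p z - b (Suc 0) z) (at z within {-R..R})" for z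
        by (rule has_field_derivative_at_within[OF DERIV_diff[OF dP db]])
      show "norm (poly p z - b (Suc 0) z) \<le> e" if "z \<in> {-R..R}" for z
      proof -
        have "axis i z \<in> cball (0 :: real^'n) R" using that by (simp add: norm_eq_sqrt_inner[of "axis i z"] inner_axis_axis abs_le_iff)
        from cclose_bound[OF p this] show ?thesis by simp
      qed
    qed (use t R in auto)
    also have "\<dots> \<le> e * R" using t e(1) by simp
    finally show ?thesis using e(3) P(2) by simp
  qed
  moreover have "\<bar>x $ i\<bar> \<le> R" if "x \<in> cball 0 R" for x :: "real^'n"
    using component_le_norm_cart[of x i] that by simp
  moreover have "cclose k (cball 0 R) \<epsilon> (partial_deriv l (\<lambda>x :: real^'n. poly P (x $ i))) (partial_deriv l (\<lambda>x. b 0 (x $ i)))" for l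
    using cclose_mono[OF p e(2)] cclose_refl[OF Suc.prems(2)]
    by (cases "l = i") (simp_all add: partial_deriv_coordinate[OF dP] partial_deriv_coordinate[OF db])
  ultimately show ?case
    by (intro exI[of _ P]) simp
qed

lemma cclose_subset: "cclose k K e f g \<Longrightarrow> L \<subseteq> K \<Longrightarrow> cclose k L e f g"
  by (induction k arbitrary: f g) auto

lemma coordinate_chain_in_closure:
  fixes K :: "(real^'n) set"
  assumes b: "deriv_chain b" and K: "bounded K"
  shows "(\<lambda>x. b 0 (x $ i)) \<in> C_k_closure k K exp_sums"
proof (rule C_k_closure_trans)
  obtain R where R: "\<And>x. x \<in> K \<Longrightarrow> norm x \<le> R" using K by (auto simp: bounded_iff)
  have RP: "0 < \<bar>R\<bar> + 1" by linarith
  have "K \<subseteq> cball 0 (\<bar>R\<bar> + 1)" using R by force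
  have "\<exists>s\<in>range (\<lambda>p x. poly p (x $ i)). smooth s \<and> cclose k K e s (\<lambda>x. b 0 (x $ i))" if e: "0 < e" for e
  proof -
    obtain p where "cclose k (cball 0 (\<bar>R\<bar> + 1)) e (\<lambda>x :: real^'n. poly p (x $ i)) (\<lambda>x. b 0 (x $ i))"
      using Weierstrass_with_derivatives[OF b _ e, of "\<bar>R\<bar> + 1" k i] RP by blast
    from cclose_subset[OF this \<open>K \<subseteq> cball 0 (\<bar>R\<bar> + 1)\<close>] show ?thesis
      using smooth_poly_coordinate by blast
  qed
  then show "(\<lambda>x. b 0 (x $ i)) \<in> C_k_closure k K (range (\<lambda>p x. poly p (x $ i)))"
    using smooth_coordinate[OF b] by (simp add: C_k_closure_def)
qed (use poly_in_closure[OF K] in auto)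

lemma tensor_in_closure:
  fixes K :: "(real^'n) set"
  assumes b: "\<forall>i. deriv_chain (b i)" and K: "bounded K"
  shows "tensor b (\<lambda>_. 0) \<in> C_k_closure k K exp_sums"
proof -
  have "(\<lambda>x. \<Prod>i\<in>I. b i 0 (x $ i)) \<in> C_k_closure k K exp_sums" if "finite I" for I
    using that
  proof (induction I rule: finite_induct)
    case empty
    then show ?case using const_in_closure[of 1] by simp
  next
    case (insert i I)
    have "(\<lambda>x. b i 0 (x $ i) * (\<Prod>i\<in>I. b i 0 (x $ i))) \<in> C_k_closure k K exp_sums"
      using b by (intro C_k_closure_mult coordinate_chain_in_closure insert K exp_sums_mult) auto
    then show ?case using insert.hyps by simp
  qed
  from this[of UNIV] show ?thesis by (simp add: tensor_def[abs_def])
qed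

context bounded_open_set
begin

text \<open>Convolution with \<open>u\<close> multiplies uniform distances by at most the integral of
  \<open>\<bar>u\<bar>\<close>, and it commutes with derivatives.\<close>

lemma convolve_cclose:
  assumes u: "u \<in> L2 \<Omega>" and \<delta>: "0 \<le> \<delta>" "\<delta> * (\<integral>y. \<bar>u y\<bar> \<partial>lebesgue_on \<Omega>) < \<epsilon>"
  shows "smooth q \<Longrightarrow> smooth q' \<Longrightarrow> cclose k {x - y |x y. x \<in> \<Omega> \<and> y \<in> \<Omega>} \<delta> q q' \<Longrightarrow>
     cclose k \<Omega> \<epsilon> (convolve \<Omega> u q) (convolve \<Omega> u q')"
proof (induction k arbitrary: q q')
  have *: "\<bar>convolve \<Omega> u q x - convolve \<Omega> u q' x\<bar> < \<epsilon>"
    if q: "smooth q" "smooth q'" and c: "cclose k {x - y |x y. x \<in> \<Omega> \<and> y \<in> \<Omega>} \<delta> q q'" and x: "x \<in> \<Omega>"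
    for k q q' and x :: "real^'n"
  proof -
    note int = convolve_integrable[OF u smooth_continuous[OF q(1)], of x] convolve_integrable[OF u smooth_continuous[OF q(2)], of x]
    have "convolve \<Omega> u q x - convolve \<Omega> u q' x = (\<integral>y. u y * q (x - y) - u y * q' (x - y) \<partial>lebesgue_on \<Omega>)"
      unfolding convolve_def using int by simp
    moreover have "\<bar>\<integral>y. u y * q (x - y) - u y * q' (x - y) \<partial>lebesgue_on \<Omega>\<bar> \<le> (\<integral>y. \<delta> * \<bar>u y\<bar> \<partial>lebesgue_on \<Omega>)"
    proof (rule order_trans[OF integral_abs_bound], rule integral_mono)
      show "\<bar>u y * q (x - y) - u y * q' (x - y)\<bar> \<le> \<delta> * \<bar>u y\<bar>" if "y \<in> space (lebesgue_on \<Omega>)" for y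
      proof -
        have "x - y \<in> {x - y |x y. x \<in> \<Omega> \<and> y \<in> \<Omega>}" using that x by auto
        from cclose_bound[OF c this] have "\<bar>q (x - y) - q' (x - y)\<bar> * \<bar>u y\<bar> \<le> \<delta> * \<bar>u y\<bar>"
          by (intro mult_right_mono) auto
        then show ?thesis by (simp add: abs_mult[symmetric] algebra_simps)
      qed
    qed (use int L2_integrable[OF u] in auto)
    ultimately show ?thesis using \<delta>(2) by simp
  qed
  {
    case 0
    then show ?case using *[of q q' 0] by simp
  next
    case (Suc k)
    have "cclose k \<Omega> \<epsilon> (convolve \<Omega> u (partial_deriv i q)) (convolve \<Omega> u (partial_deriv i q'))" for i
      using Suc.prems by (intro Suc.IH smooth_partial) auto
    then show ?case
      using *[OF Suc.prems] Suc.prems by (simp add: partial_deriv_convolve[OF u])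
  }
qed

text \<open>Convolving \<open>u\<close> with an exponential sum close to \<open>q\<close> gives an exponential
  sum close to \<open>convolve \<Omega> u q\<close>. The approximation of \<open>q\<close> is
  needed on all differences of points of the domain.\<close>

lemma convolve_in_closure:
  assumes u: "u \<in> L2 \<Omega>" and q: "\<And>K. bounded K \<Longrightarrow> q \<in> C_k_closure k K exp_sums"
  shows "convolve \<Omega> u q \<in> C_k_closure k \<Omega> exp_sums"
proof -
  let ?K = "{x - y |x y. x \<in> \<Omega> \<and> y \<in> \<Omega>}"
  have "bounded ?K"
  proof -
    obtain R where R: "\<And>y. y \<in> \<Omega> \<Longrightarrow> norm y \<le> R" using bounded_\<Omega> by (auto simp: bounded_iff)
    have "norm (x - y) \<le> R + R" if "x \<in> \<Omega>" "y \<in> \<Omega>" for x y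
      using norm_triangle_ineq4[of x y] R[OF that(1)] R[OF that(2)] by linarith
    then show ?thesis by (auto simp: bounded_iff)
  qed
  then have qK: "q \<in> C_k_closure k ?K exp_sums" by (rule q)
  then have sq: "smooth q" by (rule C_k_closure_smooth)
  define I where "I = (\<integral>y. \<bar>u y\<bar> \<partial>lebesgue_on \<Omega>)"
  have I: "0 \<le> I" by (simp add: I_def)
  show ?thesis
    unfolding C_k_closure_def
  proof (intro CollectI conjI allI impI)
    show "smooth (convolve \<Omega> u q)" by (rule smooth_convolve[OF u sq])
    fix \<epsilon> :: real assume \<epsilon>: "0 < \<epsilon>"
    define \<delta> where "\<delta> = \<epsilon> / (I + 1)"
    have \<delta>: "0 < \<delta>" "\<delta> * I < \<epsilon>" using \<epsilon> I by (auto simp: \<delta>_def field_simps)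
    obtain s where s: "s \<in> exp_sums" "smooth s" "cclose k ?K \<delta> s q"
      using qK \<delta>(1) unfolding C_k_closure_def by blast
    have "cclose k \<Omega> \<epsilon> (convolve \<Omega> u s) (convolve \<Omega> u q)"
      by (rule convolve_cclose[OF u _ _ s(2) sq s(3)]) (use \<delta> in \<open>auto simp: I_def\<close>)
    then show "\<exists>s\<in>exp_sums. smooth s \<and> cclose k \<Omega> \<epsilon> s (convolve \<Omega> u q)"
      using convolve_exp_sums[OF s(1) u] smooth_convolve[OF u s(2)] by blast
  qed
qed

end

section \<open>Sums of sigmoids\<close>

inductive_set sigmoid_sums :: "(real^'n \<Rightarrow> real) set" where
  sig: "(\<lambda>x. c * sigmoid (w \<bullet> x + b)) \<in> sigmoid_sums"
| add: "f \<in> sigmoid_sums \<Longrightarrow> g \<in> sigmoid_sums \<Longrightarrow> (\<lambda>x. f x + g x) \<in> sigmoid_sums"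

lemma sigmoid_has_derivative: "(sigmoid has_real_derivative sigmoid t * (1 - sigmoid t)) (at t)"
proof -
  have "1 + exp (- t) \<noteq> 0" by (smt (verit) exp_gt_zero)
  then show ?thesis
    unfolding sigmoid_def by (auto intro!: derivative_eq_intros simp: field_simps power2_eq_square)
qed

lemma sigmoid_affine_has_derivative:
  "((\<lambda>x. poly p (sigmoid (w \<bullet> x + b))) has_derivative
     (\<lambda>h. (w \<bullet> h) * poly (pderiv p * [:0, 1, -1:]) (sigmoid (w \<bullet> x + b)))) (at x)"
proof -
  have a: "((\<lambda>x. w \<bullet> x + b) has_derivative (\<lambda>h. w \<bullet> h)) (at x)"
    by (auto intro!: derivative_eq_intros)
  have s: "((\<lambda>t. poly p (sigmoid t)) has_real_derivative
      poly (pderiv p) (sigmoid t) * (sigmoid t * (1 - sigmoid t))) (at t)" for t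
    by (rule DERIV_chain2[OF poly_DERIV sigmoid_has_derivative])
  from has_derivative_compose[OF a s[unfolded has_field_derivative_def]]
  show ?thesis by (simp add: algebra_simps)
qed

lemma partial_deriv_sigmoid_poly:
  "partial_deriv i (\<lambda>x. poly p (sigmoid (w \<bullet> x + b))) =
     (\<lambda>x. poly (smult (w $ i) (pderiv p * [:0, 1, -1:])) (sigmoid (w \<bullet> x + b)))"
  by (rule ext, subst partial_deriv_eq[OF sigmoid_affine_has_derivative]) (simp add: inner_axis)

lemma smooth_sigmoid_poly: "smooth (\<lambda>x. poly p (sigmoid (w \<bullet> x + b)))"
proof (rule smooth_coinduct[of "range (\<lambda>p x. poly p (sigmoid (w \<bullet> x + b)))"])
  show "(\<forall>x. f differentiable at x) \<and> (\<forall>i. partial_deriv i f \<in> range (\<lambda>p x. poly p (sigmoid (w \<bullet> x + b))))"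
    if f: "f \<in> range (\<lambda>p x. poly p (sigmoid (w \<bullet> x + b)))" for f
  proof -
    obtain p where p: "f = (\<lambda>x. poly p (sigmoid (w \<bullet> x + b)))" using f by blast
    show ?thesis
      unfolding p partial_deriv_sigmoid_poly using differentiableI[OF sigmoid_affine_has_derivative] by blast
  qed
qed simp

lemma smooth_sigmoid: "smooth (\<lambda>x. sigmoid (w \<bullet> x + b))"
  using smooth_sigmoid_poly[of "[:0, 1:]" w b] by simp

lemma partial_deriv_sigmoid:
  "partial_deriv i (\<lambda>x. sigmoid (w \<bullet> x + b)) =
     (\<lambda>x. w $ i * (sigmoid (w \<bullet> x + b) * (1 + (-1) * sigmoid (w \<bullet> x + b))))"
  using partial_deriv_sigmoid_poly[of i "[:0, 1:]" w b] by (simp add: pderiv_pCons algebra_simps)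

lemma smooth_sigmoid_sums: "f \<in> sigmoid_sums \<Longrightarrow> smooth f"
  by (induction rule: sigmoid_sums.induct) (auto intro: smooth_cmult smooth_sigmoid smooth_add)

text \<open>The derivative \<open>\<sigma> (1 - \<sigma>)\<close> contains \<open>\<sigma>\<close> as a factor
  and so tends to \<open>0\<close> along with it.\<close>

lemma ulim_sigmoid_0:
  assumes K: "bounded K"
  shows "ulim k K (\<lambda>m x. sigmoid (w \<bullet> x + - real m)) (\<lambda>x. 0)"
proof (induction k)
  obtain R where R: "\<And>x. x \<in> K \<Longrightarrow> norm x \<le> R" using K by (auto simp: bounded_iff)
  have u: "uniform_limit K (\<lambda>m x. sigmoid (w \<bullet> x + - real m)) (\<lambda>x. 0) sequentially"
  proof (rule uniform_limitI)
    fix e :: real assume "0 < e"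
    have "(\<lambda>m. exp (norm w * R) * (exp (- 1)) ^ m) \<longlonglongrightarrow> 0"
      by (intro tendsto_mult_right_zero LIMSEQ_realpow_zero) auto
    then have "\<forall>\<^sub>F m in sequentially. exp (norm w * R) * (exp (- 1)) ^ m < e"
      using \<open>0 < e\<close> by (rule order_tendstoD(2))
    then show "\<forall>\<^sub>F m in sequentially. \<forall>x\<in>K. dist (sigmoid (w \<bullet> x + - real m)) 0 < e"
    proof (rule eventually_mono, intro ballI)
      fix m x assume m: "exp (norm w * R) * (exp (- 1)) ^ m < e" and x: "x \<in> K"
      define t where "t = w \<bullet> x + - real m"
      have "w \<bullet> x \<le> norm w * norm x" by (rule norm_cauchy_schwarz)
      also have "\<dots> \<le> norm w * R" using R[OF x] by (intro mult_left_mono) auto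
      finally have "exp t \<le> exp (norm w * R + - real m)" by (simp add: t_def)
      also have "\<dots> = exp (norm w * R) * exp (- 1) ^ m"
        by (simp only: exp_add exp_of_nat_mult[symmetric]) simp
      finally have "exp t < e" using m by linarith
      moreover have "0 \<le> sigmoid t" "sigmoid t \<le> exp t"
      proof -
        have p: "0 < 1 + exp (- t)" by (smt (verit) exp_gt_zero)
        show "0 \<le> sigmoid t" using p by (simp add: sigmoid_def)
        have "1 \<le> exp t * (1 + exp (- t))" by (simp add: distrib_left flip: exp_add)
        then show "sigmoid t \<le> exp t" using p by (simp add: sigmoid_def pos_divide_le_eq)
      qed
      ultimately show "dist (sigmoid (w \<bullet> x + - real m)) 0 < e"
        unfolding t_def dist_real_def by linarith
    qed
  qed
  {
    case 0
    then show ?case using u by (simp add: ulim_0)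
  next
    case (Suc k)
    let ?s = "\<lambda>m x. sigmoid (w \<bullet> x + - real m)"
    have s: "smooth (?s m)" for m by (rule smooth_sigmoid)
    have "ulim k K (\<lambda>m x. 1 + (-1) * ?s m x) (\<lambda>x. 1 + (-1) * 0)"
      by (intro ulim_add ulim_mult smooth_const smooth_cmult s ulim_const Suc K)
    then have "ulim k K (\<lambda>m x. w $ i * (?s m x * (1 + (-1) * ?s m x))) (\<lambda>x. w $ i * (0 * (1 + (-1) * 0)))" for i
      by (intro ulim_mult smooth_const smooth_mult smooth_add smooth_cmult s ulim_const Suc K)
    then have "ulim k K (\<lambda>m. partial_deriv i (?s m)) (partial_deriv i (\<lambda>x. 0))" for i
      unfolding partial_deriv_sigmoid partial_deriv_const by simp
    with u show ?case by (simp add: ulim_Suc)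
  }
qed

text \<open>Far out on its left tail the sigmoid is an exponential: \<open>exp m * sigmoid (t - m)\<close> equals
  \<open>exp t * (1 - sigmoid (t - m))\<close>, which tends to \<open>exp t\<close> with all derivatives.\<close>

lemma exp_in_sigmoid_closure:
  assumes K: "bounded K"
  shows "(\<lambda>x. c * exp (w \<bullet> x)) \<in> C_k_closure k K sigmoid_sums"
proof (rule C_k_closureI[OF smooth_exp])
  let ?s = "\<lambda>m x. (c * exp (real m)) * sigmoid (w \<bullet> x + - real m)"
  show s: "?s m \<in> sigmoid_sums" for m by (rule sigmoid_sums.sig)
  show "smooth (?s m)" for m by (rule smooth_sigmoid_sums[OF s])
  have eq: "?s m x = (c * exp (w \<bullet> x)) * (1 + (-1) * sigmoid (w \<bullet> x + - real m))" for m x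
  proof -
    define t where "t = w \<bullet> x + - real m"
    have p: "1 + exp (- t) \<noteq> 0" by (smt (verit) exp_gt_zero)
    have "1 + (-1) * sigmoid t = exp (- t) * sigmoid t" using p by (simp add: sigmoid_def field_simps)
    moreover have "exp (w \<bullet> x) * exp (- t) = exp (real m)" by (simp add: t_def flip: exp_add)
    ultimately show ?thesis unfolding t_def[symmetric] by (simp add: mult.assoc[symmetric])
  qed
  have "ulim k K (\<lambda>m x. (c * exp (w \<bullet> x)) * (1 + (-1) * sigmoid (w \<bullet> x + - real m))) (\<lambda>x. (c * exp (w \<bullet> x)) * (1 + (-1) * 0))"
    by (intro ulim_mult ulim_add smooth_exp smooth_const smooth_add smooth_cmult smooth_sigmoid ulim_const ulim_sigmoid_0 K)
  then show "ulim k K ?s (\<lambda>x. c * exp (w \<bullet> x))"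
    unfolding eq by simp
qed

lemma exp_sums_in_sigmoid_closure:
  assumes "bounded K" "f \<in> exp_sums"
  shows "f \<in> C_k_closure k K sigmoid_sums"
  using assms(2)
proof (induction rule: exp_sums.induct)
  case (exp c w)
  show ?case by (rule exp_in_sigmoid_closure[OF assms(1)])
next
  case (add f g)
  show ?case by (rule C_k_closure_add[OF add.IH sigmoid_sums.add])
qed

section \<open>Density of the networks\<close>

context bounded_open_set
begin

lemma l2_close_tendsto:
  assumes f: "\<And>m. smooth (f m)" and s: "\<And>m. smooth (s m)" and F: "F \<in> L2 \<Omega>"
    and close: "\<And>m x. x \<in> \<Omega> \<Longrightarrow> \<bar>s m x - f m x\<bar> < 1 / real (Suc m)"
    and lim: "(\<lambda>m. \<integral>x. (f m x - F x)\<^sup>2 \<partial>lebesgue_on \<Omega>) \<longlonglongrightarrow> 0"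
  shows "(\<lambda>m. \<integral>x. (s m x - F x)\<^sup>2 \<partial>lebesgue_on \<Omega>) \<longlonglongrightarrow> 0"
proof (rule tendsto_sandwich[OF _ _ tendsto_const])
  interpret finite_measure "lebesgue_on \<Omega>" by (rule finite_measure_\<Omega>)
  let ?V = "\<integral>x. 1 \<partial>lebesgue_on \<Omega>"
  have "(\<lambda>m. (1 / real (Suc m))\<^sup>2 * ?V) \<longlonglongrightarrow> 0\<^sup>2 * ?V"
    by (intro tendsto_intros LIMSEQ_Suc[OF lim_1_over_n])
  from tendsto_add[OF tendsto_mult[OF tendsto_const[of 2] this] tendsto_mult_right_zero[OF lim, of 2]]
  show "(\<lambda>m. 2 * ((1 / real (Suc m))\<^sup>2 * ?V) + 2 * (\<integral>x. (f m x - F x)\<^sup>2 \<partial>lebesgue_on \<Omega>)) \<longlonglongrightarrow> 0"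
    by simp
  have "(\<integral>x. (s m x - F x)\<^sup>2 \<partial>lebesgue_on \<Omega>) \<le> 2 * ((1 / real (Suc m))\<^sup>2 * ?V) + 2 * (\<integral>x. (f m x - F x)\<^sup>2 \<partial>lebesgue_on \<Omega>)" for m
  proof -
    have L: "s m \<in> L2 \<Omega>" "f m \<in> L2 \<Omega>" by (intro smooth_in_L2 s f)+
    have "(\<integral>x. (s m x - f m x)\<^sup>2 \<partial>lebesgue_on \<Omega>) \<le> (\<integral>x. (1 / real (Suc m))\<^sup>2 * 1 \<partial>lebesgue_on \<Omega>)"
    proof (rule integral_mono)
      show "(s m x - f m x)\<^sup>2 \<le> (1 / real (Suc m))\<^sup>2 * 1" if "x \<in> space (lebesgue_on \<Omega>)" for x
        using power_mono[OF less_imp_le[OF close[of x m]] abs_ge_zero, of 2] that by simp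
    qed (use L2_diff[OF L] in \<open>auto simp: L2_def\<close>)
    also have "\<dots> = (1 / real (Suc m))\<^sup>2 * ?V" by (rule integral_mult_right_zero)
    finally have "(\<integral>x. (s m x - f m x)\<^sup>2 \<partial>lebesgue_on \<Omega>) \<le> (1 / real (Suc m))\<^sup>2 * ?V" .
    moreover have "(\<integral>x. (s m x - F x)\<^sup>2 \<partial>lebesgue_on \<Omega>) \<le> 2 * (\<integral>x. (s m x - f m x)\<^sup>2 \<partial>lebesgue_on \<Omega>) + 2 * (\<integral>x. (f m x - F x)\<^sup>2 \<partial>lebesgue_on \<Omega>)"
      using L F unfolding L2_eq_sq_int by (rule sq_int_dist_triangle)
    ultimately show ?thesis by linarith
  qed
  then show "\<forall>\<^sub>F m in sequentially. (\<integral>x. (s m x - F x)\<^sup>2 \<partial>lebesgue_on \<Omega>) \<le> 2 * ((1 / real (Suc m))\<^sup>2 * ?V) + 2 * (\<integral>x. (f m x - F x)\<^sup>2 \<partial>lebesgue_on \<Omega>)"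
    by (rule always_eventually[OF allI])
qed simp

lemma l2conv_close:
  assumes "\<And>m. smooth (f m)" "\<And>m. smooth (s m)" "l2conv k \<Omega> f" "\<And>m. cclose k \<Omega> (1 / real (Suc m)) (s m) (f m)"
  shows "l2conv k \<Omega> s"
  using assms
proof (induction k arbitrary: f s)
  case 0
  obtain F where F: "F \<in> L2 \<Omega>" "(\<lambda>m. \<integral>x. (f m x - F x)\<^sup>2 \<partial>lebesgue_on \<Omega>) \<longlonglongrightarrow> 0"
    using l2conv_limit[OF 0(3)] by blast
  from l2_close_tendsto[OF 0(1,2) F(1) cclose_bound[OF 0(4)] F(2)] F(1) show ?case by auto
next
  case (Suc k)
  obtain F where F: "F \<in> L2 \<Omega>" "(\<lambda>m. \<integral>x. (f m x - F x)\<^sup>2 \<partial>lebesgue_on \<Omega>) \<longlonglongrightarrow> 0"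
    using l2conv_limit[OF Suc.prems(3)] by blast
  have "l2conv k \<Omega> (\<lambda>m. partial_deriv i (s m))" for i
  proof (rule Suc.IH)
    show "smooth (partial_deriv i (f m))" "smooth (partial_deriv i (s m))" for m
      using Suc.prems(1,2) by (auto intro: smooth_partial)
    show "l2conv k \<Omega> (\<lambda>m. partial_deriv i (f m))" using Suc.prems(3) by simp
    show "cclose k \<Omega> (1 / real (Suc m)) (partial_deriv i (s m)) (partial_deriv i (f m))" for m
      using Suc.prems(4)[of m] by simp
  qed
  with l2_close_tendsto[OF Suc.prems(1,2) F(1) cclose_bound[OF Suc.prems(4)] F(2)] F(1) show ?case by auto
qed

text \<open>Smooth approximation applied to the class of functions within reach of exponential sums, followed
  by the passage from exponentials to sigmoids at distance \<open>1 / (m + 1)\<close> in the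
  \<open>m\<close>-th step.\<close>

theorem sigmoid_sums_dense:
  assumes u: "u \<in> sobolev k \<Omega>" and cone: "\<And>x. x \<in> closure \<Omega> \<Longrightarrow> \<exists>r>0. uniform_cone \<Omega> x r" and \<epsilon>: "0 < \<epsilon>"
  shows "\<exists>s\<in>sigmoid_sums. sobolev_norm k \<Omega> (\<lambda>x. s x - u x) < \<epsilon>"
proof -
  let ?X = "C_k_closure k \<Omega> exp_sums"
  have "\<exists>f. (\<forall>m. f m \<in> ?X) \<and> l2conv k \<Omega> f \<and> (\<lambda>m. \<integral>x. (f m x - u x)\<^sup>2 \<partial>lebesgue_on \<Omega>) \<longlonglongrightarrow> 0"
  proof (rule smooth_approximation[OF u cone])
    show "(\<lambda>x. f x + g x) \<in> ?X" if "f \<in> ?X" "g \<in> ?X" for f g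
      by (rule C_k_closure_add[OF that exp_sums.add])
    show "(\<lambda>x. f x * g x) \<in> ?X" if "f \<in> ?X" "g \<in> ?X" for f g
      by (rule C_k_closure_mult[OF that bounded_\<Omega> exp_sums_mult])
    show "convolve \<Omega> u (tensor b (\<lambda>_. 0)) \<in> ?X" if "\<forall>i. deriv_chain (b i)" for b
      by (rule convolve_in_closure[OF sobolev_L2[OF u] tensor_in_closure[OF that]])
  qed (auto intro: C_k_closure_smooth const_in_closure tensor_in_closure[OF _ bounded_\<Omega>])
  then obtain f where f: "\<And>m. f m \<in> ?X" "l2conv k \<Omega> f" "(\<lambda>m. \<integral>x. (f m x - u x)\<^sup>2 \<partial>lebesgue_on \<Omega>) \<longlonglongrightarrow> 0"
    by blast
  have fs: "smooth (f m)" for m by (rule C_k_closure_smooth[OF f(1)])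
  have "f m \<in> C_k_closure k \<Omega> sigmoid_sums" for m
    by (rule C_k_closure_trans[OF f(1) exp_sums_in_sigmoid_closure[OF bounded_\<Omega>]])
  then have "\<exists>s. s \<in> sigmoid_sums \<and> cclose k \<Omega> (1 / real (Suc m)) s (f m)" for m
  proof -
    have "0 < 1 / real (Suc m)" by simp
    with \<open>\<And>m. f m \<in> C_k_closure k \<Omega> sigmoid_sums\<close> show ?thesis
      unfolding C_k_closure_def by blast
  qed
  then obtain s where s: "\<And>m. s m \<in> sigmoid_sums" "\<And>m. cclose k \<Omega> (1 / real (Suc m)) (s m) (f m)"
    by metis
  have ss: "smooth (s m)" for m by (rule smooth_sigmoid_sums[OF s(1)])
  have "(\<lambda>m. sobolev_norm k \<Omega> (\<lambda>x. s m x - u x)) \<longlonglongrightarrow> 0"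
    by (rule l2conv_imp_sobolev_norm_tendsto[OF sobolev_L2[OF u] ss
        l2_close_tendsto[OF fs ss sobolev_L2[OF u] cclose_bound[OF s(2)] f(3)] l2conv_close[OF fs ss f(2) s(2)]])
  then have "\<forall>\<^sub>F m in sequentially. sobolev_norm k \<Omega> (\<lambda>x. s m x - u x) < \<epsilon>"
    using \<epsilon> by (rule order_tendstoD(2))
  then show ?thesis using s(1) by (auto simp: eventually_sequentially)
qed

end


section \<open>Best approximation in finite dimension\<close>

text \<open>Seminorms on coefficient vectors, which may vanish on nonzero vectors: the functions combined by
  the coefficients can be linearly dependent. Homogeneity is assumed as an inequality only; the
  converse follows from the inverse scalar.\<close>

locale coefficient_seminorm =
  fixes Q :: "(nat \<Rightarrow> real) \<Rightarrow> real"
  assumes Q_nonneg: "0 \<le> Q c"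
    and Q_triangle: "Q (\<lambda>i. c i + d i) \<le> Q c + Q d"
    and Q_scale: "Q (\<lambda>i. a * c i) \<le> \<bar>a\<bar> * Q c"
begin

lemma Q_comb:
  assumes "\<And>i. c i = d i + a * e i"
  shows "Q c \<le> Q d + \<bar>a\<bar> * Q e"
proof -
  have "c = (\<lambda>i. d i + a * e i)" using assms by auto
  then show ?thesis using Q_triangle[of d "\<lambda>i. a * e i"] Q_scale[of a e] by simp
qed

definition supported :: "nat \<Rightarrow> (nat \<Rightarrow> real) \<Rightarrow> bool" where
  "supported N c \<longleftrightarrow> (\<forall>i\<ge>N. c i = 0)"

definition precompact :: "nat \<Rightarrow> bool" where
  "precompact N \<longleftrightarrow> (\<forall>c C. (\<forall>m. supported N (c m) \<and> Q (c m) \<le> C) \<longrightarrow>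
     (\<exists>r d. strict_mono (r :: nat \<Rightarrow> nat) \<and> supported N d \<and> (\<lambda>m. Q (\<lambda>i. c (r m) i - d i)) \<longlonglongrightarrow> 0))"

text \<open>A minimizing sequence is bounded in the seminorm and has a subsequence converging in it.\<close>

lemma precompact_minimizer:
  assumes N: "precompact N"
  shows "\<exists>c. supported N c \<and> (\<forall>c'. supported N c' \<longrightarrow> Q (\<lambda>i. v i - c i) \<le> Q (\<lambda>i. v i - c' i))"
proof -
  define S where "S = (\<lambda>c. Q (\<lambda>i. v i - c i)) ` {c. supported N c}"
  define \<delta> where "\<delta> = Inf S"
  have S0: "S \<noteq> {}" by (auto simp: S_def supported_def intro!: exI[of _ "\<lambda>_. 0"])
  have bdd: "bdd_below S" by (rule bdd_belowI[of _ 0]) (auto simp: S_def Q_nonneg)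
  have "\<exists>c. supported N c \<and> Q (\<lambda>i. v i - c i) < \<delta> + 1 / real (Suc m)" for m
  proof -
    have "Inf S < \<delta> + 1 / real (Suc m)" by (simp add: \<delta>_def)
    then show ?thesis using cInf_lessD[OF S0] by (auto simp: S_def)
  qed
  then obtain c where c: "\<And>m. supported N (c m)" "\<And>m. Q (\<lambda>i. v i - c m i) < \<delta> + 1 / real (Suc m)"
    by metis
  have "Q (c m) \<le> Q v + (\<delta> + 1)" for m
  proof -
    have "Q (c m) \<le> Q v + \<bar>-1\<bar> * Q (\<lambda>i. v i - c m i)" by (rule Q_comb) simp
    moreover have "1 / real (Suc m) \<le> 1" by simp
    ultimately show ?thesis using c(2)[of m] by linarith
  qed
  with c(1) N obtain r d where r: "strict_mono (r :: nat \<Rightarrow> nat)" and d: "supported N d"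
    and lim: "(\<lambda>m. Q (\<lambda>i. c (r m) i - d i)) \<longlonglongrightarrow> 0"
    unfolding precompact_def by blast
  have "Q (\<lambda>i. v i - d i) \<le> \<delta>"
  proof (rule LIMSEQ_le_const)
    have "(\<lambda>m. \<delta> + 1 / real (Suc m) + Q (\<lambda>i. c (r m) i - d i)) \<longlonglongrightarrow> \<delta> + 0 + 0"
      by (intro tendsto_add tendsto_const lim LIMSEQ_Suc[OF lim_1_over_n])
    then show "(\<lambda>m. \<delta> + 1 / real (Suc m) + Q (\<lambda>i. c (r m) i - d i)) \<longlonglongrightarrow> \<delta>" by simp
    have "Q (\<lambda>i. v i - d i) \<le> \<delta> + 1 / real (Suc m) + Q (\<lambda>i. c (r m) i - d i)" for m
    proof -
      have "Q (\<lambda>i. v i - d i) \<le> Q (\<lambda>i. v i - c (r m) i) + \<bar>1\<bar> * Q (\<lambda>i. c (r m) i - d i)"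
        by (rule Q_comb) simp
      moreover have "1 / real (Suc (r m)) \<le> 1 / real (Suc m)"
        using seq_suble[OF r, of m] by (simp add: frac_le)
      ultimately show ?thesis using c(2)[of "r m"] by linarith
    qed
    then show "\<exists>N. \<forall>m\<ge>N. Q (\<lambda>i. v i - d i) \<le> \<delta> + 1 / real (Suc m) + Q (\<lambda>i. c (r m) i - d i)" by blast
  qed
  moreover have "\<delta> \<le> Q (\<lambda>i. v i - c' i)" if "supported N c'" for c'
    unfolding \<delta>_def using that by (intro cInf_lower bdd) (auto simp: S_def)
  ultimately show ?thesis using d by (meson order_trans)
qed

text \<open>Induction on the dimension.  The unit vector \<open>e\<close> of the new coordinate either lies at distance
  \<open>0\<close> from the old coordinate space, and is then replaced by its best approximation there; or its
  distance is positive and bounds the new coordinate.\<close>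

lemma precompact_all: "precompact N"
proof (induction N)
  case 0
  have z: "Q (\<lambda>i. 0) = 0" using Q_scale[of 0 "\<lambda>_. 0"] Q_nonneg[of "\<lambda>i. 0"] by simp
  have "\<exists>r d. strict_mono (r :: nat \<Rightarrow> nat) \<and> supported 0 d \<and> (\<lambda>m. Q (\<lambda>i. c (r m) i - d i)) \<longlonglongrightarrow> 0"
    if "\<forall>m. supported 0 (c m) \<and> Q (c m) \<le> C" for c C
  proof (intro exI conjI)
    show "strict_mono (\<lambda>m :: nat. m)" by (simp add: strict_mono_def)
    show "supported 0 (\<lambda>i. 0)" by (simp add: supported_def)
    have "c m i = 0" for m i using that by (simp add: supported_def)
    then show "(\<lambda>m. Q (\<lambda>i. c m i - 0)) \<longlonglongrightarrow> 0" by (simp add: z)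
  qed
  then show ?case unfolding precompact_def by blast
next
  case (Suc N)
  define e :: "nat \<Rightarrow> real" where "e i = (if i = N then 1 else 0)" for i
  obtain d where d: "supported N d" "\<And>d'. supported N d' \<Longrightarrow> Q (\<lambda>i. e i - d i) \<le> Q (\<lambda>i. e i - d' i)"
    using precompact_minimizer[OF Suc] by blast
  define \<delta> where "\<delta> = Q (\<lambda>i. e i - d i)"
  have "\<exists>r f. strict_mono (r :: nat \<Rightarrow> nat) \<and> supported (Suc N) f \<and> (\<lambda>m. Q (\<lambda>i. c (r m) i - f i)) \<longlonglongrightarrow> 0"
    if c: "\<forall>m. supported (Suc N) (c m) \<and> Q (c m) \<le> C" for c C
  proof (cases "\<delta> = 0")
    case True
    \<comment> \<open>The new coordinate is removed along \<open>e - d\<close>, where \<open>Q\<close> vanishes.\<close>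
    define c' where "c' m i = c m i + (- c m N) * (e i - d i)" for m i
    have "supported N (c' m)" for m
      using c d(1) by (auto simp: supported_def c'_def e_def)
    moreover have "Q (c' m) \<le> C" for m
    proof -
      have "Q (c' m) \<le> Q (c m) + \<bar>- c m N\<bar> * Q (\<lambda>i. e i - d i)"
        by (rule Q_comb) (simp add: c'_def)
      moreover have "Q (c m) \<le> C" using c by blast
      ultimately show ?thesis using True by (simp add: \<delta>_def)
    qed
    ultimately obtain r f where r: "strict_mono (r :: nat \<Rightarrow> nat)" and f: "supported N f"
      and lim: "(\<lambda>m. Q (\<lambda>i. c' (r m) i - f i)) \<longlonglongrightarrow> 0"
      using Suc unfolding precompact_def by blast
    have "Q (\<lambda>i. c (r m) i - f i) \<le> Q (\<lambda>i. c' (r m) i - f i)" for m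
    proof -
      have "Q (\<lambda>i. c (r m) i - f i) \<le> Q (\<lambda>i. c' (r m) i - f i) + \<bar>c (r m) N\<bar> * Q (\<lambda>i. e i - d i)"
        by (rule Q_comb) (simp add: c'_def)
      then show ?thesis using True by (simp add: \<delta>_def)
    qed
    then have "(\<lambda>m. Q (\<lambda>i. c (r m) i - f i)) \<longlonglongrightarrow> 0"
      by (intro tendsto_sandwich[OF _ _ tendsto_const lim] always_eventually allI Q_nonneg)
    moreover have "supported (Suc N) f" using f by (simp add: supported_def)
    ultimately show ?thesis using r by blast
  next
    case False
    then have \<delta>: "0 < \<delta>" using Q_nonneg[of "\<lambda>i. e i - d i"] by (simp add: \<delta>_def)
    have bound: "\<bar>c m N\<bar> \<le> C / \<delta>" for m
    proof (cases "c m N = 0")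
      case True
      have "0 \<le> C" using c Q_nonneg[of "c m"] by (meson order_trans)
      with True \<delta> show ?thesis by simp
    next
      case False
      let ?t = "c m N"
      define d' where "d' i = e i - c m i / ?t" for i
      have "supported N d'"
        unfolding supported_def
      proof (intro allI impI)
        fix i assume "N \<le> i"
        then consider "i = N" | "Suc N \<le> i" by linarith
        then show "d' i = 0"
        proof cases
          case 1
          then show ?thesis using False by (simp add: d'_def e_def)
        next
          case 2
          then have "c m i = 0" using c by (simp add: supported_def)
          with 2 show ?thesis by (simp add: d'_def e_def)
        qed
      qed
      then have "\<delta> \<le> Q (\<lambda>i. e i - d' i)" unfolding \<delta>_def by (rule d(2))
      also have "(\<lambda>i. e i - d' i) = (\<lambda>i. (1 / ?t) * c m i)" by (simp add: d'_def)
      also have "Q (\<lambda>i. (1 / ?t) * c m i) \<le> \<bar>1 / ?t\<bar> * Q (c m)" by (rule Q_scale)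
      also have "\<dots> \<le> \<bar>1 / ?t\<bar> * C" using c by (intro mult_left_mono) auto
      finally show ?thesis using False \<delta> by (simp add: field_simps)
    qed
    then have "bounded (range (\<lambda>m. c m N))" unfolding bounded_iff real_norm_def by blast
    from bounded_imp_convergent_subsequence[OF this]
    obtain t r1 where r1: "strict_mono (r1 :: nat \<Rightarrow> nat)" and "((\<lambda>m. c m N) \<circ> r1) \<longlonglongrightarrow> t"
      by blast
    then have t: "(\<lambda>m. c (r1 m) N) \<longlonglongrightarrow> t" by (simp add: comp_def)
    define c' where "c' m i = c (r1 m) i + (- c (r1 m) N) * e i" for m i
    have "supported N (c' m)" for m
      using c by (auto simp: supported_def c'_def e_def)
    moreover have "Q (c' m) \<le> C + C / \<delta> * Q e" for m
    proof -
      have "Q (c' m) \<le> Q (c (r1 m)) + \<bar>- c (r1 m) N\<bar> * Q e"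
        by (rule Q_comb) (simp add: c'_def)
      also have "\<dots> \<le> C + C / \<delta> * Q e"
        using c bound[of "r1 m"] Q_nonneg[of e] by (intro add_mono mult_right_mono) auto
      finally show ?thesis .
    qed
    ultimately obtain r2 f where r2: "strict_mono (r2 :: nat \<Rightarrow> nat)" and f: "supported N f"
      and lim: "(\<lambda>m. Q (\<lambda>i. c' (r2 m) i - f i)) \<longlonglongrightarrow> 0"
      using Suc unfolding precompact_def by blast
    define g where "g i = f i + t * e i" for i
    have le: "Q (\<lambda>i. c (r1 (r2 m)) i - g i) \<le> Q (\<lambda>i. c' (r2 m) i - f i) + \<bar>c (r1 (r2 m)) N - t\<bar> * Q e" for m
      by (rule Q_comb) (simp add: c'_def g_def algebra_simps)
    have "(\<lambda>m. c (r1 (r2 m)) N) \<longlonglongrightarrow> t"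
      using LIMSEQ_subseq_LIMSEQ[OF t r2] by (simp add: comp_def)
    then have "(\<lambda>m. \<bar>c (r1 (r2 m)) N - t\<bar> * Q e) \<longlonglongrightarrow> \<bar>t - t\<bar> * Q e"
      by (intro tendsto_intros)
    from tendsto_add[OF lim this] have "(\<lambda>m. Q (\<lambda>i. c' (r2 m) i - f i) + \<bar>c (r1 (r2 m)) N - t\<bar> * Q e) \<longlonglongrightarrow> 0"
      by simp
    then have "(\<lambda>m. Q (\<lambda>i. c (r1 (r2 m)) i - g i)) \<longlonglongrightarrow> 0"
    proof (rule Lim_null_comparison[rotated])
      show "\<forall>\<^sub>F m in sequentially. norm (Q (\<lambda>i. c (r1 (r2 m)) i - g i))
          \<le> Q (\<lambda>i. c' (r2 m) i - f i) + \<bar>c (r1 (r2 m)) N - t\<bar> * Q e"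
        using le Q_nonneg by (intro always_eventually allI) simp
    qed
    moreover have "supported (Suc N) g" using f by (simp add: supported_def g_def e_def)
    moreover have "strict_mono (\<lambda>m. r1 (r2 m))" using strict_mono_o[OF r1 r2] by (simp add: comp_def)
    ultimately show ?thesis by (intro exI[of _ "\<lambda>m. r1 (r2 m)"] exI[of _ g]) auto
  qed
  then show ?case unfolding precompact_def by blast
qed

lemma minimizer_exists: "\<exists>c. supported N c \<and> (\<forall>c'. supported N c' \<longrightarrow> Q (\<lambda>i. v i - c i) \<le> Q (\<lambda>i. v i - c' i))"
  by (rule precompact_minimizer[OF precompact_all])

end

section \<open>Minimal residuals\<close>

text \<open>Spaces of representatives: \<open>nrm\<close> vanishes on the representatives of zero.\<close>

locale seminormed_functions =
  fixes V :: "('a \<Rightarrow> real) set" and nrm :: "('a \<Rightarrow> real) \<Rightarrow> real"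
  assumes V_add: "u \<in> V \<Longrightarrow> v \<in> V \<Longrightarrow> (\<lambda>x. u x + v x) \<in> V"
    and V_cmult: "u \<in> V \<Longrightarrow> (\<lambda>x. a * u x) \<in> V"
    and nrm_nonneg: "0 \<le> nrm u"
    and nrm_triangle: "u \<in> V \<Longrightarrow> v \<in> V \<Longrightarrow> nrm (\<lambda>x. u x + v x) \<le> nrm u + nrm v"
    and nrm_cmult: "u \<in> V \<Longrightarrow> nrm (\<lambda>x. a * u x) = \<bar>a\<bar> * nrm u"
    and nonzero_nonempty: "nonzero V nrm \<noteq> {}"
begin

lemma V_diff: "u \<in> V \<Longrightarrow> v \<in> V \<Longrightarrow> (\<lambda>x. u x - v x) \<in> V"
  using V_add[OF _ V_cmult[of v "-1"], of u] by simp

lemma nrm_diff_commute: "u \<in> V \<Longrightarrow> v \<in> V \<Longrightarrow> nrm (\<lambda>x. u x - v x) = nrm (\<lambda>x. v x - u x)"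
  using nrm_cmult[OF V_diff[of u v], of "-1"] by simp

lemma nrm_diff_triangle:
  assumes "u \<in> V" "v \<in> V" "w \<in> V"
  shows "nrm (\<lambda>x. u x - w x) \<le> nrm (\<lambda>x. u x - v x) + nrm (\<lambda>x. v x - w x)"
  using nrm_triangle[OF V_diff[OF assms(1,2)] V_diff[OF assms(2,3)]] by simp

lemma nonzeroD: "v \<in> nonzero V nrm \<Longrightarrow> v \<in> V \<and> 0 < nrm v"
  using nrm_nonneg[of v] by (auto simp: nonzero_def)

lemma lin_comb_in_V:
  assumes "\<forall>n<N. u n \<in> V"
  shows "lin_comb N c u \<in> V"
  using assms
proof (induction N)
  case 0
  obtain v where "v \<in> V" using nonzero_nonempty nonzeroD by blast
  from V_cmult[OF this, of 0] show ?case by (simp add: lin_comb_def)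
next
  case (Suc N)
  then have "(\<lambda>x. lin_comb N c u x + c N * u N x) \<in> V" by (intro V_add V_cmult) auto
  then show ?case by (simp add: lin_comb_def)
qed

lemma dual_norm_upper:
  assumes l: "l \<in> dual_space V nrm" and v: "v \<in> V"
  shows "\<bar>l v\<bar> \<le> dual_norm V nrm l * nrm v"
proof -
  obtain C where C: "\<And>v. v \<in> V \<Longrightarrow> \<bar>l v\<bar> \<le> C * nrm v" using l by (auto simp: dual_space_def)
  show ?thesis
  proof (cases "nrm v = 0")
    case True
    then show ?thesis using C[OF v] by simp
  next
    case False
    then have v': "v \<in> nonzero V nrm" "0 < nrm v" using v nrm_nonneg[of v] by (auto simp: nonzero_def)
    have "bdd_above ((\<lambda>v. \<bar>l v\<bar> / nrm v) ` nonzero V nrm)"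
      using C nonzeroD by (intro bdd_aboveI[of _ C]) (auto simp: pos_divide_le_eq)
    then have "\<bar>l v\<bar> / nrm v \<le> dual_norm V nrm l"
      unfolding dual_norm_def by (rule cSUP_upper[OF v'(1)])
    then show ?thesis using v'(2) by (simp add: pos_divide_le_eq)
  qed
qed

lemma dual_norm_least:
  assumes "\<And>v. v \<in> V \<Longrightarrow> \<bar>l v\<bar> \<le> C * nrm v"
  shows "dual_norm V nrm l \<le> C"
  unfolding dual_norm_def
proof (rule cSUP_least[OF nonzero_nonempty])
  fix v assume "v \<in> nonzero V nrm"
  then have "v \<in> V" "0 < nrm v" using nonzeroD by blast+
  then show "\<bar>l v\<bar> / nrm v \<le> C" using assms[of v] by (simp add: pos_divide_le_eq)
qed

lemma dual_norm_nonneg: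
  assumes "l \<in> dual_space V nrm"
  shows "0 \<le> dual_norm V nrm l"
proof -
  obtain v where v: "v \<in> V" "0 < nrm v" using nonzero_nonempty nonzeroD by blast
  have "0 \<le> dual_norm V nrm l * nrm v" using dual_norm_upper[OF assms v(1)] by linarith
  then show ?thesis using v(2) by (simp add: zero_le_mult_iff)
qed

lemma dual_norm_cong:
  assumes "\<And>v. v \<in> V \<Longrightarrow> l v = l' v"
  shows "dual_norm V nrm l = dual_norm V nrm l'"
  unfolding dual_norm_def using assms nonzeroD by (intro SUP_cong) auto

end

text \<open>The residual of \<open>u\<close> is \<open>q (u - w)\<close> for the solution \<open>w\<close>,
  and the two stability constants make the seminorm \<open>q\<close> equivalent to
  \<open>nrm\<close>.\<close>

locale inf_sup_problem = seminormed_functions V nrm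
  for V :: "('a \<Rightarrow> real) set" and nrm :: "('a \<Rightarrow> real) \<Rightarrow> real" +
  fixes T :: "('a \<Rightarrow> real) \<Rightarrow> ('a \<Rightarrow> real) \<Rightarrow> real" and l :: "('a \<Rightarrow> real) \<Rightarrow> real"
    and w :: "'a \<Rightarrow> real" and \<gamma> \<theta> :: real
  assumes T: "bounded_operator_to_dual V nrm T" and \<gamma>: "0 < \<gamma>" "\<gamma> \<le> \<theta>"
    and sup: "(SUP u\<in>nonzero V nrm. SUP v\<in>nonzero V nrm. ereal (\<bar>T u v\<bar> / (nrm u * nrm v))) \<le> ereal \<theta>"
    and infsup: "(INF u\<in>nonzero V nrm. SUP v\<in>nonzero V nrm. ereal (\<bar>T u v\<bar> / (nrm u * nrm v))) \<ge> ereal \<gamma>"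
    and w: "w \<in> V" and solves: "\<And>v. v \<in> V \<Longrightarrow> T w v = l v"
begin

abbreviation q :: "('a \<Rightarrow> real) \<Rightarrow> real" where "q u \<equiv> dual_norm V nrm (T u)"

lemma T_dual: "u \<in> V \<Longrightarrow> T u \<in> dual_space V nrm"
  using T by (simp add: bounded_operator_to_dual_def)

lemma T_add: "u \<in> V \<Longrightarrow> u' \<in> V \<Longrightarrow> v \<in> V \<Longrightarrow> T (\<lambda>x. u x + u' x) v = T u v + T u' v"
  using T by (simp add: bounded_operator_to_dual_def linear_functional_on_def)

lemma T_cmult: "u \<in> V \<Longrightarrow> v \<in> V \<Longrightarrow> T (\<lambda>x. a * u x) v = a * T u v"
  using T by (simp add: bounded_operator_to_dual_def linear_functional_on_def)

lemma T_diff: "u \<in> V \<Longrightarrow> u' \<in> V \<Longrightarrow> v \<in> V \<Longrightarrow> T (\<lambda>x. u x - u' x) v = T u v - T u' v"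
  using T_add[OF _ V_cmult[of u' "-1"], of u v] T_cmult[of u' v "-1"] by simp

lemma q_nonneg: "u \<in> V \<Longrightarrow> 0 \<le> q u"
  by (intro dual_norm_nonneg T_dual)

lemma q_triangle:
  assumes "u \<in> V" "u' \<in> V"
  shows "q (\<lambda>x. u x + u' x) \<le> q u + q u'"
proof (rule dual_norm_least)
  fix v assume v: "v \<in> V"
  have "\<bar>T u v + T u' v\<bar> \<le> q u * nrm v + q u' * nrm v"
    using dual_norm_upper[OF T_dual[OF assms(1)] v] dual_norm_upper[OF T_dual[OF assms(2)] v] by linarith
  then show "\<bar>T (\<lambda>x. u x + u' x) v\<bar> \<le> (q u + q u') * nrm v"
    using T_add[OF assms v] by (simp add: distrib_right)
qed

lemma q_cmult:
  assumes "u \<in> V"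
  shows "q (\<lambda>x. a * u x) \<le> \<bar>a\<bar> * q u"
proof (rule dual_norm_least)
  fix v assume v: "v \<in> V"
  have "\<bar>a\<bar> * \<bar>T u v\<bar> \<le> \<bar>a\<bar> * (q u * nrm v)"
    using dual_norm_upper[OF T_dual[OF assms] v] by (intro mult_left_mono) auto
  then show "\<bar>T (\<lambda>x. a * u x) v\<bar> \<le> \<bar>a\<bar> * q u * nrm v"
    using T_cmult[OF assms v] by (simp add: abs_mult mult.assoc)
qed

lemma q_upper:
  assumes u: "u \<in> V"
  shows "q u \<le> \<theta> * nrm u"
proof (cases "nrm u = 0")
  case True
  obtain C where "\<And>u. u \<in> V \<Longrightarrow> q u \<le> C * nrm u" using T by (auto simp: bounded_operator_to_dual_def)
  from this[OF u] True show ?thesis by simp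
next
  case False
  then have u': "u \<in> nonzero V nrm" "0 < nrm u" using u nrm_nonneg[of u] by (auto simp: nonzero_def)
  show ?thesis
  proof (rule dual_norm_least)
    fix v assume v: "v \<in> V"
    show "\<bar>T u v\<bar> \<le> \<theta> * nrm u * nrm v"
    proof (cases "nrm v = 0")
      case True
      then show ?thesis using dual_norm_upper[OF T_dual[OF u] v] by simp
    next
      case False
      then have v': "v \<in> nonzero V nrm" "0 < nrm v" using v nrm_nonneg[of v] by (auto simp: nonzero_def)
      have "ereal (\<bar>T u v\<bar> / (nrm u * nrm v)) \<le> (SUP v\<in>nonzero V nrm. ereal (\<bar>T u v\<bar> / (nrm u * nrm v)))"
        by (rule SUP_upper[OF v'(1)])
      also have "\<dots> \<le> (SUP u\<in>nonzero V nrm. SUP v\<in>nonzero V nrm. ereal (\<bar>T u v\<bar> / (nrm u * nrm v)))"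
        by (rule SUP_upper[OF u'(1)])
      also note sup
      finally have "\<bar>T u v\<bar> / (nrm u * nrm v) \<le> \<theta>" by simp
      then show ?thesis using u'(2) v'(2) by (simp add: pos_divide_le_eq mult.assoc)
    qed
  qed
qed

lemma q_lower:
  assumes u: "u \<in> V"
  shows "\<gamma> * nrm u \<le> q u"
proof (cases "nrm u = 0")
  case True
  then show ?thesis using q_nonneg[OF u] by simp
next
  case False
  then have u': "u \<in> nonzero V nrm" "0 < nrm u" using u nrm_nonneg[of u] by (auto simp: nonzero_def)
  note infsup
  also have "(INF u\<in>nonzero V nrm. SUP v\<in>nonzero V nrm. ereal (\<bar>T u v\<bar> / (nrm u * nrm v)))
     \<le> (SUP v\<in>nonzero V nrm. ereal (\<bar>T u v\<bar> / (nrm u * nrm v)))"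
    by (rule INF_lower[OF u'(1)])
  also have "\<dots> \<le> ereal (q u / nrm u)"
  proof (rule SUP_least)
    fix v assume "v \<in> nonzero V nrm"
    then have v: "v \<in> V" "0 < nrm v" using nonzeroD by blast+
    have "\<bar>T u v\<bar> / (nrm u * nrm v) \<le> (q u * nrm v) / (nrm u * nrm v)"
      using dual_norm_upper[OF T_dual[OF u] v(1)] u'(2) v(2) by (intro divide_right_mono) auto
    then show "ereal (\<bar>T u v\<bar> / (nrm u * nrm v)) \<le> ereal (q u / nrm u)"
      using v(2) by simp
  qed
  finally have "\<gamma> \<le> q u / nrm u" by simp
  then show ?thesis using u'(2) by (simp add: pos_le_divide_eq)
qed

abbreviation residual :: "('a \<Rightarrow> real) \<Rightarrow> real" where
  "residual u \<equiv> dual_norm V nrm (\<lambda>v. T u v - l v)"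

lemma residual_eq: "u \<in> V \<Longrightarrow> residual u = q (\<lambda>x. u x - w x)"
  by (rule dual_norm_cong) (simp add: T_diff w solves)

lemma residual_nonneg: "u \<in> V \<Longrightarrow> 0 \<le> residual u"
  by (simp add: residual_eq q_nonneg V_diff w)

lemma residual_minimizer_iff:
  assumes u: "\<forall>n<N. u n \<in> V"
  shows "is_residual_minimizer V nrm T l N u c \<longleftrightarrow> (\<forall>c'. residual (lin_comb N c u) \<le> residual (lin_comb N c' u))"
  unfolding is_residual_minimizer_def is_arg_min_def
  using residual_nonneg[OF lin_comb_in_V[OF u]]
  by (auto simp: not_less abs_le_square_iff[symmetric])

text \<open>Appending \<open>w\<close> to the functions \<open>u n\<close> turns the residual into a distance
  between coefficient vectors in a seminorm: that of the unit vector belonging to \<open>w\<close>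
  from the vectors supported below \<open>N\<close>.\<close>

lemma residual_minimizer_exists:
  assumes u: "\<forall>n<N. u n \<in> V"
  shows "\<exists>c. is_residual_minimizer V nrm T l N u c"
proof -
  let ?w = "u(N := w)"
  have wV: "\<forall>n<Suc N. ?w n \<in> V" using u w by auto
  note LV = lin_comb_in_V[of "Suc N" ?w, OF wV]
  define Q where "Q c = q (lin_comb (Suc N) c ?w)" for c
  interpret coefficient_seminorm Q
  proof
    fix c d :: "nat \<Rightarrow> real" and a :: real
    show "0 \<le> Q c" unfolding Q_def by (rule q_nonneg[OF LV])
    have "lin_comb (Suc N) (\<lambda>i. c i + d i) ?w = (\<lambda>x. lin_comb (Suc N) c ?w x + lin_comb (Suc N) d ?w x)"
      by (simp only: lin_comb_def sum.distrib distrib_right)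
    then show "Q (\<lambda>i. c i + d i) \<le> Q c + Q d"
      unfolding Q_def using q_triangle[OF LV[of c] LV[of d]] by simp
    have "lin_comb (Suc N) (\<lambda>i. a * c i) ?w = (\<lambda>x. a * lin_comb (Suc N) c ?w x)"
      by (simp only: lin_comb_def sum_distrib_left mult.assoc)
    then show "Q (\<lambda>i. a * c i) \<le> \<bar>a\<bar> * Q c"
      unfolding Q_def using q_cmult[OF LV[of c], of a] by simp
  qed
  define v :: "nat \<Rightarrow> real" where "v i = (if i = N then 1 else 0)" for i
  have Qv: "Q (\<lambda>i. v i - c i) = residual (lin_comb N c u)" if "supported N c" for c
  proof -
    have "lin_comb (Suc N) (\<lambda>i. v i - c i) ?w x = w x - lin_comb N c u x" for x
      using that by (simp add: lin_comb_def v_def supported_def sum_negf)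
    then have "lin_comb (Suc N) (\<lambda>i. v i - c i) ?w = (\<lambda>x. w x - lin_comb N c u x)" by auto
    then have Q: "Q (\<lambda>i. v i - c i) = q (\<lambda>x. w x - lin_comb N c u x)" by (simp add: Q_def)
    have L: "lin_comb N c u \<in> V" by (rule lin_comb_in_V[OF u])
    have "q (\<lambda>x. w x - lin_comb N c u x) \<le> q (\<lambda>x. lin_comb N c u x - w x)"
      using q_cmult[OF V_diff[OF L w], of "-1"] by simp
    moreover have "q (\<lambda>x. lin_comb N c u x - w x) \<le> q (\<lambda>x. w x - lin_comb N c u x)"
      using q_cmult[OF V_diff[OF w L], of "-1"] by simp
    ultimately show ?thesis unfolding Q residual_eq[OF L] by simp
  qed
  obtain c where c: "supported N c" "\<And>c'. supported N c' \<Longrightarrow> Q (\<lambda>i. v i - c i) \<le> Q (\<lambda>i. v i - c' i)"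
    using minimizer_exists by blast
  have "residual (lin_comb N c u) \<le> residual (lin_comb N c' u)" for c'
  proof -
    define c'' where "c'' i = (if i < N then c' i else 0)" for i
    have s: "supported N c''" by (simp add: supported_def c''_def)
    have "lin_comb N c' u = lin_comb N c'' u"
      by (auto simp: lin_comb_def c''_def intro!: sum.cong)
    with c(2)[OF s] show ?thesis by (simp add: Qv c(1) s)
  qed
  then show ?thesis using residual_minimizer_iff[OF u] by blast
qed

text \<open>The residual of the minimizer is at most that of any competitor \<open>y\<close>, and residuals
  compare with errors by the two stability constants.\<close>

lemma quasi_optimal:
  assumes u: "\<forall>n<N. u n \<in> V" and c: "is_residual_minimizer V nrm T l N u c"
  shows "residual (lin_comb N c u) \<le> \<theta> * nrm (\<lambda>x. lin_comb N y u x - w x)"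
    and "nrm (\<lambda>x. lin_comb N c u x - w x) \<le> \<theta> / \<gamma> * nrm (\<lambda>x. lin_comb N y u x - w x)"
proof -
  have L: "lin_comb N c u \<in> V" for c by (rule lin_comb_in_V[OF u])
  have "residual (lin_comb N c u) \<le> residual (lin_comb N y u)"
    using c residual_minimizer_iff[OF u] by blast
  also have "\<dots> \<le> \<theta> * nrm (\<lambda>x. lin_comb N y u x - w x)"
    unfolding residual_eq[OF L] by (rule q_upper[OF V_diff[OF L w]])
  finally show r: "residual (lin_comb N c u) \<le> \<theta> * nrm (\<lambda>x. lin_comb N y u x - w x)" .
  have "\<gamma> * nrm (\<lambda>x. lin_comb N c u x - w x) \<le> residual (lin_comb N c u)"
    unfolding residual_eq[OF L] by (rule q_lower[OF V_diff[OF L w]])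
  with r have "\<gamma> * nrm (\<lambda>x. lin_comb N c u x - w x) \<le> \<theta> * nrm (\<lambda>x. lin_comb N y u x - w x)" by linarith
  then show "nrm (\<lambda>x. lin_comb N c u x - w x) \<le> \<theta> / \<gamma> * nrm (\<lambda>x. lin_comb N y u x - w x)"
    using \<gamma> by (simp add: field_simps)
qed

end

section \<open>Networks with one layer\<close>

lemma sigmoid_sums_finite:
  "f \<in> sigmoid_sums \<Longrightarrow> \<exists>S a. finite S \<and> f = (\<lambda>x. \<Sum>z\<in>S. a z * sigmoid (fst z \<bullet> x + snd z))"
proof (induction rule: sigmoid_sums.induct)
  case (sig c w b)
  show ?case by (rule exI[of _ "{(w, b)}"], rule exI[of _ "\<lambda>_. c"]) simp
next
  case (add f g)
  obtain S a where S: "finite S" "f = (\<lambda>x. \<Sum>z\<in>S. a z * sigmoid (fst z \<bullet> x + snd z))" using add.IH by blast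
  obtain S' a' where S': "finite S'" "g = (\<lambda>x. \<Sum>z\<in>S'. a' z * sigmoid (fst z \<bullet> x + snd z))" using add.IH by blast
  let ?a = "\<lambda>z. (if z \<in> S then a z else 0) + (if z \<in> S' then a' z else 0)"
  have "f x + g x = (\<Sum>z\<in>S \<union> S'. ?a z * sigmoid (fst z \<bullet> x + snd z))" for x
  proof -
    have "(\<Sum>z\<in>S. a z * sigmoid (fst z \<bullet> x + snd z)) = (\<Sum>z\<in>S \<union> S'. (if z \<in> S then a z else 0) * sigmoid (fst z \<bullet> x + snd z))"
      using S(1) S'(1) by (intro sum.mono_neutral_cong_left) auto
    moreover have "(\<Sum>z\<in>S'. a' z * sigmoid (fst z \<bullet> x + snd z)) = (\<Sum>z\<in>S \<union> S'. (if z \<in> S' then a' z else 0) * sigmoid (fst z \<bullet> x + snd z))"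
      using S(1) S'(1) by (intro sum.mono_neutral_cong_left) auto
    ultimately show ?thesis by (simp add: S(2) S'(2) distrib_right sum.distrib)
  qed
  then show ?case using S(1) S'(1) by (intro exI[of _ "S \<union> S'"] exI[of _ ?a]) auto
qed

text \<open>Depth one suffices: the activation is applied in the last layer as well, so the components of a
  single layer are already the sigmoid units.\<close>

lemma one_layer_network:
  fixes h :: "nat \<Rightarrow> (real^'n) \<times> real"
  assumes "1 \<le> N"
  shows "neural_network N (\<lambda>n x. sigmoid (fst (h n) \<bullet> x + snd (h n)))"
proof -
  let ?W = "\<lambda>k. if k = 0 then CARD('n) else N"
  let ?A = "\<lambda>k i j. fst (h i) $ from_nat_into UNIV j" and ?b = "\<lambda>k i. snd (h i)"
  have "(\<Sum>j<CARD('n). w $ from_nat_into UNIV j * x $ from_nat_into UNIV j) = w \<bullet> x" for w x :: "real^'n"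
  proof -
    have "bij_betw (from_nat_into UNIV) {..<CARD('n)} (UNIV :: 'n set)"
      by (rule bij_betw_from_nat_into_finite) simp
    from sum.reindex_bij_betw[OF this, of "\<lambda>i. w $ i * x $ i"] show ?thesis
      by (simp add: inner_vec_def)
  qed
  then have "sigmoid (fst (h n) \<bullet> x + snd (h n)) = nn_layer ?W ?A ?b 1 x n" for n x
    by (simp add: One_nat_def)
  moreover have "1 \<le> CARD('n)" by (simp add: Suc_le_eq)
  ultimately show ?thesis
    unfolding neural_network_def using assms
    by (intro exI[of _ 1] exI[of _ ?W] exI[of _ ?A] exI[of _ ?b]) auto
qed

text \<open>The units of finitely many sums are collected into one network; each sum gets coefficient
  \<open>0\<close> at the units of the others. The additional unit \<open>(0, 0)\<close> keeps the
  width positive.\<close>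

lemma common_network:
  fixes s :: "'i \<Rightarrow> real^'n \<Rightarrow> real"
  assumes F: "finite F" and s: "\<And>i. i \<in> F \<Longrightarrow> s i \<in> sigmoid_sums"
  shows "\<exists>N u y. 1 \<le> N \<and> neural_network N u \<and> (\<forall>n. smooth (u n)) \<and> (\<forall>i\<in>F. s i = lin_comb N (y i) u)"
proof -
  define R where "R i Sa \<longleftrightarrow> finite (fst Sa) \<and> s i = (\<lambda>x. \<Sum>z\<in>fst Sa. snd Sa z * sigmoid (fst z \<bullet> x + snd z))" for i Sa
  have "\<exists>Sa. R i Sa" if "i \<in> F" for i
    using sigmoid_sums_finite[OF s[OF that]] by (auto simp: R_def)
  then obtain Sa where Sa: "\<And>i. i \<in> F \<Longrightarrow> R i (Sa i)"
    by metis
  define S a where "S i = fst (Sa i)" and "a i = snd (Sa i)" for i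
  have S: "\<And>i. i \<in> F \<Longrightarrow> finite (S i)"
    "\<And>i. i \<in> F \<Longrightarrow> s i = (\<lambda>x. \<Sum>z\<in>S i. a i z * sigmoid (fst z \<bullet> x + snd z))"
    using Sa by (simp_all add: R_def S_def a_def)
  define Z where "Z = insert (0, 0) (\<Union>i\<in>F. S i)"
  have Z: "finite Z" using F S(1) by (simp add: Z_def)
  define N where "N = card Z"
  have N: "1 \<le> N" using Z by (simp add: N_def Z_def Suc_le_eq card_gt_0_iff)
  obtain h where "bij_betw h {0..<N} Z" using ex_bij_betw_nat_finite[OF Z] by (auto simp: N_def)
  then have h: "bij_betw h {..<N} Z" by (simp add: atLeast0LessThan)
  define u where "u n x = sigmoid (fst (h n) \<bullet> x + snd (h n))" for n x
  define y where "y i n = (if h n \<in> S i then a i (h n) else 0)" for i n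
  have "s i = lin_comb N (y i) u" if i: "i \<in> F" for i
  proof
    fix x
    have "lin_comb N (y i) u x = (\<Sum>z\<in>Z. (if z \<in> S i then a i z else 0) * sigmoid (fst z \<bullet> x + snd z))"
      unfolding lin_comb_def y_def u_def
      using sum.reindex_bij_betw[OF h, of "\<lambda>z. (if z \<in> S i then a i z else 0) * sigmoid (fst z \<bullet> x + snd z)"] .
    also have "\<dots> = (\<Sum>z\<in>S i. a i z * sigmoid (fst z \<bullet> x + snd z))"
      using Z i by (intro sum.mono_neutral_cong_right) (auto simp: Z_def)
    finally show "s i x = lin_comb N (y i) u x" by (simp add: S(2)[OF i])
  qed
  moreover have "neural_network N u"
    using one_layer_network[OF N, of h] by (simp add: u_def[abs_def])
  moreover have "smooth (u n)" for n
    unfolding u_def[abs_def] by (rule smooth_sigmoid)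
  ultimately show ?thesis using N by blast
qed

section \<open>The approximation theorem\<close>

lemma lipschitz_domain_seminormed:
  assumes \<Omega>: "bounded_lipschitz_domain \<Omega>"
  shows "seminormed_functions (sobolev k \<Omega>) (sobolev_norm k \<Omega>)"
proof -
  interpret bounded_open_set \<Omega>
    using \<Omega> by unfold_locales (auto simp: bounded_lipschitz_domain_def)
  have one: "smooth (\<lambda>x :: real^'a. 1)" by (rule smooth_const)
  have "sobolev_norm k \<Omega> (\<lambda>x. 1) \<noteq> 0"
  proof
    assume 0: "sobolev_norm k \<Omega> (\<lambda>x. 1) = 0"
    let ?w = "\<lambda>\<alpha>. fold partial_deriv (rev (word \<alpha>)) (\<lambda>x :: real^'a. 1)"
    have "sobolev_norm k \<Omega> (\<lambda>x. 1) = L2_set (\<lambda>\<alpha>. sqrt (\<integral>x. (?w \<alpha> x)\<^sup>2 \<partial>lebesgue_on \<Omega>)) {\<alpha>. sum \<alpha> UNIV \<le> k}"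
      by (intro sobolev_norm_eq smooth_in_sobolev one conjI smooth_in_L2 smooth_fold_partial smooth_is_weak_deriv)
    with 0 have "\<forall>\<alpha>\<in>{\<alpha>. sum \<alpha> UNIV \<le> k}. sqrt (\<integral>x. (?w \<alpha> x)\<^sup>2 \<partial>lebesgue_on \<Omega>) = 0"
      by (simp add: L2_set_eq_0_iff finite_multi_indices)
    then have "sqrt (\<integral>x. (?w (\<lambda>_. 0) x)\<^sup>2 \<partial>lebesgue_on \<Omega>) = 0" by simp
    moreover have "word (\<lambda>_ :: 'a. 0) = []" using length_word[of "\<lambda>_ :: 'a. 0"] by simp
    ultimately have "measure (lebesgue_on \<Omega>) \<Omega> = 0" by simp
    then have "measure lebesgue \<Omega> = 0"
      using open_\<Omega> by (simp add: measure_restrict_space)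
    obtain x r where x: "0 < r" "ball x r \<subseteq> \<Omega>"
      using \<Omega> open_contains_ball unfolding bounded_lipschitz_domain_def by blast
    have "measure lebesgue (ball x r) \<le> measure lebesgue \<Omega>"
      using x(2) lmeasurable_open[OF bounded_\<Omega> open_\<Omega>] by (intro measure_mono_fmeasurable) auto
    moreover have "0 < measure lborel (ball x r)" by (rule content_ball_pos[OF x(1)])
    moreover have "measure lebesgue (ball x r) = measure lborel (ball x r)" by simp
    ultimately show False using \<open>measure lebesgue \<Omega> = 0\<close> by linarith
  qed
  then have "nonzero (sobolev k \<Omega>) (sobolev_norm k \<Omega>) \<noteq> {}"
    using smooth_in_sobolev[OF one, of k] by (auto simp: nonzero_def)
  then show ?thesis
    by unfold_locales (auto intro: sobolev_add sobolev_cmult sobolev_norm_nonneg sobolev_norm_triangle sobolev_norm_cmult)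
qed

text \<open>Compactness of \<open>P\<close> reduces the approximation of all \<open>usol p\<close> to that of finitely many.\<close>

lemma uniform_approximation:
  fixes \<Omega> :: "(real^'n) set"
  assumes \<Omega>: "bounded_lipschitz_domain \<Omega>" and P: "compact_space P"
    and us: "\<And>p. p \<in> topspace P \<Longrightarrow> usol p \<in> sobolev k \<Omega>"
    and cont: "continuous_map P (sobolev_topology k \<Omega>) usol" and \<eta>: "0 < \<eta>"
  shows "\<exists>N u. 1 \<le> N \<and> neural_network N u \<and> (\<forall>n. smooth (u n)) \<and>
    (\<forall>p\<in>topspace P. \<exists>y. sobolev_norm k \<Omega> (\<lambda>x. lin_comb N y u x - usol p x) < \<eta>)"
proof -
  interpret bounded_open_set \<Omega>
    using \<Omega> by unfold_locales (auto simp: bounded_lipschitz_domain_def)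
  interpret S: seminormed_functions "sobolev k \<Omega>" "sobolev_norm k \<Omega>"
    by (rule lipschitz_domain_seminormed[OF \<Omega>])
  let ?nrm = "sobolev_norm k \<Omega>"
  define O' where "O' p = {p' \<in> topspace P. usol p' \<in> {w \<in> sobolev k \<Omega>. ?nrm (\<lambda>x. w x - usol p x) < \<eta> / 2}}" for p
  have "openin P (O' p)" if "p \<in> topspace P" for p
  proof -
    have "openin (sobolev_topology k \<Omega>) {w \<in> sobolev k \<Omega>. ?nrm (\<lambda>x. w x - usol p x) < \<eta> / 2}"
      unfolding sobolev_topology_def
    proof (rule topology_generated_by_Basis, rule CollectI, intro exI conjI)
      show "usol p \<in> sobolev k \<Omega>" by (rule us[OF that])
      show "0 < \<eta> / 2" using \<eta> by simp
    qed (rule refl)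
    with cont show ?thesis unfolding O'_def by (rule openin_continuous_map_preimage)
  qed
  moreover have "topspace P \<subseteq> (\<Union>p\<in>topspace P. O' p)"
  proof
    fix p assume p: "p \<in> topspace P"
    have "?nrm (\<lambda>x. 0) = 0" using S.nrm_cmult[OF us[OF p], of 0] by simp
    then have "p \<in> O' p" using p us[OF p] \<eta> by (simp add: O'_def)
    with p show "p \<in> (\<Union>p\<in>topspace P. O' p)" by blast
  qed
  ultimately obtain \<F> where "finite \<F>" "\<F> \<subseteq> O' ` topspace P" "topspace P \<subseteq> \<Union>\<F>"
    using P unfolding compact_space_alt by (metis (mono_tags, lifting) imageE)
  then obtain F where F: "finite F" "F \<subseteq> topspace P" "topspace P \<subseteq> (\<Union>p\<in>F. O' p)"
    by (metis finite_subset_image)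
  have "\<exists>s\<in>sigmoid_sums. ?nrm (\<lambda>x. s x - usol p x) < \<eta> / 2" if "p \<in> F" for p
    using F(2) that \<eta> us by (intro sigmoid_sums_dense lipschitz_uniform_cone[OF \<Omega>]) auto
  then obtain s where s: "\<And>p. p \<in> F \<Longrightarrow> s p \<in> sigmoid_sums" "\<And>p. p \<in> F \<Longrightarrow> ?nrm (\<lambda>x. s p x - usol p x) < \<eta> / 2"
    by metis
  obtain N u y where u: "1 \<le> N" "neural_network N u" "\<And>n. smooth (u n)" "\<And>p. p \<in> F \<Longrightarrow> s p = lin_comb N (y p) u"
    using common_network[of F s, OF F(1) s(1)] by blast
  have "\<exists>y. ?nrm (\<lambda>x. lin_comb N y u x - usol p' x) < \<eta>" if p': "p' \<in> topspace P" for p'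
  proof -
    obtain p where p: "p \<in> F" "?nrm (\<lambda>x. usol p' x - usol p x) < \<eta> / 2"
      using F(3) p' unfolding O'_def by blast
    have V: "s p \<in> sobolev k \<Omega>" "usol p \<in> sobolev k \<Omega>" "usol p' \<in> sobolev k \<Omega>"
      using smooth_in_sobolev[OF smooth_sigmoid_sums[OF s(1)[OF p(1)]]] us p(1) F(2) p' by auto
    have "?nrm (\<lambda>x. s p x - usol p' x) \<le> ?nrm (\<lambda>x. s p x - usol p x) + ?nrm (\<lambda>x. usol p x - usol p' x)"
      by (rule S.nrm_diff_triangle[OF V])
    also have "\<dots> < \<eta>"
      using s(2)[OF p(1)] p(2) S.nrm_diff_commute[OF V(2,3)] by linarith
    finally show ?thesis unfolding u(4)[OF p(1)] by blast
  qed
  with u(1-3) show ?thesis by blast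
qed

theorem theorem2p2:
  fixes \<Omega> :: "(real^'n) set" and k :: nat
    and P :: "'p topology" and M :: "'p measure"
    and B :: "'p \<Rightarrow> (real^'n \<Rightarrow> real) \<Rightarrow> (real^'n \<Rightarrow> real) \<Rightarrow> real"
    and l :: "'p \<Rightarrow> (real^'n \<Rightarrow> real) \<Rightarrow> real"
    and usol :: "'p \<Rightarrow> real^'n \<Rightarrow> real"
    and \<gamma> \<theta> \<epsilon> :: real
  defines "U \<equiv> sobolev k \<Omega>" and "nrm \<equiv> sobolev_norm k \<Omega>"
  assumes "bounded_lipschitz_domain \<Omega>"
    and "compact_space P" and "prob_space M" and "space M = topspace P"
    and "\<And>p. p \<in> topspace P \<Longrightarrow> bounded_operator_to_dual U nrm (B p)"
    and "\<And>p. p \<in> topspace P \<Longrightarrow> l p \<in> dual_space U nrm"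
    and "0 < \<gamma>" and "\<gamma> \<le> \<theta>"
    and "\<And>p. p \<in> topspace P \<Longrightarrow>
      (SUP u\<in>nonzero U nrm. SUP v\<in>nonzero U nrm. ereal (\<bar>B p u v\<bar> / (nrm u * nrm v))) \<le> ereal \<theta>"
    and "\<And>p. p \<in> topspace P \<Longrightarrow>
      (INF u\<in>nonzero U nrm. SUP v\<in>nonzero U nrm. ereal (\<bar>B p u v\<bar> / (nrm u * nrm v))) \<ge> ereal \<gamma>"
    and "\<And>p. p \<in> topspace P \<Longrightarrow> usol p \<in> U"
    and "\<And>p v. p \<in> topspace P \<Longrightarrow> v \<in> U \<Longrightarrow> B p (usol p) v = l p v"
    and "usol \<in> measurable (completion M) (sigma U {S. openin (sobolev_topology k \<Omega>) S})"
    and "continuous_map P (sobolev_topology k \<Omega>) usol"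
    and "0 < \<epsilon>"
  shows "\<exists>N u. 1 \<le> N \<and> neural_network N u \<and> (\<forall>n<N. u n \<in> U) \<and>
    (\<forall>p\<in>topspace P. \<exists>c. is_residual_minimizer U nrm (B p) (l p) N u c) \<and>
    (\<forall>c. (\<forall>p\<in>topspace P. is_residual_minimizer U nrm (B p) (l p) N u (c p)) \<longrightarrow>
      (\<integral>\<^sup>+p. ennreal ((nrm (\<lambda>x. lin_comb N (c p) u x - usol p x))\<^sup>2) \<partial>M) < ennreal \<epsilon> \<and>
      (\<integral>\<^sup>+p. ennreal ((dual_norm U nrm (\<lambda>v. B p (lin_comb N (c p) u) v - l p v))\<^sup>2) \<partial>M) < ennreal \<epsilon>)"
proof -
  note \<Omega> = assms(3) and sol = assms(13) and \<gamma> = assms(9) and \<theta> = assms(10) and \<epsilon> = assms(17)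
  interpret bounded_open_set \<Omega>
    using \<Omega> by unfold_locales (auto simp: bounded_lipschitz_domain_def)
  interpret S: seminormed_functions U nrm
    unfolding U_def nrm_def by (rule lipschitz_domain_seminormed[OF \<Omega>])
  interpret M: prob_space M by (rule assms(5))
  have problem: "inf_sup_problem U nrm (B p) (l p) (usol p) \<gamma> \<theta>" if "p \<in> topspace P" for p
    by unfold_locales (use assms(7,9-14) that in auto)
  \<comment> \<open>Half of \<open>\<epsilon>\<close> keeps the final inequalities strict.\<close>
  define \<sigma> where "\<sigma> = sqrt (\<epsilon> / 2)"
  have \<sigma>: "0 < \<sigma>" "\<sigma>\<^sup>2 = \<epsilon> / 2" using \<epsilon> by (auto simp: \<sigma>_def)
  have \<theta>0: "0 < \<theta>" using \<gamma> \<theta> by linarith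
  \<comment> \<open>With this distance to the span, residual and error of the minimizers are at most \<open>\<sigma>\<close>.\<close>
  define \<eta> where "\<eta> = min (\<sigma> / \<theta>) (\<sigma> * \<gamma> / \<theta>)"
  have \<eta>: "0 < \<eta>" "\<theta> * \<eta> \<le> \<sigma>" "\<theta> / \<gamma> * \<eta> \<le> \<sigma>"
  proof -
    show "0 < \<eta>" using \<sigma> \<theta>0 \<gamma> by (simp add: \<eta>_def)
    have "\<theta> * \<eta> \<le> \<theta> * (\<sigma> / \<theta>)" using \<theta>0 by (intro mult_left_mono) (auto simp: \<eta>_def)
    then show "\<theta> * \<eta> \<le> \<sigma>" using \<theta>0 by simp
    have "\<theta> / \<gamma> * \<eta> \<le> \<theta> / \<gamma> * (\<sigma> * \<gamma> / \<theta>)" using \<theta>0 \<gamma> by (intro mult_left_mono) (auto simp: \<eta>_def)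
    then show "\<theta> / \<gamma> * \<eta> \<le> \<sigma>" using \<theta>0 \<gamma> by simp
  qed
  have "\<exists>N u. 1 \<le> N \<and> neural_network N u \<and> (\<forall>n. smooth (u n)) \<and>
    (\<forall>p\<in>topspace P. \<exists>y. sobolev_norm k \<Omega> (\<lambda>x. lin_comb N y u x - usol p x) < \<eta>)"
    by (rule uniform_approximation[OF \<Omega> assms(4) sol[unfolded U_def] assms(16) \<eta>(1)])
  then obtain N u where N: "1 \<le> N" "neural_network N u" and u: "\<And>n. smooth (u n)"
    and y: "\<And>p. p \<in> topspace P \<Longrightarrow> \<exists>y. nrm (\<lambda>x. lin_comb N y u x - usol p x) < \<eta>"
    unfolding nrm_def by blast
  have uU: "\<forall>n<N. u n \<in> U" unfolding U_def by (intro allI impI smooth_in_sobolev u)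
  have small: "(\<integral>\<^sup>+p. ennreal ((f p)\<^sup>2) \<partial>M) < ennreal \<epsilon>"
    if f: "\<And>p. p \<in> topspace P \<Longrightarrow> 0 \<le> f p \<and> f p \<le> \<sigma>" for f
  proof -
    have "(\<integral>\<^sup>+p. ennreal ((f p)\<^sup>2) \<partial>M) \<le> (\<integral>\<^sup>+p. ennreal (\<epsilon> / 2) \<partial>M)"
    proof (rule nn_integral_mono)
      fix p assume "p \<in> space M"
      then have "(f p)\<^sup>2 \<le> \<sigma>\<^sup>2" using f[of p] assms(6) by (intro power_mono) auto
      then show "ennreal ((f p)\<^sup>2) \<le> ennreal (\<epsilon> / 2)" unfolding \<sigma>(2) by (rule ennreal_leI)
    qed
    also have "\<dots> = ennreal (\<epsilon> / 2)" by (simp add: M.emeasure_space_1)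
    also have "\<dots> < ennreal \<epsilon>" using \<epsilon> by (intro ennreal_lessI) auto
    finally show ?thesis .
  qed
  have bounds: "nrm (\<lambda>x. lin_comb N c u x - usol p x) \<le> \<sigma>"
    "dual_norm U nrm (\<lambda>v. B p (lin_comb N c u) v - l p v) \<le> \<sigma>"
    "0 \<le> dual_norm U nrm (\<lambda>v. B p (lin_comb N c u) v - l p v)"
    if p: "p \<in> topspace P" and c: "is_residual_minimizer U nrm (B p) (l p) N u c" for p c
  proof -
    interpret I: inf_sup_problem U nrm "B p" "l p" "usol p" \<gamma> \<theta> by (rule problem[OF p])
    obtain y where y: "nrm (\<lambda>x. lin_comb N y u x - usol p x) < \<eta>" using y[OF p] by blast
    have "\<theta> / \<gamma> * nrm (\<lambda>x. lin_comb N y u x - usol p x) \<le> \<theta> / \<gamma> * \<eta>"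
      using y \<theta>0 \<gamma> by (intro mult_left_mono) auto
    then show "nrm (\<lambda>x. lin_comb N c u x - usol p x) \<le> \<sigma>"
      using I.quasi_optimal(2)[OF uU c, of y] \<eta>(3) by linarith
    have "\<theta> * nrm (\<lambda>x. lin_comb N y u x - usol p x) \<le> \<theta> * \<eta>"
      using y \<theta>0 by (intro mult_left_mono) auto
    then show "dual_norm U nrm (\<lambda>v. B p (lin_comb N c u) v - l p v) \<le> \<sigma>"
      using I.quasi_optimal(1)[OF uU c, of y] \<eta>(2) by linarith
    show "0 \<le> dual_norm U nrm (\<lambda>v. B p (lin_comb N c u) v - l p v)"
      by (rule I.residual_nonneg[OF S.lin_comb_in_V[OF uU]])
  qed
  have "\<exists>c. is_residual_minimizer U nrm (B p) (l p) N u c" if "p \<in> topspace P" for p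
  proof -
    interpret I: inf_sup_problem U nrm "B p" "l p" "usol p" \<gamma> \<theta> by (rule problem[OF that])
    show ?thesis by (rule I.residual_minimizer_exists[OF uU])
  qed
  moreover have "(\<integral>\<^sup>+p. ennreal ((nrm (\<lambda>x. lin_comb N (c p) u x - usol p x))\<^sup>2) \<partial>M) < ennreal \<epsilon> \<and>
      (\<integral>\<^sup>+p. ennreal ((dual_norm U nrm (\<lambda>v. B p (lin_comb N (c p) u) v - l p v))\<^sup>2) \<partial>M) < ennreal \<epsilon>"
    if "\<forall>p\<in>topspace P. is_residual_minimizer U nrm (B p) (l p) N u (c p)" for c
    using that bounds S.nrm_nonneg by (intro conjI small) auto
  ultimately show ?thesis
    using N uU by (intro exI[of _ N] exI[of _ u]) blast
qed

end
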